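(* Let $g\ge 1$, $i\ge 0$ and $1\le j\le g$ be integers. Then the irreducible representation $V_{i\omega_1+\omega_j}$ of $\mathfrak{sp}(2g)$ of highest weight $i\omega_1+\omega_j$ has dimension $$\dim V_{i\omega_1+\omega_j}= \binom{2g+i+1}{i,\,j}\,\frac{2g+2-2j}{2g+2+i-j}\,\frac{j}{i+j}.$$
   Context: $\mathfrak{sp}(2g)=\mathfrak{sp}(2g,\mathbb{C})$ is the symplectic Lie algebra of rank $g$, with fundamental weights $\omega_1,\dots,\omega_g$ ($\omega_k=e_1+\dots+e_k$ in the standard coordinates, so that $V_{\omega_1}$ is the standard $2g$-dimensional representation). The symbol $\binom{m}{i,j}$ denotes the trinomial coefficient $\frac{m!}{i!\,j!\,(m-i-j)!}$. *)

theory Defs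
  imports "Jordan_Normal_Form.Matrix"
begin

definition symp_form :: "nat \<Rightarrow> complex mat" where
  "symp_form g = four_block_mat (0\<^sub>m g g) (1\<^sub>m g) (- 1\<^sub>m g) (0\<^sub>m g g)"

definition sp :: "nat \<Rightarrow> complex mat set" where
  "sp g = {X \<in> carrier_mat (2 * g) (2 * g).
     transpose_mat X * symp_form g + symp_form g * X = 0\<^sub>m (2 * g) (2 * g)}"

definition lie_bracket :: "complex mat \<Rightarrow> complex mat \<Rightarrow> complex mat" where
  "lie_bracket X Y = X * Y - Y * X"

text \<open>
  The elements of the Cartan subalgebra are the matrices
  \<open>diag (t\<^sub>1, \<dots>, t\<^sub>g, - t\<^sub>1, \<dots>, - t\<^sub>g)\<close>.
  Weights are given as functionals on it; their values elsewhere play no role.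
  Matrix indices start at 0, so \<open>std_coord 0\<close>, \<dots>, \<open>std_coord (g - 1)\<close> are the
  standard coordinates \<open>e\<^sub>1, \<dots>, e\<^sub>g\<close>, whereas \<open>fund_weight k\<close> is
  \<open>\<omega>\<^sub>k = e\<^sub>1 + \<dots> + e\<^sub>k\<close> for \<open>1 \<le> k \<le> g\<close>.
\<close>

definition cartan :: "nat \<Rightarrow> complex mat set" where
  "cartan g = {H \<in> sp g. diagonal_mat H}"

type_synonym weight = "complex mat \<Rightarrow> complex"

definition std_coord :: "nat \<Rightarrow> weight" where
  "std_coord a H = H $$ (a, a)"

definition fund_weight :: "nat \<Rightarrow> weight" where
  "fund_weight k H = (\<Sum>a<k. std_coord a H)"

text \<open>The case \<open>a = b\<close> of the second set gives the long roots \<open>2 e\<^sub>a\<close>.\<close>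

definition positive_roots :: "nat \<Rightarrow> weight set" where
  "positive_roots g =
     {\<lambda>H. std_coord a H - std_coord b H | a b. a < b \<and> b < g} \<union>
     {\<lambda>H. std_coord a H + std_coord b H | a b. a \<le> b \<and> b < g}"

definition root_space :: "nat \<Rightarrow> weight \<Rightarrow> complex mat set" where
  "root_space g \<alpha> = {X \<in> sp g. \<forall>H\<in>cartan g. lie_bracket H X = \<alpha> H \<cdot>\<^sub>m X}"

locale sp_representation = vector_space scale
  for scale :: "complex \<Rightarrow> 'v::ab_group_add \<Rightarrow> 'v" +
  fixes g :: nat and \<rho> :: "complex mat \<Rightarrow> 'v \<Rightarrow> 'v"
  assumes fin_dim: "\<exists>B. finite B \<and> span B = UNIV"
    and linear_rep: "X \<in> sp g \<Longrightarrow> Vector_Spaces.linear scale scale (\<rho> X)"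
    and rep_add: "X \<in> sp g \<Longrightarrow> Y \<in> sp g \<Longrightarrow> \<rho> (X + Y) v = \<rho> X v + \<rho> Y v"
    and rep_smult: "X \<in> sp g \<Longrightarrow> \<rho> (c \<cdot>\<^sub>m X) v = scale c (\<rho> X v)"
    and rep_bracket: "X \<in> sp g \<Longrightarrow> Y \<in> sp g \<Longrightarrow>
      \<rho> (lie_bracket X Y) v = \<rho> X (\<rho> Y v) - \<rho> Y (\<rho> X v)"
begin

definition invariant_subspace :: "'v set \<Rightarrow> bool" where
  "invariant_subspace W \<longleftrightarrow> subspace W \<and> (\<forall>X\<in>sp g. \<forall>w\<in>W. \<rho> X w \<in> W)"

definition irreducible_rep :: bool where
  "irreducible_rep \<longleftrightarrow> (UNIV :: 'v set) \<noteq> {0} \<and>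
     (\<forall>W. invariant_subspace W \<longrightarrow> W = {0} \<or> W = UNIV)"

definition highest_weight_vector :: "weight \<Rightarrow> 'v \<Rightarrow> bool" where
  "highest_weight_vector \<mu> v \<longleftrightarrow> v \<noteq> 0 \<and>
     (\<forall>H\<in>cartan g. \<rho> H v = scale (\<mu> H) v) \<and>
     (\<forall>\<alpha>\<in>positive_roots g. \<forall>X\<in>root_space g \<alpha>. \<rho> X v = 0)"

definition has_highest_weight :: "weight \<Rightarrow> bool" where
  "has_highest_weight \<mu> \<longleftrightarrow> (\<exists>v. highest_weight_vector \<mu> v)"

end

definition trinomial :: "nat \<Rightarrow> nat \<Rightarrow> nat \<Rightarrow> real" where
  "trinomial m i j = fact m / (fact i * fact j * fact (m - i - j))"

end

theory Submission
  imports Defs "HOL-Library.Function_Algebras"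
begin

text \<open>
  Write \<open>n = 2 g\<close>. On polynomial differential forms on \<open>\<complex>\<^sup>n\<close>, graded by the degree \<open>i\<close> of the
  coefficients and the degree \<open>j\<close> of the form, consider the exterior derivative, the contraction
  with the symplectic bivector, and their commutator, the symplectic codifferential. These operators
  commute with the symplectic Lie algebra, and their common kernel in bidegree \<open>(i, j)\<close> contains
  \<open>x\<^sub>1\<^sup>i dx\<^sub>1 \<and> \<dots> \<and> dx\<^sub>j\<close>, a highest weight vector of weight \<open>i \<omega>\<^sub>1 + \<omega>\<^sub>j\<close>.

  The dimension of this kernel follows from three surjectivity statements: contraction with the
  bivector is onto below the middle degree, the codifferential maps primitive forms onto primitive
  coclosed ones, and the exterior derivative maps primitive coclosed forms onto closed primitive
  coclosed ones.

  The quadratic Casimir element is a scalar on the kernel. Since \<open>(\<lambda> + \<rho>, \<lambda> + \<rho>)\<close> strictly dominates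
  \<open>(\<mu> + \<rho>, \<mu> + \<rho>)\<close> for the other dominant weights \<open>\<mu>\<close> that occur, every highest weight vector in the
  kernel has weight \<open>\<lambda> = i \<omega>\<^sub>1 + \<omega>\<^sub>j\<close>. With the contravariant inner product this makes the kernel
  irreducible, and the submodule generated by a pair of highest weight vectors in the direct sum
  with an abstract irreducible representation is the graph of an isomorphism.
\<close>

section \<open>The Weyl--Clifford algebra\<close>

text \<open>Each surjectivity has an explicit candidate inverse: \<open>E\<close> for
  \<open>Lam\<close>, \<open>eps\<close> for \<open>del\<close>, \<open>io\<close> for
  \<open>d\<close>. Their commutators or anticommutators act on a bidegree by scalars, up to terms
  that vanish or can be corrected. The resulting exact sequences express the dimension of the
  primitive forms of bidegree (i, j) through the kernels of bidegrees (i, j), (i - 1, j + 1), (i -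
  1, j - 1) and (i - 2, j). This mirrors the decomposition of the i-th symmetric power of V tensored
  with the j-th fundamental representation. Induction on i then leaves a single rational identity,
  so the closed formula is verified rather than derived from roots. The proof does without weight
  space decompositions and complete reducibility. On forms they are replaced by monomials, which are
  weight vectors, by extremal choices of support, and by the adjointness of raising and lowering
  operators; in the abstract module, by a span of eigenvectors of one element of the Cartan
  subalgebra.\<close>

definition opp :: "nat \<Rightarrow> nat \<Rightarrow> nat" where
  "opp g k = (if k < g then k + g else k - g)"

lemma opp_less [simp]: "k < 2 * g \<Longrightarrow> opp g k < 2 * g"
  and opp_opp [simp]: "k < 2 * g \<Longrightarrow> opp g (opp g k) = k"
  by (auto simp: opp_def)

lemma opp_neq [simp]: "k < 2 * g \<Longrightarrow> opp g k \<noteq> k" "k < 2 * g \<Longrightarrow> k \<noteq> opp g k"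
  by (auto simp: opp_def)

lemma opp_eq_iff: "k < 2 * g \<Longrightarrow> l < 2 * g \<Longrightarrow> opp g k = l \<longleftrightarrow> k = opp g l"
  by auto

lemma opp_inj [simp]: "k < 2 * g \<Longrightarrow> l < 2 * g \<Longrightarrow> opp g k = opp g l \<longleftrightarrow> k = l"
  by (metis opp_opp)

lemma sum_opp: "(\<Sum>k<2 * g. f (opp g k)) = (\<Sum>k<2 * g. f k)"
  by (rule sum.reindex_bij_witness[of _ "opp g" "opp g"]) auto

lemma sum_pairs: "(\<Sum>k<2 * g. f k) = (\<Sum>a<g. f a + f (a + g :: nat))"
proof -
  have "{..<2 * g} = {..<g} \<union> (\<lambda>a. a + g) ` {..<g}"
  proof (intro subset_antisym subsetI)
    fix k assume "k \<in> {..<2 * g}"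
    then show "k \<in> {..<g} \<union> (\<lambda>a. a + g) ` {..<g}"
      by (cases "k < g") (auto intro!: image_eqI[of _ _ "k - g"])
  qed auto
  then have "(\<Sum>k<2 * g. f k) = (\<Sum>k<g. f k) + (\<Sum>k\<in>(\<lambda>a. a + g) ` {..<g}. f k)"
    by (simp only:) (rule sum.union_disjoint, auto)
  also have "(\<Sum>k\<in>(\<lambda>a. a + g) ` {..<g}. f k) = (\<Sum>a<g. f (a + g))"
    by (subst sum.reindex) (auto simp: inj_on_def)
  finally show ?thesis by (simp add: sum.distrib)
qed

text \<open>The relations of the Weyl algebra in \<open>x\<close>, \<open>D\<close> together with
  those of the Clifford algebra in \<open>e\<close>, \<open>c\<close>, even letters commuting with
  odd ones. In an abstract ring every operator identity becomes a computation with words.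
  \<open>halve\<close> excludes 2-torsion, so that an element equal to its own negative
  vanishes.\<close>

locale weyl_clifford =
  fixes x D e c :: "nat \<Rightarrow> 'a::ring_1" and g :: nat
  assumes xx: "x k * x l = x l * x k"
    and DD: "D k * D l = D l * D k"
    and Dx: "D k * x l = x l * D k + (if k = l then 1 else 0)"
    and ee: "e k * e l = - (e l * e k)"
    and cc: "c k * c l = - (c l * c k)"
    and ce: "c k * e l = (if k = l then 1 else 0) - e l * c k"
    and ex: "e k * x l = x l * e k"
    and eD: "e k * D l = D l * e k"
    and cx: "c k * x l = x l * c k"
    and cD: "c k * D l = D l * c k"
    and halve: "y + y = 0 \<Longrightarrow> (y :: 'a) = 0"
begin

abbreviation cj where "cj \<equiv> opp g"

text \<open>The entry of \<open>symp_form\<close> in row \<open>k\<close> and column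
  \<open>cj k\<close>, as a central element of the ring.\<close>

definition s :: "nat \<Rightarrow> 'a" where "s k = (if k < g then 1 else - 1)"

lemma s_central: "y * s k = s k * y" by (simp add: s_def)

lemma s_comm: "s l * s k = s k * s l" "x l * s k = s k * x l" "D l * s k = s k * D l"
    "e l * s k = s k * e l" "c l * s k = s k * c l"
  by (rule s_central)+

lemma s_comm': "s l * (s k * z) = s k * (s l * z)" "x l * (s k * z) = s k * (x l * z)"
    "D l * (s k * z) = s k * (D l * z)" "e l * (s k * z) = s k * (e l * z)"
    "c l * (s k * z) = s k * (c l * z)"
  by (simp_all add: s_def)

lemma s_sq [simp]: "s k * s k = 1" "s k * (s k * y) = y" by (simp_all add: s_def)
lemma s_cj [simp]: "k < 2 * g \<Longrightarrow> s (cj k) = - s k" by (auto simp: s_def opp_def)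

lemma assoc_rules:
  "D k * (x l * z) = x l * (D k * z) + (if k = l then z else 0)"
  "c k * (e l * z) = (if k = l then z else 0) - e l * (c k * z)"
  "e k * (x l * z) = x l * (e k * z)"
  "e k * (D l * z) = D l * (e k * z)"
  "c k * (x l * z) = x l * (c k * z)"
  "c k * (D l * z) = D l * (c k * z)"
  by (simp_all add: mult.assoc[symmetric] Dx ce ex eD cx cD)
     (simp_all add: algebra_simps)

text \<open>Rewriting with these rules brings every word into the order \<open>x\<close>,
  \<open>D\<close>, \<open>e\<close>, \<open>c\<close>. Letters of one kind are left alone:
  exchanging two odd letters twice restores the word, so such a rule would loop.\<close>

lemmas normal_order = Dx ce ex eD cx cD assoc_rules mult.assoc

lemma sort_rules: "x k * (x l * z) = x l * (x k * z)" "D k * (D l * z) = D l * (D k * z)"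
  "e k * (e l * z) = - (e l * (e k * z))" "c k * (c l * z) = - (c l * (c k * z))"
  by (simp_all add: mult.assoc[symmetric] xx[of k l] DD[of k l] ee[of k l] cc[of k l])

text \<open>With \<open>x\<close>, \<open>D\<close>, \<open>e\<close>, \<open>c\<close> read as multiplication, partial derivative, exterior multiplication and
  contraction, \<open>io\<close> contracts with the Euler field, \<open>Lam\<close> and \<open>E\<close> are (up to a factor) the Lefschetz
  operators, \<open>del\<close> is the symplectic codifferential and \<open>eps\<close> its adjoint.\<close>

definition N where "N = (\<Sum>k<2 * g. x k * D k)"
definition F where "F = (\<Sum>k<2 * g. e k * c k)"
definition d where "d = (\<Sum>k<2 * g. e k * D k)"
definition io where "io = (\<Sum>k<2 * g. x k * c k)"
definition Lam where "Lam = (\<Sum>k<2 * g. s k * (c k * c (cj k)))"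
definition del where "del = (\<Sum>k<2 * g. s k * (D k * c (cj k)))"
definition E where "E = (\<Sum>k<2 * g. s k * (e k * e (cj k)))"
definition eps where "eps = (\<Sum>k<2 * g. s k * (x k * e (cj k)))"

text \<open>\<open>T k l\<close> is the Lie derivative along the vector field x_k d/dx_l, i.e. the
  matrix unit (k, l) of gl(2g) acting on forms. \<open>Y k l\<close> belongs to the sum of this
  matrix unit and its image under the involution of gl(2g) whose fixed algebra is sp(2g).\<close>

definition T where "T k l = x k * D l + e k * c l"
definition Y where "Y k l = T k l - s k * s l * T (cj l) (cj k)"

lemma T_s: "T k l * s m = s m * T k l" "T k l * (s m * z) = s m * (T k l * z)"
  by (simp_all add: s_def)

section \<open>Commutation of the operators with the symplectic action\<close>

lemma Lam_x: "Lam * x m = x m * Lam"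
  and Lam_D: "Lam * D m = D m * Lam"
  and Lam_c: "Lam * c m = c m * Lam"
  by (simp_all add: Lam_def sum_distrib_left sum_distrib_right normal_order s_comm' s_comm,
      simp add: sort_rules(4)[of _ m] cc[of _ m])

lemma Lam_e: "m < 2 * g \<Longrightarrow> Lam * e m = e m * Lam - 2 * s m * c (cj m)"
proof -
  assume m: "m < 2 * g"
  have "Lam * e m = (\<Sum>k<2 * g. e m * (s k * (c k * c (cj k))) 
     + ((if k = cj m then s k * c k else 0) - (if k = m then s k * c (cj k) else 0)))"
    unfolding Lam_def sum_distrib_right
    by (rule sum.cong) (use m in \<open>auto simp: normal_order s_comm' s_comm algebra_simps opp_eq_iff\<close>)
  also have "\<dots> = e m * Lam + (s (cj m) * c (cj m) - s m * c (cj m))"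
    using m by (simp add: sum.distrib sum_subtractf sum_distrib_left Lam_def)
  finally show ?thesis using m by (simp add: algebra_simps mult_2)
qed


lemma T_x: "T k l * x m = x m * T k l + (if l = m then x k else 0)"
  and T_e: "T k l * e m = e m * T k l + (if l = m then e k else 0)"
  and T_D: "T k l * D m = D m * T k l - (if k = m then D l else 0)"
  and T_c: "T k l * c m = c m * T k l - (if k = m then c l else 0)"
  by (auto simp: T_def normal_order algebra_simps sort_rules(1)[of k m] sort_rules(2)[of l m]
      sort_rules(3)[of k m] sort_rules(4)[of l m] xx[of k m] DD[of l m] ee[of k m] cc[of l m])

lemma T_assoc:
  "T k l * (x m * z) = x m * (T k l * z) + (if l = m then x k * z else 0)"
  "T k l * (e m * z) = e m * (T k l * z) + (if l = m then e k * z else 0)"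
  "T k l * (D m * z) = D m * (T k l * z) - (if k = m then D l * z else 0)"
  "T k l * (c m * z) = c m * (T k l * z) - (if k = m then c l * z else 0)"
  by (simp_all add: mult.assoc[symmetric] T_x T_e T_D T_c) (simp_all add: algebra_simps)

lemma T_T: "T k l * T m n = T m n * T k l + (if l = m then T k n else 0) - (if k = n then T m l else 0)"
  by (subst (2 4 5) T_def) (simp add: T_def[of m n] algebra_simps T_assoc T_x T_e T_D T_c)

lemma mult_if_zero: "(a :: 'a) * (if P then b else 0) = (if P then a * b else 0)"
  by simp

lemma T_d: "k < 2 * g \<Longrightarrow> l < 2 * g \<Longrightarrow> T k l * d = d * T k l"
  by (simp add: d_def sum_distrib_left sum_distrib_right T_assoc T_D sum.distrib sum_subtractf
      algebra_simps mult_if_zero)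

text \<open>gl(2g) does not preserve the bivector. The defect found here is unchanged when (k, l) is
  replaced by (cj l, cj k) and the sign \<open>s k * s l\<close> is inserted, so it drops out of
  \<open>Y k l\<close>. The same holds for the defect in \<open>T_del\<close>.\<close>

lemma T_Lam:
  assumes "k < 2 * g" "l < 2 * g"
  shows "T k l * Lam = Lam * T k l - 2 * s k * (c l * c (cj k))"
proof -
  have "T k l * Lam = (\<Sum>m<2 * g. s m * (c m * c (cj m)) * T k l
      - ((if m = k then s m * (c l * c (cj m)) else 0) + (if m = cj k then s m * (c m * c l) else 0)))"
    unfolding Lam_def sum_distrib_left
    by (rule sum.cong)
      (use assms in \<open>auto simp: T_assoc T_c T_s s_comm' s_comm algebra_simps opp_eq_iff\<close>)
  also have "\<dots> = Lam * T k l - (s k * (c l * c (cj k)) + s (cj k) * (c (cj k) * c l))"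
    using assms by (simp add: sum_subtractf sum.distrib sum_distrib_right Lam_def)
  finally show ?thesis using assms by (simp add: cc[of "cj k" l] mult_2 algebra_simps)
qed

lemma T_del:
  assumes "k < 2 * g" "l < 2 * g"
  shows "T k l * del = del * T k l - s k * (D l * c (cj k) - D (cj k) * c l)"
proof -
  have "T k l * del = (\<Sum>m<2 * g. s m * (D m * c (cj m)) * T k l
      - ((if m = k then s m * (D l * c (cj m)) else 0) + (if m = cj k then s m * (D m * c l) else 0)))"
    unfolding del_def sum_distrib_left
    by (rule sum.cong)
      (use assms in \<open>auto simp: T_assoc T_c T_s s_comm' s_comm algebra_simps opp_eq_iff\<close>)
  also have "\<dots> = del * T k l - (s k * (D l * c (cj k)) + s (cj k) * (D (cj k) * c l))"
    using assms by (simp add: sum_subtractf sum.distrib sum_distrib_right del_def)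
  finally show ?thesis using assms by (simp add: algebra_simps)
qed

lemma Lam_s: "Lam * s m = s m * Lam" "Lam * (s m * z) = s m * (Lam * z)"
    "del * s m = s m * del" "del * (s m * z) = s m * (del * z)"
    "d * s m = s m * d" "d * (s m * z) = s m * (d * z)"
  by (simp_all add: s_def)

lemma double: "y * (2 * z) = 2 * (y * z)" for y z :: 'a
  by (simp add: mult_2 distrib_left)

lemmas s_double = double[of "s k" for k] double[of "x k" for k] double[of "D k" for k]
  double[of "e k" for k] double[of "c k" for k]

lemma Y_d: "k < 2 * g \<Longrightarrow> l < 2 * g \<Longrightarrow> Y k l * d = d * Y k l"
  by (simp only: Y_def left_diff_distrib right_diff_distrib T_d Lam_s mult.assoc opp_less)

lemma Y_Lam: "k < 2 * g \<Longrightarrow> l < 2 * g \<Longrightarrow> Y k l * Lam = Lam * Y k l"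
  by (simp only: Y_def left_diff_distrib right_diff_distrib T_Lam Lam_s mult.assoc opp_less)
     (simp add: right_diff_distrib s_double s_comm'(1) cc[of "cj k" l])

lemma Y_del: "k < 2 * g \<Longrightarrow> l < 2 * g \<Longrightarrow> Y k l * del = del * Y k l"
  by (simp only: Y_def left_diff_distrib right_diff_distrib T_del Lam_s mult.assoc opp_less)
     (simp add: right_diff_distrib s_comm'(1))

section \<open>Commutators and anticommutators among the operators\<close>

lemma N_plus_F: "d * io + io * d = N + F"
proof -
  have "d * io + io * d = (\<Sum>k<2 * g. \<Sum>l<2 * g. e k * D k * (x l * c l) + x l * c l * (e k * D k))"
    by (simp add: d_def io_def sum_product sum.distrib) (rule sum.swap)
  also have "\<dots> = (\<Sum>k<2 * g. \<Sum>l<2 * g. if k = l then e k * c k + x k * D k else 0)"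
    by (intro sum.cong refl) (auto simp: normal_order algebra_simps xx)
  finally show ?thesis by (simp add: N_def F_def sum.distrib)
qed

lemma Lam_assoc: "Lam * (x m * z) = x m * (Lam * z)" "Lam * (D m * z) = D m * (Lam * z)"
    "Lam * (c m * z) = c m * (Lam * z)"
    "m < 2 * g \<Longrightarrow> Lam * (e m * z) = e m * (Lam * z) - 2 * (s m * (c (cj m) * z))"
  by (simp_all add: mult.assoc[symmetric] Lam_x Lam_D Lam_c Lam_e)
     (simp add: left_diff_distrib mult.assoc)

lemmas Lam_rules = Lam_assoc Lam_x Lam_D Lam_c Lam_e Lam_s s_double

lemma Lam_io: "Lam * io = io * Lam"
  by (simp add: io_def sum_distrib_left sum_distrib_right mult.assoc Lam_rules)

lemma Lam_del: "Lam * del = del * Lam"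
  by (simp add: del_def sum_distrib_left sum_distrib_right mult.assoc Lam_rules)

lemma Lam_d: "Lam * d = d * Lam - 2 * del"
proof -
  have "Lam * d = (\<Sum>m<2 * g. e m * D m * Lam - 2 * (s m * (D m * c (cj m))))"
    unfolding d_def sum_distrib_left
    by (rule sum.cong) (auto simp: Lam_rules algebra_simps cD)
  then show ?thesis by (simp add: sum_subtractf d_def del_def sum_distrib_left sum_distrib_right)
qed

lemma Lam_eps: "Lam * eps = eps * Lam + 2 * io"
proof -
  have "Lam * eps = (\<Sum>m<2 * g. s m * (x m * e (cj m)) * Lam + 2 * (x m * c m))"
    unfolding eps_def sum_distrib_left
    by (rule sum.cong) (simp_all add: Lam_rules left_diff_distrib right_diff_distrib distrib_left distrib_right mult.assoc s_comm s_comm')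
  then show ?thesis by (simp add: sum.distrib eps_def io_def sum_distrib_left sum_distrib_right)
qed

lemma sum_ce: "(\<Sum>k<2 * g. c k * e k) = of_nat (2 * g) - F"
  by (simp add: F_def ce sum_subtractf)

lemma four: "4 * y = y + y + y + (y :: 'a)"
proof -
  have "(4 :: 'a) = 1 + 1 + 1 + 1" by simp
  then show ?thesis by (simp only: distrib_right mult_1_left)
qed

text \<open>The sl(2) relation of Lefschetz theory: on forms of degree j the last term is the scalar
  4 (g - j). The factor 4 arises because \<open>Lam\<close> and \<open>E\<close> both sum over all
  indices and so count every symplectic pair twice.\<close>

lemma Lam_E: "Lam * E = E * Lam - 4 * (of_nat g - F)"
proof -
  have "Lam * E = (\<Sum>m<2 * g. s m * (e m * e (cj m)) * Lam + 2 * (e m * c m) - 2 * (c (cj m) * e (cj m)))"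
    unfolding E_def sum_distrib_left
    by (rule sum.cong) (simp_all add: Lam_rules left_diff_distrib right_diff_distrib distrib_left distrib_right mult.assoc s_comm s_comm')
  also have "\<dots> = E * Lam + 2 * F - 2 * (of_nat (2 * g) - F)"
    using sum_opp[of "\<lambda>m. c m * e m" g]
    by (simp add: sum.distrib sum_subtractf E_def F_def[symmetric] sum_ce sum_distrib_left[symmetric]
        sum_distrib_right[symmetric])
  finally show ?thesis by (simp add: algebra_simps mult_2 mult_2_right four)
qed

lemma del_io: "del * io + io * del = - Lam"
proof -
  have "s k * (D k * c (cj k)) * (x l * c l) + x l * c l * (s k * (D k * c (cj k)))
      = (if k = l then - (s k * (c k * c (cj k))) else 0)" for k l
    by (auto simp: normal_order algebra_simps s_comm s_comm' cc[of "cj k" l])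
  then have "(\<Sum>k<2 * g. \<Sum>l<2 * g. s k * (D k * c (cj k)) * (x l * c l) + x l * c l * (s k * (D k * c (cj k))))
    = (\<Sum>k<2 * g. - (s k * (c k * c (cj k))))"
    by simp
  moreover have "del * io + io * del = (\<Sum>k<2 * g. \<Sum>l<2 * g. s k * (D k * c (cj k)) * (x l * c l) + x l * c l * (s k * (D k * c (cj k))))"
    by (simp add: del_def io_def sum_product sum.distrib) (rule sum.swap)
  ultimately show ?thesis by (simp add: Lam_def sum_negf)
qed

lemma del_d: "del * d + d * del = 0"
proof -
  have "del * d + d * del = (\<Sum>k<2 * g. \<Sum>l<2 * g. s k * (D k * c (cj k)) * (e l * D l) + e l * D l * (s k * (D k * c (cj k))))"
    by (simp add: del_def d_def sum_product sum.distrib) (rule sum.swap)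
  also have "\<dots> = (\<Sum>k<2 * g. \<Sum>l<2 * g. if l = cj k then s k * (D k * D (cj k)) else 0)"
    by (intro sum.cong refl) (auto simp: normal_order algebra_simps s_comm s_comm' sort_rules(2))
  also have "\<dots> = (\<Sum>k<2 * g. s k * (D k * D (cj k)))" by simp
  \<comment> \<open>Second derivatives are symmetric in \<open>k\<close> and \<open>cj k\<close>,
    while \<open>s\<close> changes sign, so each pair cancels.\<close>
  also have "\<dots> = 0" by (simp add: sum_pairs s_def opp_def DD)
  finally show ?thesis .
qed

lemma antisym_sum_eq_0:
  fixes f :: "nat \<Rightarrow> nat \<Rightarrow> 'a"
  assumes "\<And>k l. f k l = - f l k"
  shows "(\<Sum>k<n. \<Sum>l<n. f k l) = 0"
proof (rule halve)
  have "(\<Sum>k<n. \<Sum>l<n. f k l) = (\<Sum>k<n. \<Sum>l<n. - f k l)"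
    by (subst sum.swap) (intro sum.cong refl assms)
  then show "(\<Sum>k<n. \<Sum>l<n. f k l) + (\<Sum>k<n. \<Sum>l<n. f k l) = 0"
    by (simp add: sum_negf eq_neg_iff_add_eq_0)
qed

lemma d_d: "d * d = 0"
proof -
  have *: "e k * D k * (e l * D l) = D k * (D l * (e k * e l))" for k l
    by (simp add: normal_order)
  have "d * d = (\<Sum>k<2 * g. \<Sum>l<2 * g. e k * D k * (e l * D l))"
    by (simp add: d_def sum_product)
  also have "\<dots> = 0"
  proof (rule antisym_sum_eq_0)
    show "e k * D k * (e l * D l) = - (e l * D l * (e k * D k))" for k l
      unfolding * by (subst sort_rules(2), subst ee) simp
  qed
  finally show ?thesis .
qed

lemma del_del: "del * del = 0"
proof -
  let ?f = "\<lambda>k. s k * (D k * c (cj k))"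
  have *: "?f k * ?f l = s k * (s l * (D k * (D l * (c (cj k) * c (cj l)))))" for k l
    by (simp add: mult.assoc s_comm' normal_order)
  have "del * del = (\<Sum>k<2 * g. \<Sum>l<2 * g. ?f k * ?f l)"
    by (simp add: del_def sum_product)
  also have "\<dots> = 0"
  proof (rule antisym_sum_eq_0)
    show "?f k * ?f l = - (?f l * ?f k)" for k l
      unfolding * by (subst s_comm'(1), subst sort_rules(2), subst cc) simp
  qed
  finally show ?thesis .
qed

text \<open>The odd analogue of \<open>Lam_E\<close>: in bidegree (i, j) the right side is the
  scalar i + 2g - j, so that on coclosed forms \<open>eps\<close> is a right inverse of
  \<open>del\<close> up to a factor.\<close>

lemma del_eps: "del * eps + eps * del = N + of_nat (2 * g) - F"
proof -
  have "del * eps + eps * del = (\<Sum>k<2 * g. \<Sum>l<2 * g. s k * (D k * c (cj k)) * (s l * (x l * e (cj l))) + s l * (x l * e (cj l)) * (s k * (D k * c (cj k))))"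
    by (simp add: del_def eps_def sum_product sum.distrib) (rule sum.swap)
  also have "\<dots> = (\<Sum>k<2 * g. \<Sum>l<2 * g. if k = l then x k * D k + c (cj k) * e (cj k) else 0)"
    by (intro sum.cong refl) (auto simp: normal_order algebra_simps s_comm s_comm' s_def)
  also have "\<dots> = N + (of_nat (2 * g) - F)"
    using sum_opp[of "\<lambda>m. c m * e m" g] by (simp add: sum.distrib N_def sum_ce)
  finally show ?thesis by simp
qed

lemma del_E: "del * E = E * del - 2 * d"
proof -
  have "del * E - E * del = (\<Sum>k<2 * g. \<Sum>l<2 * g. s k * (D k * c (cj k)) * (s l * (e l * e (cj l))) - s l * (e l * e (cj l)) * (s k * (D k * c (cj k))))"
    by (simp add: del_def E_def sum_product sum_subtractf) (rule sum.swap)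
  also have "\<dots> = (\<Sum>k<2 * g. \<Sum>l<2 * g. (if l = k then - (D k * e k) else 0) + (if l = cj k then - (D k * e k) else 0))"
    by (intro sum.cong refl) (auto simp: normal_order algebra_simps s_comm s_comm' opp_eq_iff sort_rules(2))
  also have "\<dots> = (\<Sum>k<2 * g. - (D k * e k) - D k * e k)"
    by (intro sum.cong refl) (simp add: sum.distrib)
  also have "\<dots> = - 2 * d"
    by (simp add: sum_subtractf d_def eD sum_negf mult_2)
  finally show ?thesis by (simp add: algebra_simps)
qed


section \<open>The quadratic Casimir element\<close>

lemma T_T_casimir:
  "T k l * T l k = x k * D k * (x l * D l) + x k * D k - e k * c k * (e l * c l) + e k * c k
     - x k * c k * (e l * D l) - x l * c l * (e k * D k) + (if k = l then x k * D k + e k * c k else 0)"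
  by (auto simp: T_def normal_order algebra_simps sort_rules(2)[of k l] DD[of k l] 
      sort_rules(4)[of k l] cc[of k l])

lemma sum_T_T: "(\<Sum>k<2 * g. \<Sum>l<2 * g. T k l * T l k)
  = N * N + of_nat (2 * g + 1) * N + of_nat (2 * g + 1) * F - F * F - 2 * (io * d)"
proof -
  have "(\<Sum>k<2 * g. \<Sum>l<2 * g. x k * c k * (e l * D l)) = io * d"
    by (simp add: io_def d_def sum_product)
  moreover have "(\<Sum>k<2 * g. \<Sum>l<2 * g. x l * c l * (e k * D k)) = io * d"
    by (subst sum.swap) (simp add: io_def d_def sum_product)
  moreover have "(\<Sum>k<2 * g. \<Sum>l<2 * g. x k * D k * (x l * D l)) = N * N"
    by (simp add: N_def sum_product)
  moreover have "(\<Sum>k<2 * g. \<Sum>l<2 * g. e k * c k * (e l * c l)) = F * F"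
    by (simp add: F_def sum_product)
  moreover have "(\<Sum>k<2 * g. \<Sum>l<2 * g. x k * D k) = of_nat (2 * g) * N"
    "(\<Sum>k<2 * g. \<Sum>l<2 * g. e k * c k) = of_nat (2 * g) * F"
    by (simp_all add: N_def F_def sum_distrib_left)
  moreover have "(\<Sum>k<2 * g. \<Sum>l<2 * g. if k = l then x k * D k + e k * c k else 0) = N + F"
    by (simp add: N_def F_def sum.distrib)
  ultimately show ?thesis
    unfolding T_T_casimir sum.distrib sum_subtractf by (simp only:) (simp add: distrib_right mult_2)
qed

text \<open>Every term except the last is arranged as a function of \<open>k\<close> times a
  function of \<open>l\<close>, so that its double sum becomes a product of two single sums: zero
  for the part in \<open>x\<close> and \<open>D\<close>, then \<open>E * Lam\<close>, and twice
  \<open>eps * del\<close>.\<close>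

lemma T_T_twisted:
  assumes "k < 2 * g" "l < 2 * g"
  shows "s k * s l * (T k l * T (cj k) (cj l)) = 
    s k * (x k * x (cj k)) * (s l * (D l * D (cj l))) - s k * (e k * e (cj k)) * (s l * (c l * c (cj l)))
    + s k * (x k * e (cj k)) * (s l * (D l * c (cj l)))
    + s (cj k) * (x (cj k) * e (cj (cj k))) * (s (cj l) * (D (cj l) * c (cj (cj l))))
    - (if l = cj k then x k * D k + e k * c k else 0)"
  using assms by (auto simp: T_def normal_order algebra_simps s_comm s_comm' T_s)

lemma sum_T_T_twisted: "(\<Sum>k<2 * g. \<Sum>l<2 * g. s k * s l * (T k l * T (cj k) (cj l)))
  = 2 * (eps * del) - E * Lam - N - F"
proof -
  let ?h = "\<lambda>f h. \<Sum>k<2 * g. \<Sum>l<2 * g. (f k :: 'a) * h l"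
  have prod: "?h f h = (\<Sum>k<2 * g. f k) * (\<Sum>l<2 * g. h l)" for f h :: "nat \<Rightarrow> 'a"
    by (simp add: sum_product)
  have "(\<Sum>k<2 * g. s k * (x k * x (cj k))) = 0"
    by (simp add: sum_pairs s_def opp_def xx)
  then have "?h (\<lambda>k. s k * (x k * x (cj k))) (\<lambda>l. s l * (D l * D (cj l))) = 0"
    unfolding prod by simp
  moreover have "?h (\<lambda>k. s k * (e k * e (cj k))) (\<lambda>l. s l * (c l * c (cj l))) = E * Lam"
    unfolding prod by (simp add: E_def Lam_def)
  moreover have "?h (\<lambda>k. s k * (x k * e (cj k))) (\<lambda>l. s l * (D l * c (cj l))) = eps * del"
    unfolding prod by (simp add: eps_def del_def)
  moreover have "?h (\<lambda>k. s (cj k) * (x (cj k) * e (cj (cj k)))) (\<lambda>l. s (cj l) * (D (cj l) * c (cj (cj l)))) = eps * del"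
    unfolding prod sum_opp[of "\<lambda>k. s k * (x k * e (cj k))"] sum_opp[of "\<lambda>k. s k * (D k * c (cj k))"]
    by (simp add: eps_def del_def)
  moreover have "(\<Sum>k<2 * g. \<Sum>l<2 * g. if l = cj k then x k * D k + e k * c k else 0) = N + F"
    by (simp add: N_def F_def sum.distrib)
  moreover have "(\<Sum>k<2 * g. \<Sum>l<2 * g. s k * s l * (T k l * T (cj k) (cj l))) = 
    (\<Sum>k<2 * g. \<Sum>l<2 * g. s k * (x k * x (cj k)) * (s l * (D l * D (cj l))) - s k * (e k * e (cj k)) * (s l * (c l * c (cj l)))
    + s k * (x k * e (cj k)) * (s l * (D l * c (cj l)))
    + s (cj k) * (x (cj k) * e (cj (cj k))) * (s (cj l) * (D (cj l) * c (cj (cj l))))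
    - (if l = cj k then x k * D k + e k * c k else 0))"
    by (intro sum.cong refl T_T_twisted) auto
  ultimately show ?thesis
    by (simp only: sum.distrib sum_subtractf) (simp add: mult_2)
qed

lemma Y_Y_casimir:
  "k < 2 * g \<Longrightarrow> l < 2 * g \<Longrightarrow> Y k l * Y l k = T k l * T l k + T (cj l) (cj k) * T (cj k) (cj l)
    - s k * s l * (T k l * T (cj k) (cj l))
    - s (cj k) * s (cj l) * (T (cj l) (cj k) * T (cj (cj l)) (cj (cj k)))"
  by (simp add: Y_def algebra_simps s_comm s_comm' T_s)

text \<open>All terms other than polynomials in the degree operators end in \<open>d\<close>,
  \<open>Lam\<close> or \<open>del\<close>. On a form of bidegree (i, j) killed by these three, only
  the scalar 2 (i^2 + (2g + 2)(i + j) - j^2) remains.\<close>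

lemma casimir: "(\<Sum>k<2 * g. \<Sum>l<2 * g. Y k l * Y l k)
  = 2 * (N * N + of_nat (2 * g + 2) * N + of_nat (2 * g + 2) * F - F * F - 2 * (io * d)
      + E * Lam - 2 * (eps * del))"
proof -
  have reindex: "(\<Sum>k<2 * g. \<Sum>l<2 * g. f (cj k) (cj l)) = (\<Sum>k<2 * g. \<Sum>l<2 * g. f k l)"
    for f :: "nat \<Rightarrow> nat \<Rightarrow> 'a"
    unfolding sum_opp[of "\<lambda>l. f _ l"] by (rule sum_opp)
  have "(\<Sum>k<2 * g. \<Sum>l<2 * g. Y k l * Y l k) = (\<Sum>k<2 * g. \<Sum>l<2 * g. T k l * T l k)
    + (\<Sum>k<2 * g. \<Sum>l<2 * g. T (cj l) (cj k) * T (cj k) (cj l))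
    - (\<Sum>k<2 * g. \<Sum>l<2 * g. s k * s l * (T k l * T (cj k) (cj l)))
    - (\<Sum>k<2 * g. \<Sum>l<2 * g. s (cj k) * s (cj l) * (T (cj l) (cj k) * T (cj (cj l)) (cj (cj k))))"
    by (simp add: Y_Y_casimir sum.distrib sum_subtractf)
  also have "(\<Sum>k<2 * g. \<Sum>l<2 * g. T (cj l) (cj k) * T (cj k) (cj l)) = (\<Sum>k<2 * g. \<Sum>l<2 * g. T k l * T l k)"
    unfolding reindex[of "\<lambda>k l. T l k * T k l"] by (rule sum.swap)
  also have "(\<Sum>k<2 * g. \<Sum>l<2 * g. s (cj k) * s (cj l) * (T (cj l) (cj k) * T (cj (cj l)) (cj (cj k)))) 
    = (\<Sum>k<2 * g. \<Sum>l<2 * g. s k * s l * (T l k * T (cj l) (cj k)))"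
    by (rule reindex[of "\<lambda>k l. s k * s l * (T l k * T (cj l) (cj k))"])
  also have "\<dots> = (\<Sum>k<2 * g. \<Sum>l<2 * g. s k * s l * (T k l * T (cj k) (cj l)))"
    by (subst sum.swap) (simp add: s_comm(1))
  finally show ?thesis
    unfolding sum_T_T sum_T_T_twisted by (simp add: algebra_simps mult_2)
qed

section \<open>Brackets of the symplectic generators\<close>

lemma Y_Y_comm:
  assumes "k < 2 * g" "l < 2 * g" "k \<noteq> l"
  shows "Y k l * Y l k = Y l k * Y k l + (if l = cj k then 2 * (Y k k - Y l l) else Y k k - Y l l)"
  \<comment> \<open>For the long roots, \<open>l = cj k\<close>, the two summands of
    \<open>Y k l\<close> coincide, so \<open>Y k l\<close> is \<open>2 * T k l\<close> and the
    bracket acquires a factor 2.\<close>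
  using assms by (auto simp: Y_def algebra_simps s_comm s_comm' T_s T_T[of k l] T_T[of "cj l" "cj k"]
    T_T[of "cj k" k] T_T[of k "cj k"] opp_eq_iff mult_2)

text \<open>The eigenvalue of \<open>x m\<close> and \<open>e m\<close> under bracketing with
  \<open>Y k k\<close>: coordinate \<open>k\<close> of the weight of the basis vector
  \<open>m\<close>, as a ring element.\<close>

definition h :: "nat \<Rightarrow> nat \<Rightarrow> 'a" where
  "h k m = (if k = m then 1 else 0) - (if k = cj m then 1 else 0)"

lemma h_cj: "m < 2 * g \<Longrightarrow> h k (cj m) = - h k m"
  by (simp add: h_def)

lemma Y_diag: "k < 2 * g \<Longrightarrow> Y k k = T k k - T (cj k) (cj k)"
  by (simp add: Y_def)

lemma Y_diag_T:
  assumes "k < 2 * g" "m < 2 * g" "n < 2 * g"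
  shows "Y k k * T m n = T m n * Y k k + (h k m - h k n) * T m n"
proof -
  have "T k k * T m n = T m n * T k k + ((if k = m then 1 else 0) - (if k = n then 1 else 0)) * T m n" for k
    by (auto simp: T_T[of k k])
  then show ?thesis
    using assms unfolding Y_diag[OF assms(1)] h_def
    by (simp add: left_diff_distrib right_diff_distrib opp_eq_iff)
qed

lemma Y_diag_comm:
  assumes "k < 2 * g" "m < 2 * g" "n < 2 * g"
  shows "Y k k * Y m n = Y m n * Y k k + (h k m - h k n) * Y m n"
proof -
  have "Y k k * Y m n = Y k k * T m n - s m * s n * (Y k k * T (cj n) (cj m))"
    by (simp add: Y_def[of m n] right_diff_distrib mult.assoc s_def)
  also have "\<dots> = T m n * Y k k + (h k m - h k n) * T m n
      - s m * s n * (T (cj n) (cj m) * Y k k + (h k m - h k n) * T (cj n) (cj m))"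
    using assms by (simp add: Y_diag_T h_cj)
  also have "\<dots> = Y m n * Y k k + (h k m - h k n) * Y m n"
    by (simp add: Y_def[of m n] s_def algebra_simps)
  finally show ?thesis .
qed

text \<open>With central coefficients, matrices act through \<open>T\<close> by a Lie algebra
  homomorphism from gl(n): the coefficient on the right is an entry of the matrix
  commutator.\<close>

lemma linear_T_comm:
  assumes u: "\<And>k l y. y * u k l = u k l * y" and v: "\<And>k l y. y * v k l = v k l * y"
  shows "(\<Sum>k<n. \<Sum>l<n. u k l * T k l) * (\<Sum>k<n. \<Sum>l<n. v k l * T k l)
    - (\<Sum>k<n. \<Sum>l<n. v k l * T k l) * (\<Sum>k<n. \<Sum>l<n. u k l * T k l)
    = (\<Sum>k<n. \<Sum>l<n. ((\<Sum>m<n. u k m * v m l) - (\<Sum>m<n. v k m * u m l)) * T k l)"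
proof -
  let ?U = "\<Sum>k<n. \<Sum>l<n. u k l * T k l" and ?V = "\<Sum>k<n. \<Sum>l<n. v k l * T k l"
  have u': "y * (u k l * z) = u k l * (y * z)" for k l y z by (metis u mult.assoc)
  have v': "y * (v k l * z) = v k l * (y * z)" for k l y z by (metis v mult.assoc)
  have step: "?U * T m p = T m p * ?U + (\<Sum>k<n. u k m * T k p) - (\<Sum>l<n. u p l * T m l)"
    if "m < n" "p < n" for m p
  proof -
    have *: "u k l * T k l * T m p = T m p * (u k l * T k l) + (if l = m then u k l * T k p else 0)
        - (if k = p then u k l * T m l else 0)" for k l
      by (simp add: mult.assoc T_T[of k l m p] u'[of "T m p"] right_diff_distrib distrib_left)
    have "?U * T m p = (\<Sum>k<n. \<Sum>l<n. T m p * (u k l * T k l) + (if l = m then u k l * T k p else 0)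
        - (if k = p then u k l * T m l else 0))"
      unfolding sum_distrib_right by (intro sum.cong refl *)
    also have "\<dots> = T m p * ?U + (\<Sum>k<n. u k m * T k p) - (\<Sum>k<n. \<Sum>l<n. if k = p then u k l * T m l else 0)"
      using that by (simp add: sum.distrib sum_subtractf sum_distrib_left)
    also have "(\<Sum>k<n. \<Sum>l<n. if k = p then u k l * T m l else 0) = (\<Sum>l<n. u p l * T m l)"
      using that by (subst sum.swap) simp
    finally show ?thesis .
  qed
  have "?U * ?V = (\<Sum>m<n. \<Sum>p<n. v m p * (?U * T m p))"
    by (simp add: sum_distrib_left v')
  also have "\<dots> = (\<Sum>m<n. \<Sum>p<n. v m p * (T m p * ?U) + (\<Sum>k<n. v m p * (u k m * T k p)) - (\<Sum>l<n. v m p * (u p l * T m l)))"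
    by (intro sum.cong refl) (simp add: step algebra_simps sum_distrib_left)
  also have "\<dots> = ?V * ?U + (\<Sum>m<n. \<Sum>p<n. \<Sum>k<n. v m p * (u k m * T k p)) - (\<Sum>m<n. \<Sum>p<n. \<Sum>l<n. v m p * (u p l * T m l))"
    by (simp add: sum.distrib sum_subtractf sum_distrib_right mult.assoc)
  also have "(\<Sum>m<n. \<Sum>p<n. \<Sum>k<n. v m p * (u k m * T k p)) = (\<Sum>k<n. \<Sum>p<n. (\<Sum>m<n. u k m * v m p) * T k p)"
  proof -
    have "(\<Sum>m<n. \<Sum>p<n. \<Sum>k<n. v m p * (u k m * T k p)) = (\<Sum>m<n. \<Sum>k<n. \<Sum>p<n. u k m * v m p * T k p)"
      by (rule sum.cong[OF refl], subst sum.swap) (simp add: u' mult.assoc)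
    also have "\<dots> = (\<Sum>k<n. \<Sum>m<n. \<Sum>p<n. u k m * v m p * T k p)" by (rule sum.swap)
    also have "\<dots> = (\<Sum>k<n. \<Sum>p<n. \<Sum>m<n. u k m * v m p * T k p)"
      by (rule sum.cong[OF refl], rule sum.swap)
    finally show ?thesis by (simp add: sum_distrib_right)
  qed
  also have "(\<Sum>m<n. \<Sum>p<n. \<Sum>l<n. v m p * (u p l * T m l)) = (\<Sum>m<n. \<Sum>l<n. (\<Sum>p<n. v m p * u p l) * T m l)"
    by (rule sum.cong[OF refl], subst sum.swap) (simp add: sum_distrib_right mult.assoc)
  finally show ?thesis by (simp add: algebra_simps sum_subtractf)
qed

end

section \<open>Polynomial differential forms\<close>

text \<open>\<open>f (a, S)\<close> is the coefficient of the monomial with exponents \<open>a\<close> and differentials \<open>S\<close>.\<close>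

type_synonym form = "(nat \<Rightarrow> nat) \<times> nat set \<Rightarrow> complex"

definition fscale :: "complex \<Rightarrow> form \<Rightarrow> form" where
  "fscale a f = (\<lambda>s. a * f s)"

lemma fscale_apply [simp]: "fscale a f s = a * f s"
  by (simp add: fscale_def)

interpretation form: vector_space fscale
  by unfold_locales (auto simp: fscale_def fun_eq_iff algebra_simps)

lemma sum_form_apply: "(\<Sum>k\<in>A. f k) s = (\<Sum>k\<in>A. (f k :: form) s)"
  by (induction A rule: infinite_finite_induct) auto

text \<open>Linear endomorphisms are bundled into a type because the abstract relations are stated
  for a type of class \<open>ring_1\<close>; the product is composition.\<close>

typedef lop = "{A. Vector_Spaces.linear fscale fscale A}"
  morphisms ap Lop
  by (intro exI[of _ "\<lambda>f. f"]) (simp add: Vector_Spaces.linear_iff form.vector_space_axioms)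

setup_lifting type_definition_lop

lemma ap_linear: "Vector_Spaces.linear fscale fscale (ap A)"
  using ap by auto

lemma ap_add_right [simp]: "ap A (f + h) = ap A f + ap A h"
  and ap_scale_right [simp]: "ap A (fscale a f) = fscale a (ap A f)"
  using ap_linear[of A] by (simp_all add: Vector_Spaces.linear_iff)

interpretation fpair: vector_space_pair fscale fscale ..

lemma ap_zero_right [simp]: "ap A 0 = 0"
  and ap_diff_right [simp]: "ap A (f - h) = ap A f - ap A h"
  and ap_minus_right [simp]: "ap A (- f) = - ap A f"
  by (rule fpair.linear_0 fpair.linear_diff fpair.linear_neg, rule ap_linear)+

instantiation lop :: ring_1
begin

lift_definition zero_lop :: lop is "\<lambda>f. 0" by (simp add: Vector_Spaces.linear_iff form.vector_space_axioms)
lift_definition one_lop :: lop is "\<lambda>f. f" by (simp add: Vector_Spaces.linear_iff form.vector_space_axioms)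
lift_definition plus_lop :: "lop \<Rightarrow> lop \<Rightarrow> lop" is "\<lambda>A B f. A f + B f"
  by (simp add: fpair.linear_compose_add)
lift_definition minus_lop :: "lop \<Rightarrow> lop \<Rightarrow> lop" is "\<lambda>A B f. A f - B f"
  by (simp add: fpair.linear_compose_sub)
lift_definition uminus_lop :: "lop \<Rightarrow> lop" is "\<lambda>A f. - A f"
  by (simp add: fpair.linear_compose_neg)
lift_definition times_lop :: "lop \<Rightarrow> lop \<Rightarrow> lop" is "\<lambda>A B f. A (B f)"
  by (auto simp: Vector_Spaces.linear_iff)

instance
proof
  show "(0::lop) \<noteq> 1"
  proof
    assume "(0::lop) = 1"
    from arg_cong[OF this, of "\<lambda>A. ap A (\<lambda>s. 1)"] have "(0::form) = (\<lambda>s. 1)"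
      by (simp add: zero_lop.rep_eq one_lop.rep_eq)
    then show False by (metis zero_fun_apply zero_neq_one)
  qed
qed (transfer; auto simp: Vector_Spaces.linear_iff)+

end

lemma ap_add [simp]: "ap (A + B) f = ap A f + ap B f"
  and ap_diff [simp]: "ap (A - B) f = ap A f - ap B f"
  and ap_minus [simp]: "ap (- A) f = - ap A f"
  and ap_mult [simp]: "ap (A * B) f = ap A (ap B f)"
  and ap_zero [simp]: "ap 0 f = 0"
  and ap_one [simp]: "ap 1 f = f"
  by (simp_all add: plus_lop.rep_eq minus_lop.rep_eq uminus_lop.rep_eq times_lop.rep_eq
      zero_lop.rep_eq one_lop.rep_eq)

lemma lop_eqI: "(\<And>f. ap A f = ap B f) \<Longrightarrow> A = B"
  by (meson ap_inject ext)

lemma ap_sum: "ap (sum u K) f = (\<Sum>k\<in>K. ap (u k) f)"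
  by (induction K rule: infinite_finite_induct) auto

lift_definition sc :: "complex \<Rightarrow> lop" is "\<lambda>a f. fscale a f"
  by (auto simp: Vector_Spaces.linear_iff form.vector_space_axioms fun_eq_iff algebra_simps)

lemma ap_sc [simp]: "ap (sc a) f = fscale a f"
  by (simp add: sc.rep_eq)

lemma sc_central: "A * sc a = sc a * A"
  by (rule lop_eqI) simp

lemma sc_hom: "sc (a + b) = sc a + sc b" "sc (a * b) = sc a * sc b" "sc 0 = 0" "sc 1 = 1"
    "sc (a - b) = sc a - sc b" "sc (- a) = - sc a"
  by (auto intro!: lop_eqI simp: fun_eq_iff algebra_simps)

lemma sc_sum: "sc (sum u K) = (\<Sum>k\<in>K. sc (u k))"
  by (induction K rule: infinite_finite_induct) (auto simp: sc_hom)

lemma of_nat_lop: "of_nat n = sc (of_nat n)"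
  by (induction n) (auto simp: sc_hom)

lemma numeral_lop: "numeral n = sc (numeral n)"
  by (metis of_nat_lop of_nat_numeral)

text \<open>The sign of moving dx_k past the differentials of smaller index, wedge monomials being
  written in increasing order.\<close>

definition sg :: "nat \<Rightarrow> nat set \<Rightarrow> complex" where
  "sg k S = (- 1) ^ card {l \<in> S. l < k}"

lemma sg_diff: "sg k (S - {l}) = (if l \<in> S \<and> l < k then - sg k S else sg k S)"
proof (cases "l \<in> S \<and> l < k")
  case True
  then have "{m \<in> S. m < k} = insert l {m \<in> S - {l}. m < k}" by auto
  then have "card {m \<in> S. m < k} = Suc (card {m \<in> S - {l}. m < k})" by simp
  then show ?thesis using True by (simp add: sg_def)
next
  case False
  then have "{m \<in> S. m < k} = {m \<in> S - {l}. m < k}" by auto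
  then show ?thesis using False by (simp add: sg_def)
qed

lemma sg_insert: "sg k (insert l S) = (if l \<notin> S \<and> l < k then - sg k S else sg k S)"
proof (cases "l \<in> S")
  case False
  then have "sg k S = sg k (insert l S - {l})" by simp
  then show ?thesis using False unfolding sg_diff by auto
qed (simp add: insert_absorb)

lemma sg_sq [simp]: "sg k S * sg k S = 1" "sg k S * (sg k S * z) = z"
  by (simp_all add: sg_def mult.assoc[symmetric] power_mult_distrib[symmetric])

lemma cnj_sg [simp]: "cnj (sg k S) = sg k S"
  by (simp add: sg_def)

text \<open>The operators are given by the coefficients of their result, so multiplication looks up
  a smaller exponent and differentiation a larger one; likewise \<open>wedge\<close> removes an
  index and \<open>contr\<close> inserts one. Forms may have infinite support; finiteness enters
  with the bihomogeneous components.\<close>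

lift_definition mulx :: "nat \<Rightarrow> lop" is
  "\<lambda>k f s. if fst s k = 0 then 0 else f ((fst s)(k := fst s k - 1), snd s)"
  by (auto simp: Vector_Spaces.linear_iff form.vector_space_axioms fun_eq_iff)

lift_definition ddx :: "nat \<Rightarrow> lop" is
  "\<lambda>k f s. of_nat (Suc (fst s k)) * f ((fst s)(k := Suc (fst s k)), snd s)"
  by (auto simp: Vector_Spaces.linear_iff form.vector_space_axioms fun_eq_iff algebra_simps)

lift_definition wedge :: "nat \<Rightarrow> lop" is
  "\<lambda>k f s. if k \<in> snd s then sg k (snd s) * f (fst s, snd s - {k}) else 0"
  by (auto simp: Vector_Spaces.linear_iff form.vector_space_axioms fun_eq_iff algebra_simps)

lift_definition contr :: "nat \<Rightarrow> lop" is
  "\<lambda>k f s. if k \<in> snd s then 0 else sg k (snd s) * f (fst s, insert k (snd s))"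
  by (auto simp: Vector_Spaces.linear_iff form.vector_space_axioms fun_eq_iff algebra_simps)

lemmas op_apply = mulx.rep_eq ddx.rep_eq wedge.rep_eq contr.rep_eq

interpretation wc: weyl_clifford mulx ddx wedge contr g for g
proof
  fix k l
  show "mulx k * mulx l = mulx l * mulx k"
    by (rule lop_eqI) (auto simp: fun_eq_iff op_apply fun_upd_twist)
  show "ddx k * ddx l = ddx l * ddx k"
    by (rule lop_eqI) (auto simp: fun_eq_iff op_apply fun_upd_twist)
  show "ddx k * mulx l = mulx l * ddx k + (if k = l then 1 else 0)"
    by (rule lop_eqI) (auto simp: fun_eq_iff op_apply fun_upd_twist algebra_simps)
  show "wedge k * wedge l = - (wedge l * wedge k)"
    by (rule lop_eqI) (auto simp: fun_eq_iff op_apply sg_diff Diff_insert2[symmetric] insert_commute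
        intro!: arg_cong[where f="\<lambda>S. _ * (_ * _ (_, S))"])
  show "contr k * contr l = - (contr l * contr k)"
    by (rule lop_eqI) (auto simp: fun_eq_iff op_apply sg_insert insert_commute)
  show "contr k * wedge l = (if k = l then 1 else 0) - wedge l * contr k"
    by (rule lop_eqI) (auto simp: fun_eq_iff op_apply sg_insert sg_diff insert_absorb insert_Diff_if)
  show "wedge k * mulx l = mulx l * wedge k"
    by (rule lop_eqI) (auto simp: fun_eq_iff op_apply)
  show "wedge k * ddx l = ddx l * wedge k"
    by (rule lop_eqI) (auto simp: fun_eq_iff op_apply)
  show "contr k * mulx l = mulx l * contr k"
    by (rule lop_eqI) (auto simp: fun_eq_iff op_apply)
  show "contr k * ddx l = ddx l * contr k"
    by (rule lop_eqI) (auto simp: fun_eq_iff op_apply)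
next
  fix A :: lop assume "A + A = 0"
  then have "ap A f + ap A f = 0" for f by (metis ap_add ap_zero)
  then show "A = 0" by (intro lop_eqI) (auto simp: fun_eq_iff)
qed

section \<open>Rank and dimension inside finitely spanned subspaces\<close>

lemma (in vector_space) span_Int_disjoint:
  assumes "independent B" "C \<subseteq> B" "x \<in> span C" "x \<in> span (B - C)"
  shows "x = 0"
proof -
  have "representation B x = representation C x" "representation B x = representation (B - C) x"
    using assms by (auto intro!: representation_extend)
  then have "{b. representation B x b \<noteq> 0} = {}"
    using representation_ne_zero[of C x] representation_ne_zero[of "B - C" x] by fastforce
  moreover have "x \<in> span B" using assms span_mono by blast
  ultimately show ?thesis
    using sum_nonzero_representation_eq[OF assms(1), of x] by simp
qed

text \<open>Rank-nullity relative to a subspace: the space of all forms is infinite-dimensional, so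
  finiteness is supplied by the spanning set \<open>C\<close>. A basis of the kernel is extended to
  one of \<open>U\<close>, and \<open>f\<close> is injective on the span of the added
  vectors.\<close>

lemma (in vector_space_pair) dim_kernel_plus_image:
  assumes f: "Vector_Spaces.linear s1 s2 f" and U: "vs1.subspace U" "U \<subseteq> vs1.span C" "finite C"
  shows "vs1.dim U = vs1.dim {x \<in> U. f x = 0} + vs2.dim (f ` U)"
proof -
  let ?K = "{x \<in> U. f x = 0}"
  obtain A where A: "A \<subseteq> ?K" "vs1.independent A" "?K \<subseteq> vs1.span A"
    using vs1.maximal_independent_subset by blast
  obtain B where B: "A \<subseteq> B" "B \<subseteq> U" "vs1.independent B" "U \<subseteq> vs1.span B"
    using vs1.maximal_independent_subset_extend[of A U] A by blast
  have "finite B" using vs1.independent_span_bound[of C B] U B by blast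
  have inj: "inj_on f (vs1.span (B - A))"
  proof (subst linear_inj_on_iff_eq_0[OF f vs1.subspace_span], intro ballI impI)
    fix x assume x: "x \<in> vs1.span (B - A)" "f x = 0"
    have "vs1.span (B - A) \<subseteq> U"
      using B U(1) by (intro vs1.span_minimal) auto
    then have "x \<in> vs1.span A" using x A by blast
    then show "x = 0" using vs1.span_Int_disjoint[OF B(3,1)] x by blast
  qed
  have "vs2.independent (f ` (B - A))"
    using linear_independent_injective_image[OF f _ inj] vs1.independent_mono[OF B(3)] by blast
  moreover have "f ` U \<subseteq> vs2.span (f ` (B - A))"
  proof -
    have "f ` U \<subseteq> f ` vs1.span B" using B by blast
    also have "\<dots> = vs2.span (f ` B)" by (simp add: linear_span_image[OF f])
    also have "\<dots> \<subseteq> vs2.span (f ` (B - A))"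
    proof (intro vs2.span_minimal subsetI)
      fix y assume "y \<in> f ` B"
      then obtain b where "b \<in> B" "y = f b" by blast
      moreover have "f b = 0" if "b \<in> A" using that A by blast
      ultimately show "y \<in> vs2.span (f ` (B - A))"
        by (cases "b \<in> A") (auto intro: vs2.span_base vs2.span_zero)
    qed auto
    finally show ?thesis .
  qed
  ultimately have "card (f ` (B - A)) = vs2.dim (f ` U)"
    using B by (intro vs2.basis_card_eq_dim) auto
  moreover have "card (f ` (B - A)) = card (B - A)"
    using inj by (intro card_image inj_on_subset[OF inj] vs1.span_superset)
  moreover have "card A = vs1.dim ?K" "card B = vs1.dim U"
    using A B by (auto intro!: vs1.basis_card_eq_dim)
  moreover have "card B = card A + card (B - A)"
    using B \<open>finite B\<close> by (metis card_Diff_subset card_mono finite_subset le_add_diff_inverse)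
  ultimately show ?thesis by simp
qed

lemma (in vector_space) subspace_eq_if_dim_eq:
  assumes "subspace U" "U \<subseteq> W" "W \<subseteq> span C" "finite C" "dim W \<le> dim U"
  shows "U = W"
proof -
  obtain A where A: "A \<subseteq> U" "independent A" "U \<subseteq> span A"
    using maximal_independent_subset by blast
  obtain B where B: "A \<subseteq> B" "B \<subseteq> W" "independent B" "W \<subseteq> span B"
    using maximal_independent_subset_extend[of A W] A assms(2) by blast
  have "finite B" using independent_span_bound[of C B] assms B by blast
  moreover have "card A = dim U" "card B = dim W"
    using A B by (auto intro!: basis_card_eq_dim)
  ultimately have "A = B" using B assms(5) by (metis card_seteq)
  then show ?thesis using A B assms by (meson span_minimal subset_antisym subset_trans)
qed

section \<open>Bihomogeneous components and their dimensions\<close>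

definition idx :: "nat \<Rightarrow> nat \<Rightarrow> nat \<Rightarrow> ((nat \<Rightarrow> nat) \<times> nat set) set" where
  "idx n i j = {a. (\<forall>k\<ge>n. a k = 0) \<and> (\<Sum>k<n. a k) = i} \<times> {S. S \<subseteq> {..<n} \<and> card S = j}"

lemma bij_betw_exponents:
  "bij_betw (\<lambda>a. map a [0..<n]) {a. (\<forall>k\<ge>n. a k = 0) \<and> (\<Sum>k<n. a k) = i}
    {l :: nat list. length l = n \<and> sum_list l = i}"
proof (rule bij_betw_byWitness[where f' = "\<lambda>l k. if k < n then l ! k else 0"])
  show "(\<lambda>a. map a [0..<n]) ` {a. (\<forall>k\<ge>n. a k = 0) \<and> (\<Sum>k<n. a k) = i}
      \<subseteq> {l :: nat list. length l = n \<and> sum_list l = i}"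
    by (auto simp: interv_sum_list_conv_sum_set_nat atLeast0LessThan)
  show "(\<lambda>l k. if k < n then l ! k else 0) ` {l :: nat list. length l = n \<and> sum_list l = i}
      \<subseteq> {a. (\<forall>k\<ge>n. a k = 0) \<and> (\<Sum>k<n. a k) = i}"
    by (auto simp: sum_list_sum_nth atLeast0LessThan)
qed (auto simp: fun_eq_iff intro!: nth_equalityI)

lemma finite_lists_sum: "finite {l :: nat list. length l = n \<and> sum_list l = i}"
proof (rule finite_subset)
  show "{l :: nat list. length l = n \<and> sum_list l = i} \<subseteq> {l. set l \<subseteq> {..i} \<and> length l = n}"
    using member_le_sum_list by auto
qed (rule finite_lists_length_eq, simp)

lemma finite_idx [simp]: "finite (idx n i j)"
  using bij_betw_finite[OF bij_betw_exponents] finite_lists_sum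
  by (auto simp: idx_def intro!: finite_cartesian_product)

lemma card_idx: "card (idx n i j) = ((n + i - 1) choose i) * (n choose j)"
  using bij_betw_same_card[OF bij_betw_exponents, of n i] n_subsets[of "{..<n}" j]
  by (simp add: idx_def card_cartesian_product card_length_sum_list add.commute)

definition homog :: "nat \<Rightarrow> nat \<Rightarrow> nat \<Rightarrow> form set" where
  "homog n i j = {f. \<forall>s. s \<notin> idx n i j \<longrightarrow> f s = 0}"

lemma subspace_homog: "form.subspace (homog n i j)"
  by (auto simp: form.subspace_def homog_def)

definition delta :: "(nat \<Rightarrow> nat) \<times> nat set \<Rightarrow> form" where
  "delta s t = (if t = s then 1 else 0)"

lemma homog_expand:
  assumes "f \<in> homog n i j" 
  shows "f = (\<Sum>s\<in>idx n i j. fscale (f s) (delta s))"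
  using assms by (auto simp: fun_eq_iff sum_form_apply homog_def delta_def if_distrib cong: if_cong)

lemma homog_span: "homog n i j \<subseteq> form.span (delta ` idx n i j)"
proof
  fix f assume "f \<in> homog n i j"
  then have "f = (\<Sum>s\<in>idx n i j. fscale (f s) (delta s))" by (rule homog_expand)
  also have "\<dots> \<in> form.span (delta ` idx n i j)"
    by (intro form.span_sum form.span_scale form.span_base imageI)
  finally show "f \<in> form.span (delta ` idx n i j)" .
qed

lemma inj_delta: "inj delta"
  by (auto simp: inj_def delta_def fun_eq_iff split: if_splits)

lemma dim_homog: "form.dim (homog n i j) = ((n + i - 1) choose i) * (n choose j)"
proof -
  have "form.independent (delta ` idx n i j)"
  proof (subst form.dependent_finite, simp, rule notI, elim exE conjE bexE)
    fix u v assume v: "v \<in> delta ` idx n i j" "u v \<noteq> 0"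
      and 0: "(\<Sum>v\<in>delta ` idx n i j. fscale (u v) v) = 0"
    then obtain s where s: "s \<in> idx n i j" "v = delta s" by blast
    have "0 = (\<Sum>v\<in>delta ` idx n i j. fscale (u v) v) s" by (simp add: 0)
    also have "\<dots> = (\<Sum>t\<in>idx n i j. u (delta t) * delta t s)"
      by (subst sum.reindex) (auto simp: sum_form_apply intro: inj_on_subset[OF inj_delta])
    also have "\<dots> = u v" using s by (simp add: delta_def if_distrib cong: if_cong)
    finally show False using v by simp
  qed
  then have "card (delta ` idx n i j) = form.dim (homog n i j)"
    by (intro form.basis_card_eq_dim homog_span) (auto simp: homog_def delta_def)
  then show ?thesis
    by (simp add: card_image inj_on_subset[OF inj_delta] card_idx)
qed

lemma sum_fun_upd: "(k :: nat) < n \<Longrightarrow> (\<Sum>m<n. (a(k := (v :: nat))) m) + a k = (\<Sum>m<n. a m) + v"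
proof -
  assume k: "k < n"
  have "(\<Sum>m<n. b m) = b k + (\<Sum>m\<in>{..<n} - {k}. b m)" for b :: "nat \<Rightarrow> nat"
    using k by (intro sum.remove) auto
  from this[of a] this[of "a(k := v)"] show ?thesis by simp
qed

lemma idx_Suc_fst:
  "k < n \<Longrightarrow> (a(k := Suc (a k)), S) \<in> idx n i j \<longleftrightarrow> i > 0 \<and> (a, S) \<in> idx n (i - 1) j"
  using sum_fun_upd[of k n a "Suc (a k)"] by (auto simp: idx_def split: if_splits)

lemma idx_pred_fst:
  "k < n \<Longrightarrow> 0 < a k \<Longrightarrow> (a(k := a k - Suc 0), S) \<in> idx n i j \<longleftrightarrow> (a, S) \<in> idx n (Suc i) j"
  using idx_Suc_fst[of k n "a(k := a k - Suc 0)" S "Suc i" j] by simp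

lemma idx_insert_snd:
  "k < n \<Longrightarrow> k \<notin> S \<Longrightarrow> (a, insert k S) \<in> idx n i j \<longleftrightarrow> j > 0 \<and> (a, S) \<in> idx n i (j - 1)"
  using finite_subset[of S "{..<n}"] by (auto simp: idx_def)

lemma idx_remove_snd:
  "k < n \<Longrightarrow> k \<in> S \<Longrightarrow> (a, S - {k}) \<in> idx n i j \<longleftrightarrow> (a, S) \<in> idx n i (Suc j)"
  using idx_insert_snd[of k n "S - {k}" a i "Suc j"] by (simp add: insert_absorb)

lemma mulx_homog: "k < n \<Longrightarrow> f \<in> homog n i j \<Longrightarrow> ap (mulx k) f \<in> homog n (Suc i) j"
  by (auto simp: homog_def op_apply idx_pred_fst)

text \<open>For \<open>i = 0\<close> the degree \<open>i - 1\<close> is truncated to 0; the claim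
  survives because the derivative is then zero, which \<open>ddx_homog_0\<close> records separately.
  The same convention is used for \<open>contr\<close>.\<close>

lemma ddx_homog: "k < n \<Longrightarrow> f \<in> homog n i j \<Longrightarrow> ap (ddx k) f \<in> homog n (i - 1) j"
  by (auto simp: homog_def op_apply idx_Suc_fst)

lemma ddx_homog_0: "k < n \<Longrightarrow> f \<in> homog n 0 j \<Longrightarrow> ap (ddx k) f = 0"
  by (auto simp: homog_def op_apply idx_Suc_fst fun_eq_iff)

lemma wedge_homog: "k < n \<Longrightarrow> f \<in> homog n i j \<Longrightarrow> ap (wedge k) f \<in> homog n i (Suc j)"
  by (auto simp: homog_def op_apply idx_remove_snd)

lemma contr_homog: "k < n \<Longrightarrow> f \<in> homog n i j \<Longrightarrow> ap (contr k) f \<in> homog n i (j - 1)"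
  by (auto simp: homog_def op_apply idx_insert_snd)

lemma contr_homog_0: "k < n \<Longrightarrow> f \<in> homog n i 0 \<Longrightarrow> ap (contr k) f = 0"
  by (auto simp: homog_def op_apply idx_insert_snd fun_eq_iff)

text \<open>The Fischer inner product: the factorial weight makes multiplication by x_k adjoint to
  differentiation along x_k. Wedge monomials are orthonormal, so \<open>wedge k\<close> is adjoint
  to \<open>contr k\<close>.\<close>

definition ip :: "nat \<Rightarrow> nat \<Rightarrow> nat \<Rightarrow> form \<Rightarrow> form \<Rightarrow> complex" where
  "ip n i j f h = (\<Sum>s\<in>idx n i j. (\<Prod>k<n. fact (fst s k)) * f s * cnj (h s))"

lemma ip_left: "ip n i j (f + f') h = ip n i j f h + ip n i j f' h"
    "ip n i j (f - f') h = ip n i j f h - ip n i j f' h"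
    "ip n i j (- f) h = - ip n i j f h"
    "ip n i j (fscale a f) h = a * ip n i j f h" "ip n i j 0 h = 0"
  and ip_right: "ip n i j h (f + f') = ip n i j h f + ip n i j h f'"
    "ip n i j h (f - f') = ip n i j h f - ip n i j h f'"
    "ip n i j h (- f) = - ip n i j h f"
    "ip n i j h (fscale a f) = cnj a * ip n i j h f" "ip n i j h 0 = 0"
  by (simp_all add: ip_def algebra_simps sum.distrib sum_subtractf sum_negf sum_distrib_left)

lemma ip_sum_left: "ip n i j (sum u K) h = (\<Sum>k\<in>K. ip n i j (u k) h)"
  and ip_sum_right: "ip n i j h (sum u K) = (\<Sum>k\<in>K. ip n i j h (u k))"
  by (induction K rule: infinite_finite_induct) (auto simp: ip_left ip_right)

lemma ip_cnj: "ip n i j f h = cnj (ip n i j h f)"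
  by (simp add: ip_def algebra_simps)

lemma ip_self: "ip n i j f f = of_real (\<Sum>s\<in>idx n i j. (\<Prod>k<n. fact (fst s k)) * (cmod (f s))\<^sup>2)"
  by (auto simp: ip_def mult.assoc complex_mult_cnj cmod_power2 simp del: of_real_add of_real_power intro!: sum.cong)

lemma ip_self_nonneg: "Re (ip n i j f f) \<ge> 0" "Im (ip n i j f f) = 0"
  unfolding ip_self Re_complex_of_real Im_complex_of_real
  by (auto intro!: sum_nonneg mult_nonneg_nonneg prod_nonneg)

lemma ip_self_eq_0: "f \<in> homog n i j \<Longrightarrow> ip n i j f f = 0 \<Longrightarrow> f = 0"
proof
  fix s assume f: "f \<in> homog n i j" and 0: "ip n i j f f = 0"
  then have "(\<Sum>s\<in>idx n i j. (\<Prod>k<n. fact (fst s k)) * (cmod (f s))\<^sup>2) = (0 :: real)"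
    unfolding ip_self using of_real_eq_0_iff by blast
  then have "\<forall>s\<in>idx n i j. (\<Prod>k<n. fact (fst s k)) * (cmod (f s))\<^sup>2 = (0 :: real)"
    by (subst (asm) sum_nonneg_eq_0_iff) (auto intro!: mult_nonneg_nonneg prod_nonneg)
  then show "f s = 0 s" using f by (cases "s \<in> idx n i j") (simp_all add: homog_def del: split_paired_All)
qed

lemma ip_mulx:
  assumes k: "k < n"
  shows "ip n (Suc i) j (ap (mulx k) f) h = ip n i j f (ap (ddx k) h)"
proof -
  have "ip n (Suc i) j (ap (mulx k) f) h = (\<Sum>s\<in>{s \<in> idx n (Suc i) j. fst s k \<noteq> 0}.
      (\<Prod>m<n. fact (fst s m)) * f ((fst s)(k := fst s k - 1), snd s) * cnj (h s))"
    unfolding ip_def by (rule sum.mono_neutral_cong_right) (auto simp: op_apply)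
  also have "\<dots> = ip n i j f (ap (ddx k) h)"
    unfolding ip_def
  proof (rule sum.reindex_bij_witness[where
        i = "\<lambda>s. ((fst s)(k := Suc (fst s k)), snd s)" and j = "\<lambda>s. ((fst s)(k := fst s k - 1), snd s)"])
    fix s assume s: "s \<in> {s \<in> idx n (Suc i) j. fst s k \<noteq> 0}"
    obtain a S where [simp]: "s = (a, S)" by fastforce
    have "(\<Prod>m<n. fact (a m) :: complex) = fact (a k) * (\<Prod>m\<in>{..<n} - {k}. fact (a m))"
      using k by (intro prod.remove) auto
    moreover have "(\<Prod>m<n. fact ((a(k := a k - 1)) m) :: complex) =
        fact (a k - 1) * (\<Prod>m\<in>{..<n} - {k}. fact (a m))"
      using k by (subst prod.remove[of _ k]) auto
    ultimately show "(\<Prod>m<n. fact (fst ((fst s)(k := fst s k - 1), snd s) m))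
        * f ((fst s)(k := fst s k - 1), snd s) * cnj (ap (ddx k) h ((fst s)(k := fst s k - 1), snd s))
      = (\<Prod>m<n. fact (fst s m)) * f ((fst s)(k := fst s k - 1), snd s) * cnj (h s)"
      using s by (cases "a k") (auto simp: op_apply fact_Suc fun_upd_idem)
  qed (use k in \<open>auto simp: idx_pred_fst idx_Suc_fst\<close>)
  finally show ?thesis .
qed

lemma ip_wedge:
  assumes k: "k < n"
  shows "ip n i (Suc j) (ap (wedge k) f) h = ip n i j f (ap (contr k) h)"
proof -
  have "ip n i (Suc j) (ap (wedge k) f) h = (\<Sum>s\<in>{s \<in> idx n i (Suc j). k \<in> snd s}.
      (\<Prod>m<n. fact (fst s m)) * (sg k (snd s) * f (fst s, snd s - {k})) * cnj (h s))"
    unfolding ip_def by (rule sum.mono_neutral_cong_right) (auto simp: op_apply)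
  also have "\<dots> = (\<Sum>s\<in>{s \<in> idx n i j. k \<notin> snd s}.
      (\<Prod>m<n. fact (fst s m)) * f s * cnj (ap (contr k) h s))"
    by (rule sum.reindex_bij_witness[where
        i = "\<lambda>s. (fst s, insert k (snd s))" and j = "\<lambda>s. (fst s, snd s - {k})"])
      (use k in \<open>auto simp: idx_remove_snd idx_insert_snd op_apply sg_diff insert_absorb\<close>)
  also have "\<dots> = ip n i j f (ap (contr k) h)"
    unfolding ip_def by (rule sum.mono_neutral_left) (auto simp: op_apply)
  finally show ?thesis .
qed

lemma ip_ddx: "k < n \<Longrightarrow> ip n i j (ap (ddx k) f) h = ip n (Suc i) j f (ap (mulx k) h)"
  and ip_contr: "k < n \<Longrightarrow> ip n i j (ap (contr k) f) h = ip n i (Suc j) f (ap (wedge k) h)"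
  by (metis ip_cnj ip_mulx, metis ip_cnj ip_wedge)

lemma T_homog:
  assumes "k < n" "l < n" "f \<in> homog n i j"
  shows "ap (wc.T k l) f \<in> homog n i j"
proof -
  have "ap (mulx k) (ap (ddx l) f) \<in> homog n i j"
    using mulx_homog[OF assms(1) ddx_homog[OF assms(2,3)]] ddx_homog_0[of l n f j] assms
    by (cases i) (auto simp: homog_def)
  moreover have "ap (wedge k) (ap (contr l) f) \<in> homog n i j"
    using wedge_homog[OF assms(1) contr_homog[OF assms(2,3)]] contr_homog_0[of l n f i] assms
    by (cases j) (auto simp: homog_def)
  ultimately show ?thesis
    unfolding wc.T_def by (simp add: form.subspace_add[OF subspace_homog])
qed

lemma ip_T:
  assumes "k < n" "l < n" "f \<in> homog n i j" "h \<in> homog n i j"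
  shows "ip n i j (ap (wc.T k l) f) h = ip n i j f (ap (wc.T l k) h)"
proof -
  have "ip n i j (ap (mulx k) (ap (ddx l) f)) h = ip n i j f (ap (mulx l) (ap (ddx k) h))"
  \<comment> \<open>The adjunction passes through degree \<open>i - 1\<close>; in degree 0 both
    sides vanish.\<close>
  proof (cases i)
    case 0
    then show ?thesis using assms by (simp add: ddx_homog_0 ip_left ip_right)
  qed (simp add: ip_mulx ip_ddx assms)
  moreover have "ip n i j (ap (wedge k) (ap (contr l) f)) h = ip n i j f (ap (wedge l) (ap (contr k) h))"
  proof (cases j)
    case 0
    then show ?thesis using assms by (simp add: contr_homog_0 ip_left ip_right)
  qed (simp add: ip_wedge ip_contr assms)
  ultimately show ?thesis by (simp add: wc.T_def ip_left ip_right)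
qed

section \<open>Primitive, coclosed and harmonic forms\<close>

lemma (in weyl_clifford) io_io: "io * io = 0"
proof -
  have *: "x k * c k * (x l * c l) = x k * (x l * (c k * c l))" for k l
    by (simp add: normal_order)
  have "io * io = (\<Sum>k<2 * g. \<Sum>l<2 * g. x k * c k * (x l * c l))"
    by (simp add: io_def sum_product)
  also have "\<dots> = 0"
  proof (rule antisym_sum_eq_0)
    show "x k * c k * (x l * c l) = - (x l * c l * (x k * c k))" for k l
      unfolding * by (subst sort_rules(1), subst cc) simp
  qed
  finally show ?thesis .
qed

lemma ap_of_nat [simp]: "ap (of_nat m) f = fscale (of_nat m) f"
  and ap_numeral [simp]: "ap (numeral w) f = fscale (numeral w) f"
  by (simp_all add: of_nat_lop numeral_lop)

definition sn :: "nat \<Rightarrow> nat \<Rightarrow> complex" where "sn g k = (if k < g then 1 else - 1)"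

lemma ap_s [simp]: "ap (wc.s g k) f = fscale (sn g k) f"
  by (simp add: wc.s_def sn_def fun_eq_iff)

lemma cnj_sn [simp]: "cnj (sn g k) = sn g k"
  by (simp add: sn_def)

lemmas homog_closed = form.subspace_add[OF subspace_homog] form.subspace_scale[OF subspace_homog]
  form.subspace_sum[OF subspace_homog] form.subspace_0[OF subspace_homog]
  form.subspace_diff[OF subspace_homog] form.subspace_neg[OF subspace_homog]

lemma N_homog: "f \<in> homog (2 * g) i j \<Longrightarrow> ap (wc.N g) f = fscale (of_nat i) f"
proof
  fix s assume f: "f \<in> homog (2 * g) i j"
  have "ap (mulx k) (ap (ddx k) f) s = of_nat (fst s k) * f s" for k
    by (cases "fst s k") (auto simp: op_apply fun_upd_idem)
  then have "ap (wc.N g) f s = of_nat (\<Sum>k<2 * g. fst s k) * f s"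
    by (simp add: wc.N_def ap_sum sum_form_apply sum_distrib_right)
  also have "\<dots> = of_nat i * f s"
  proof (cases "s \<in> idx (2 * g) i j")
    case True
    then have "(\<Sum>k<2 * g. fst s k) = i" by (auto simp: idx_def)
    then show ?thesis by simp
  qed (use f in \<open>simp add: homog_def del: split_paired_All\<close>)
  finally show "ap (wc.N g) f s = fscale (of_nat i) f s" by simp
qed

lemma F_homog: "f \<in> homog (2 * g) i j \<Longrightarrow> ap (wc.F g) f = fscale (of_nat j) f"
proof
  fix s assume f: "f \<in> homog (2 * g) i j"
  have "ap (wedge k) (ap (contr k) f) s = (if k \<in> snd s then f s else 0)" for k
    by (auto simp: op_apply sg_diff insert_absorb)
  then have "ap (wc.F g) f s = (\<Sum>k<2 * g. if k \<in> snd s then f s else 0)"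
    by (simp add: wc.F_def ap_sum sum_form_apply)
  also have "\<dots> = of_nat (card ({..<2 * g} \<inter> snd s)) * f s"
    by (subst sum.inter_restrict[symmetric]) auto
  also have "\<dots> = of_nat j * f s"
  proof (cases "s \<in> idx (2 * g) i j")
    case True
    then have "card ({..<2 * g} \<inter> snd s) = j" by (auto simp: idx_def Int_absorb1)
    then show ?thesis by simp
  qed (use f in \<open>simp add: homog_def del: split_paired_All\<close>)
  finally show "ap (wc.F g) f s = fscale (of_nat j) f s" by simp
qed

lemma d_homog: "f \<in> homog (2 * g) i j \<Longrightarrow> ap (wc.d g) f \<in> homog (2 * g) (i - 1) (Suc j)"
  by (auto simp: wc.d_def ap_sum simp del: One_nat_def intro!: homog_closed wedge_homog ddx_homog)

lemma d_homog_0: "f \<in> homog (2 * g) 0 j \<Longrightarrow> ap (wc.d g) f = 0"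
  by (auto simp: wc.d_def ap_sum ddx_homog_0 intro!: sum.neutral)

lemma io_homog: "f \<in> homog (2 * g) i j \<Longrightarrow> ap (wc.io g) f \<in> homog (2 * g) (Suc i) (j - 1)"
  by (auto simp: wc.io_def ap_sum simp del: One_nat_def intro!: homog_closed mulx_homog contr_homog)

lemma io_homog_0: "f \<in> homog (2 * g) i 0 \<Longrightarrow> ap (wc.io g) f = 0"
  by (auto simp: wc.io_def ap_sum contr_homog_0 intro!: sum.neutral)

lemma del_homog: "f \<in> homog (2 * g) i j \<Longrightarrow> ap (wc.del g) f \<in> homog (2 * g) (i - 1) (j - 1)"
  by (auto simp: wc.del_def ap_sum simp del: One_nat_def intro!: homog_closed ddx_homog contr_homog)

lemma del_homog_0:
  assumes f: "f \<in> homog (2 * g) i j" and "i = 0 \<or> j = 0"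
  shows "ap (wc.del g) f = 0"
proof -
  have "ap (ddx k * contr l) f = 0" if "k < 2 * g" "l < 2 * g" for k l
  proof (cases "i = 0")
    case True
    then show ?thesis using f that by (simp add: wc.cD[symmetric] ddx_homog_0 del: ap_mult) (simp add: ddx_homog_0)
  next
    case False
    then show ?thesis using assms that by (simp add: contr_homog_0)
  qed
  then show ?thesis
    by (auto simp: wc.del_def ap_sum intro!: sum.neutral)
qed

lemma Lam_homog: "f \<in> homog (2 * g) i j \<Longrightarrow> ap (wc.Lam g) f \<in> homog (2 * g) i (j - 2)"
proof -
  assume f: "f \<in> homog (2 * g) i j"
  have "ap (contr k) (ap (contr (opp g k)) f) \<in> homog (2 * g) i (j - 2)" if "k < 2 * g" for k
    using contr_homog[OF that contr_homog[OF opp_less[OF that] f]] by (simp add: numeral_2_eq_2)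
  then show ?thesis
    by (auto simp: wc.Lam_def ap_sum intro!: homog_closed)
qed

lemma Lam_homog_0: "f \<in> homog (2 * g) i j \<Longrightarrow> j < 2 \<Longrightarrow> ap (wc.Lam g) f = 0"
proof -
  assume f: "f \<in> homog (2 * g) i j" "j < 2"
  have "ap (contr k) (ap (contr (opp g k)) f) = 0" if "k < 2 * g" for k
    using contr_homog[OF opp_less[OF that] f(1)] f(2)
    by (intro contr_homog_0[OF that]) (auto simp: less_2_cases_iff)
  then show ?thesis
    by (auto simp: wc.Lam_def ap_sum intro!: sum.neutral)
qed

lemma E_homog: "f \<in> homog (2 * g) i j \<Longrightarrow> ap (wc.E g) f \<in> homog (2 * g) i (j + 2)"
  by (auto simp: wc.E_def ap_sum intro!: homog_closed wedge_homog)

lemma eps_homog: "f \<in> homog (2 * g) i j \<Longrightarrow> ap (wc.eps g) f \<in> homog (2 * g) (Suc i) (Suc j)"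
  by (auto simp: wc.eps_def ap_sum intro!: homog_closed wedge_homog mulx_homog)

section \<open>Surjectivity of the contraction with the bivector\<close>

lemma ip_E: "ip (2 * g) i (j + 2) (ap (wc.E g) f) h = - ip (2 * g) i j f (ap (wc.Lam g) h)"
proof -
  have "ip (2 * g) i (j + 2) (ap (wedge k) (ap (wedge (opp g k)) f)) h
      = - ip (2 * g) i j f (ap (contr k) (ap (contr (opp g k)) h))" if "k < 2 * g" for k
  proof -
    have "ip (2 * g) i (j + 2) (ap (wedge k) (ap (wedge (opp g k)) f)) h
      = ip (2 * g) i j f (ap (contr (opp g k) * contr k) h)"
      using that by (simp add: ip_wedge)
    \<comment> \<open>Passing to the adjoint reverses the order of two odd operators, whence the
      minus sign.\<close>
    then show ?thesis by (subst (asm) wc.cc) (simp add: ip_right)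
  qed
  then show ?thesis
    by (simp add: wc.E_def wc.Lam_def ap_sum ip_sum_left ip_sum_right ip_left ip_right sum_negf[symmetric])
qed

text \<open>By the sl(2) relation the assumption says that \<open>E (Lam f)\<close> equals 4 (g - j)
  f. Paired with \<open>f\<close>, the former gives minus the squared norm of \<open>Lam f\<close>,
  the latter a positive multiple of the squared norm of \<open>f\<close>.\<close>

lemma Lam_E_inj:
  assumes f: "f \<in> homog (2 * g) i j" and j: "j < g" and 0: "ap (wc.Lam g) (ap (wc.E g) f) = 0"
  shows "f = 0"
proof (rule ip_self_eq_0[OF f])
  let ?I = "ip (2 * g) i"
  have "ap (wc.Lam g * wc.E g) f = ap (wc.E g) (ap (wc.Lam g) f) - fscale (4 * of_nat (g - j)) f"
    using j unfolding wc.Lam_E by (simp add: F_homog[OF f] fun_eq_iff algebra_simps of_nat_diff)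
  then have *: "?I j (ap (wc.E g) (ap (wc.Lam g) f)) f = 4 * of_nat (g - j) * ?I j f f"
    using 0 by (simp add: ip_left(4)[symmetric] del: ip_left(4))
  have "Re (?I j (ap (wc.E g) (ap (wc.Lam g) f)) f) \<le> 0"
  proof (cases "j < 2")
    case True
    then show ?thesis using f by (simp add: Lam_homog_0 ip_left)
  next
    case False
    then obtain m where m: "j = m + 2" by (metis add.commute le_Suc_ex not_less)
    show ?thesis using ip_self_nonneg(1) unfolding m ip_E by simp
  qed
  then have "real (4 * (g - j)) * Re (?I j f f) \<le> 0" unfolding * by simp
  then have "Re (?I j f f) = 0"
    using ip_self_nonneg(1)[of "2 * g" i j f] j by (simp add: mult_le_0_iff)
  then show "?I j f f = 0" using ip_self_nonneg(2) by (simp add: complex_eq_iff)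
qed

lemma dim_kernel_plus_image:
  assumes "form.subspace U" "U \<subseteq> form.span (delta ` idx n i j)"
  shows "form.dim U = form.dim {f \<in> U. ap A f = 0} + form.dim (ap A ` U)"
  using assms by (rule fpair.dim_kernel_plus_image[OF ap_linear]) simp

lemma finite_delta: "finite (delta ` idx n i j)"
  by simp

text \<open>\<open>Lam\<close> after \<open>E\<close> is an injective endomorphism of a
  finite-dimensional space, hence onto; the preimage is found in the image of
  \<open>E\<close>.\<close>

lemma Lam_surj:
  assumes "j < g" "f \<in> homog (2 * g) i j"
  obtains h where "h \<in> homog (2 * g) i (j + 2)" "ap (wc.Lam g) h = f"
proof -
  let ?U = "homog (2 * g) i j" and ?A = "wc.Lam g * wc.E g"
  have sub: "ap ?A ` ?U \<subseteq> ?U" using Lam_homog[OF E_homog] by fastforce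
  have "{f \<in> ?U. ap ?A f = 0} = {0}"
    using Lam_E_inj[OF _ assms(1)] homog_closed(4) by auto
  then have "form.dim ?U \<le> form.dim (ap ?A ` ?U)"
    using dim_kernel_plus_image[OF subspace_homog homog_span, of "2 * g" i j ?A]
      form.dim_eq_card[of "{}" "{0}"] form.independent_empty by simp
  then have "ap ?A ` ?U = ?U"
    by (rule form.subspace_eq_if_dim_eq[OF fpair.linear_subspace_image[OF ap_linear subspace_homog]
          sub homog_span finite_delta])
  then obtain h where "h \<in> ?U" "f = ap ?A h" using assms(2) by blast
  then show thesis using that[of "ap (wc.E g) h"] E_homog by simp
qed

definition prim :: "nat \<Rightarrow> nat \<Rightarrow> nat \<Rightarrow> form set" where
  "prim g i j = {f \<in> homog (2 * g) i j. ap (wc.Lam g) f = 0}"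

definition coclosed :: "nat \<Rightarrow> nat \<Rightarrow> nat \<Rightarrow> form set" where
  "coclosed g i j = {f \<in> prim g i j. ap (wc.del g) f = 0}"

definition harm :: "nat \<Rightarrow> nat \<Rightarrow> nat \<Rightarrow> form set" where
  "harm g i j = {f \<in> coclosed g i j. ap (wc.d g) f = 0}"

lemma subspace_prim: "form.subspace (prim g i j)"
  and subspace_coclosed: "form.subspace (coclosed g i j)"
  and subspace_harm: "form.subspace (harm g i j)"
  using subspace_homog[of "2 * g" i j]
  by (auto simp: prim_def coclosed_def harm_def form.subspace_def)

lemma prim_span: "prim g i j \<subseteq> form.span (delta ` idx (2 * g) i j)"
  and coclosed_span: "coclosed g i j \<subseteq> form.span (delta ` idx (2 * g) i j)"
  and harm_span: "harm g i j \<subseteq> form.span (delta ` idx (2 * g) i j)"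
  using homog_span by (auto simp: prim_def coclosed_def harm_def)

text \<open>For \<open>2 \<le> j\<close> the contraction maps degree \<open>j\<close> onto degree
  \<open>j - 2\<close> as long as \<open>j - 2 < g\<close>, which is the bound
  \<open>j \<le> Suc g\<close>. Degree \<open>Suc g\<close> itself serves as the boundary of the
  recursion for the dimensions.\<close>

lemma dim_prim:
  assumes "j \<le> Suc g"
  shows "form.dim (prim g i j) + ((2 * g + i - 1) choose i) * (if j < 2 then 0 else (2 * g) choose (j - 2))
    = ((2 * g + i - 1) choose i) * ((2 * g) choose j)"
proof -
  have "form.dim (homog (2 * g) i j) = form.dim (prim g i j) + form.dim (ap (wc.Lam g) ` homog (2 * g) i j)"
    unfolding prim_def by (rule dim_kernel_plus_image[OF subspace_homog homog_span])
  moreover have "form.dim (ap (wc.Lam g) ` homog (2 * g) i j)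
      = ((2 * g + i - 1) choose i) * (if j < 2 then 0 else (2 * g) choose (j - 2))"
  proof (cases "j < 2")
    case True
    then have "ap (wc.Lam g) ` homog (2 * g) i j = {0}"
      using Lam_homog_0[of _ g i j] homog_closed(4) by (auto intro!: image_eqI[of _ _ 0])
    then show ?thesis using True form.dim_eq_card[of "{}" "{0}"] form.independent_empty by simp
  next
    case False
    then obtain m where j: "j = m + 2" by (metis add.commute le_Suc_ex not_less)
    have "ap (wc.Lam g) ` homog (2 * g) i j = homog (2 * g) i m"
    proof (intro subset_antisym subsetI)
      fix f assume "f \<in> homog (2 * g) i m"
      then show "f \<in> ap (wc.Lam g) ` homog (2 * g) i j"
        using Lam_surj[of m g f i] assms j by (metis Suc_le_lessD Suc_le_mono add_2_eq_Suc' imageI)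
    qed (use Lam_homog[of _ g i j] j in auto)
    then show ?thesis using False j by (simp add: dim_homog)
  qed
  ultimately show ?thesis by (simp add: dim_homog)
qed

section \<open>Surjectivity of the codifferential and the exterior derivative\<close>

lemma solve_scaled:
  assumes "ap A b = fscale r f" "r \<noteq> 0"
  obtains r' where "ap A (fscale r' b) = f"
  using assms by (auto intro!: that[of "inverse r"])

lemma harm_d: "f \<in> coclosed g i j \<Longrightarrow> ap (wc.d g) f \<in> harm g (i - 1) (Suc j)"
proof -
  assume f: "f \<in> coclosed g i j"
  have "ap (wc.Lam g * wc.d g) f = 0" "ap (wc.d g * wc.d g) f = 0"
    unfolding wc.Lam_d wc.d_d using f by (auto simp: coclosed_def prim_def)
  moreover have "ap (wc.del g * wc.d g + wc.d g * wc.del g) f = 0"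
    unfolding wc.del_d by simp
  ultimately show ?thesis
    using f d_homog by (auto simp: harm_def coclosed_def prim_def)
qed

lemma io_coclosed: "f \<in> coclosed g i j \<Longrightarrow> ap (wc.io g) f \<in> coclosed g (Suc i) (j - 1)"
proof -
  assume f: "f \<in> coclosed g i j"
  have "ap (wc.Lam g * wc.io g) f = 0"
    unfolding wc.Lam_io using f by (auto simp: coclosed_def prim_def)
  moreover have "ap (wc.del g * wc.io g + wc.io g * wc.del g) f = 0"
    unfolding wc.del_io using f by (auto simp: coclosed_def prim_def)
  ultimately show ?thesis
    using f io_homog by (auto simp: coclosed_def prim_def)
qed

text \<open>Cartan's formula for the Euler field, whose Lie derivative multiplies a form of bidegree
  (i, j) by i + j.\<close>

lemma homotopy:
  assumes "f \<in> homog (2 * g) i j"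
  shows "ap (wc.d g) (ap (wc.io g) f) + ap (wc.io g) (ap (wc.d g) f) = fscale (of_nat (i + j)) f"
proof -
  have "ap (wc.d g * wc.io g + wc.io g * wc.d g) f = fscale (of_nat (i + j)) f"
    unfolding wc.N_plus_F by (simp add: N_homog[OF assms] F_homog[OF assms] fun_eq_iff algebra_simps)
  then show ?thesis by simp
qed

text \<open>The Poincare lemma inside the coclosed forms: contraction with the Euler field preserves
  primitive coclosed forms, and after division by the total degree it yields an antiderivative of a
  closed one.\<close>

lemma image_d: "ap (wc.d g) ` coclosed g (Suc i) j = harm g i (Suc j)"
proof (intro subset_antisym subsetI)
  fix f assume f: "f \<in> harm g i (Suc j)"
  then have f': "f \<in> coclosed g i (Suc j)" "f \<in> homog (2 * g) i (Suc j)" "ap (wc.d g) f = 0"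
    by (auto simp: harm_def coclosed_def prim_def)
  let ?h = "fscale (1 / of_nat (i + Suc j)) (ap (wc.io g) f)"
  have "?h \<in> coclosed g (Suc i) j"
    using io_coclosed[OF f'(1)] form.subspace_scale[OF subspace_coclosed] by simp
  moreover have "ap (wc.d g) ?h = f"
    using homotopy[OF f'(2)] f'(3) by (simp add: fun_eq_iff del: of_nat_Suc of_nat_add)
  ultimately show "f \<in> ap (wc.d g) ` coclosed g (Suc i) j" by (metis imageI)
qed (use harm_d[of _ g "Suc i" j] in auto)

lemma dim_coclosed_Suc:
  "form.dim (coclosed g (Suc i) j) = form.dim (harm g (Suc i) j) + form.dim (harm g i (Suc j))"
  using dim_kernel_plus_image[OF subspace_coclosed coclosed_span, of g "Suc i" j "wc.d g"]
  by (simp add: image_d harm_def)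

lemma coclosed_0: "coclosed g 0 j = prim g 0 j"
  and harm_0: "harm g 0 j = prim g 0 j"
  using del_homog_0[of _ g 0 j] d_homog_0[of _ g j] by (auto simp: coclosed_def harm_def prim_def)

lemma harm_Suc_0: "harm g (Suc i) 0 = {0}"
proof -
  have "f = 0" if "f \<in> harm g (Suc i) 0" for f
  proof -
    have "f \<in> homog (2 * g) (Suc i) 0" "ap (wc.d g) f = 0"
      using that by (auto simp: harm_def coclosed_def prim_def)
    then show ?thesis using homotopy[of f g "Suc i" 0] io_homog_0
      by (simp del: of_nat_Suc)
  qed
  then show ?thesis using form.subspace_0[OF subspace_harm] by auto
qed

lemma ap_del_eps:
  assumes "f \<in> coclosed g i j"
  shows "ap (wc.del g) (ap (wc.eps g) f) = fscale (of_nat i + 2 * of_nat g - of_nat j) f"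
proof -
  have f: "f \<in> homog (2 * g) i j" "ap (wc.del g) f = 0"
    using assms by (auto simp: coclosed_def prim_def)
  have "ap (wc.del g * wc.eps g + wc.eps g * wc.del g) f = fscale (of_nat i + 2 * of_nat g - of_nat j) f"
    unfolding wc.del_eps by (simp add: N_homog[OF f(1)] F_homog[OF f(1)] fun_eq_iff algebra_simps)
  then show ?thesis using f by simp
qed

lemma ap_Lam_eps:
  assumes "f \<in> prim g i j"
  shows "ap (wc.Lam g) (ap (wc.eps g) f) = fscale 2 (ap (wc.io g) f)"
proof -
  have "ap (wc.Lam g * wc.eps g) f = fscale 2 (ap (wc.io g) f)"
    unfolding wc.Lam_eps using assms by (simp add: prim_def)
  then show ?thesis by simp
qed

text \<open>For \<open>f\<close> in the kernel of \<open>wc.d g\<close> the form \<open>wc.eps g f\<close> is not primitive; the summand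
  with \<open>wc.E g\<close> corrects this, at the price of a factor that vanishes exactly for \<open>j = g\<close>.\<close>

lemma harm_subset_image_del:
  assumes f: "f \<in> harm g i j" and j: "j < g"
  shows "f \<in> ap (wc.del g) ` prim g (Suc i) (Suc j)"
proof -
  have fc: "f \<in> coclosed g i j" and fd: "ap (wc.d g) f = 0" and fh: "f \<in> homog (2 * g) i j"
    and fp: "f \<in> prim g i j"
    using f by (auto simp: harm_def coclosed_def prim_def)
  define u where "u = ap (wc.io g) f"
  have uc: "u \<in> coclosed g (Suc i) (j - 1)" unfolding u_def by (rule io_coclosed[OF fc])
  then have uh: "u \<in> homog (2 * g) (Suc i) (j - 1)" by (auto simp: coclosed_def prim_def)
  \<comment> \<open>\<open>u\<close> has form degree \<open>j - 1\<close>, so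
    \<open>Lam (E u)\<close> is - 4 (g + 1 - j) u, whereas \<open>Lam (eps f)\<close> is 2 u. This
    \<open>a\<close> makes the two contributions cancel in \<open>Lam b\<close>.\<close>
  define a :: complex where "a = 1 / (2 * of_nat (Suc g - j))"
  define b where "b = ap (wc.eps g) f + fscale a (ap (wc.E g) u)"
  have du: "ap (wc.d g) u = fscale (of_nat (i + j)) f"
    using homotopy[OF fh] fd by (simp add: u_def)
  have Eu: "ap (wc.E g) u \<in> homog (2 * g) (Suc i) (Suc j)"
  proof (cases j)
    case 0
    then have "u = 0" using io_homog_0 fh by (simp add: u_def)
    then show ?thesis using homog_closed by simp
  qed (use E_homog[OF uh] in simp)
  have LE: "ap (wc.Lam g) (ap (wc.E g) u) = - fscale (4 * of_nat (Suc g - j)) u"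
  proof (cases j)
    case 0
    then have "u = 0" using io_homog_0 fh by (simp add: u_def)
    then show ?thesis by simp
  next
    case (Suc m)
    have "ap (wc.Lam g * wc.E g) u = ap (wc.E g) (ap (wc.Lam g) u) - fscale (4 * of_nat (Suc g - j)) u"
      unfolding wc.Lam_E using j Suc
      by (simp add: F_homog[OF uh] fun_eq_iff algebra_simps of_nat_diff)
    then show ?thesis using uc by (simp add: coclosed_def prim_def)
  qed
  have "of_nat (Suc g - j) \<noteq> (0 :: complex)" using j by (simp only: of_nat_eq_0_iff)
  then have "a * (4 * of_nat (Suc g - j)) = 2" by (simp add: a_def del: of_nat_diff)
  then have "ap (wc.Lam g) b = 0"
    by (simp add: b_def LE ap_Lam_eps[OF fp] u_def[symmetric] fun_eq_iff mult.assoc[symmetric] del: of_nat_diff)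
  moreover have "b \<in> homog (2 * g) (Suc i) (Suc j)"
    unfolding b_def by (intro homog_closed eps_homog fh Eu)
  ultimately have b: "b \<in> prim g (Suc i) (Suc j)" by (simp add: prim_def)
  have "ap (wc.del g * wc.E g) u = - fscale (2 * of_nat (i + j)) f"
    unfolding wc.del_E using uc by (simp add: du coclosed_def)
  then have dE: "ap (wc.del g) (ap (wc.E g) u) = - fscale (2 * of_nat (i + j)) f" by simp
  have "ap (wc.del g) b = fscale (of_nat i + 2 * of_nat g - of_nat j - of_nat (i + j) / of_nat (Suc g - j)) f"
    by (simp add: b_def ap_del_eps[OF fc] dE a_def fun_eq_iff algebra_simps add_divide_distrib)
  also have "of_nat i + 2 * of_nat g - of_nat j - of_nat (i + j) / of_nat (Suc g - j)
      = (of_nat ((g - j) * (i + 2 * g - j + 2)) / of_nat (Suc g - j) :: complex)"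
  proof -
    \<comment> \<open>With g = j + m + 1 the numerator (i + 2g - j)(g + 1 - j) - (i + j) becomes (m
      + 1)(i + j + 2m + 4), free of truncated subtraction.\<close>
    obtain m where m: "g = Suc (j + m)" using j by (metis less_iff_Suc_add)
    have "of_nat (Suc (Suc m)) \<noteq> (0 :: complex)" by (simp only: of_nat_eq_0_iff)
    then have "of_nat m + 2 \<noteq> (0 :: complex)" by (simp add: algebra_simps)
    moreover have "Suc g - j = m + 2" "g - j = m + 1" "i + 2 * g - j + 2 = i + j + 2 * m + 4"
      using m by auto
    ultimately show ?thesis unfolding m by (simp add: field_simps)
  qed
  finally have "ap (wc.del g) b = fscale (of_nat ((g - j) * (i + 2 * g - j + 2)) / of_nat (Suc g - j)) f" .
  moreover have "of_nat ((g - j) * (i + 2 * g - j + 2)) / of_nat (Suc g - j) \<noteq> (0 :: complex)"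
    using j by (simp only: divide_eq_0_iff of_nat_eq_0_iff) simp
  ultimately obtain r where "ap (wc.del g) (fscale r b) = f" by (rule solve_scaled)
  then show ?thesis using b form.subspace_scale[OF subspace_prim] by (metis imageI)
qed

text \<open>\<open>Lam (eps f)\<close> is twice \<open>io f\<close>, which vanishes here. Hence
  \<open>eps f\<close> is primitive as it stands, and only the scalar i + 2g - j has to be divided
  out.\<close>

lemma io_harm_subset_image_del:
  assumes f: "f \<in> coclosed g i j" and io: "ap (wc.io g) f = 0" and j: "j < g"
  shows "f \<in> ap (wc.del g) ` prim g (Suc i) (Suc j)"
proof -
  have fh: "f \<in> homog (2 * g) i j" and fp: "f \<in> prim g i j"
    using f by (auto simp: coclosed_def prim_def)
  let ?a = "of_nat i + 2 * of_nat g - of_nat j :: complex"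
  have "?a = of_nat (i + 2 * g - j)" using j by (simp add: of_nat_diff)
  then have a: "?a \<noteq> 0" using j by (simp only: of_nat_eq_0_iff)
  have "ap (wc.eps g) f \<in> prim g (Suc i) (Suc j)"
    using ap_Lam_eps[OF fp] io eps_homog[OF fh] by (simp add: prim_def)
  then have "fscale (1 / ?a) (ap (wc.eps g) f) \<in> prim g (Suc i) (Suc j)"
    by (rule form.subspace_scale[OF subspace_prim])
  moreover have "ap (wc.del g) (fscale (1 / ?a) (ap (wc.eps g) f)) = f"
    using a by (simp add: ap_del_eps[OF f] fun_eq_iff)
  ultimately show ?thesis by (metis imageI)
qed

text \<open>For \<open>i > 0\<close> Cartan's formula writes a nonzero multiple of \<open>f\<close>
  as a closed form plus one killed by \<open>io\<close>; the two preceding lemmas cover one summand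
  each. For \<open>i = 0\<close> every primitive form is closed and coclosed.\<close>

lemma image_del:
  assumes j: "j < g"
  shows "ap (wc.del g) ` prim g (Suc i) (Suc j) = coclosed g i j"
proof (intro subset_antisym subsetI)
  fix f assume "f \<in> ap (wc.del g) ` prim g (Suc i) (Suc j)"
  then obtain b where b: "b \<in> prim g (Suc i) (Suc j)" "f = ap (wc.del g) b" by blast
  have "ap (wc.Lam g * wc.del g) b = 0" "ap (wc.del g * wc.del g) b = 0"
    unfolding wc.Lam_del wc.del_del using b by (auto simp: prim_def)
  then show "f \<in> coclosed g i j"
    using b del_homog[of b g "Suc i" "Suc j"] by (auto simp: coclosed_def prim_def)
next
  fix f assume f: "f \<in> coclosed g i j"
  then have fh: "f \<in> homog (2 * g) i j" by (auto simp: coclosed_def prim_def)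
  let ?W = "ap (wc.del g) ` prim g (Suc i) (Suc j)"
  have W: "form.subspace ?W" by (rule fpair.linear_subspace_image[OF ap_linear subspace_prim])
  show "f \<in> ?W"
  proof (cases i)
    case 0
    then show ?thesis using f harm_subset_image_del[OF _ j] by (simp add: harm_0 coclosed_0)
  next
    case (Suc m)
    let ?u = "ap (wc.io g) (ap (wc.d g) f)"
    have df: "ap (wc.d g) f \<in> coclosed g m (Suc j)"
      using harm_d[OF f] Suc by (simp add: harm_def)
    have "ap (wc.io g * wc.io g) (ap (wc.d g) f) = 0" unfolding wc.io_io by simp
    then have u: "?u \<in> ?W"
      using io_harm_subset_image_del[OF _ _ j] io_coclosed[OF df] Suc by simp
    have "ap (wc.d g) (ap (wc.io g) f) \<in> harm g i j" 
    proof (cases j)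
      case 0
      then show ?thesis using io_homog_0 fh form.subspace_0[OF subspace_harm] by simp
    next
      case (Suc l)
      then show ?thesis using harm_d[OF io_coclosed[OF f]] by simp
    qed
    then have "ap (wc.d g) (ap (wc.io g) f) \<in> ?W" by (rule harm_subset_image_del[OF _ j])
    then have "fscale (of_nat (i + j)) f \<in> ?W"
      unfolding homotopy[OF fh, symmetric] by (rule form.subspace_add[OF W _ u])
    then have "fscale (1 / of_nat (i + j)) (fscale (of_nat (i + j)) f) \<in> ?W"
      by (rule form.subspace_scale[OF W])
    moreover have "fscale (1 / of_nat (i + j)) (fscale (of_nat (i + j)) f) = f"
      using Suc by (simp add: fun_eq_iff del: of_nat_add of_nat_Suc)
    ultimately show ?thesis by simp
  qed
qed

lemma dim_prim_Suc_Suc: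
  "j < g \<Longrightarrow> form.dim (prim g (Suc i) (Suc j))
    = form.dim (coclosed g (Suc i) (Suc j)) + form.dim (coclosed g i j)"
  using dim_kernel_plus_image[OF subspace_prim prim_span, of g "Suc i" "Suc j" "wc.del g"]
  by (simp add: image_del coclosed_def[of g "Suc i" "Suc j"])

section \<open>The dimension of the space of harmonic forms\<close>

definition dim_formula :: "nat \<Rightarrow> nat \<Rightarrow> nat \<Rightarrow> real" where
  "dim_formula g i j = trinomial (2 * g + i + 1) i j
       * ((2 * real g + 2 - 2 * real j) / (2 * real g + 2 + real i - real j))
       * (real j / (real i + real j))"

text \<open>\<open>Q\<close> is a common factor of the four trinomials and the two binomial products
  in the dimension recursion, with n = 2g. Once it is divided out, only rational functions of
  \<open>n\<close>, \<open>i\<close> and \<open>j\<close> remain.\<close>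

lemma fact_ratio:
  fixes n i j :: nat
  assumes "j \<le> n" "n \<ge> 1"
  defines "Q \<equiv> fact (n + i - 1) / (fact i * fact j * fact (n + 2 - j)) :: real"
  shows "fact (n + i + 1) / (fact i * fact j * fact (n + 1 - j)) = Q * (real n + real i) * (real n + real i + 1) * (real n + 2 - real j)"
    "i \<ge> 1 \<Longrightarrow> fact (n + i) / (fact (i - 1) * fact (j + 1) * fact (n - j))
      = Q * (real n + real i) * real i * (real n + 2 - real j) * (real n + 1 - real j) / (real j + 1)"
    "i \<ge> 1 \<Longrightarrow> j \<ge> 1 \<Longrightarrow> fact (n + i) / (fact (i - 1) * fact (j - 1) * fact (n + 2 - j))
      = Q * (real n + real i) * real i * real j"
    "i \<ge> 2 \<Longrightarrow> fact (n + i - 1) / (fact (i - 2) * fact j * fact (n + 1 - j))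
      = Q * real i * (real i - 1) * (real n + 2 - real j)"
    "real ((n + i - 1) choose i) * real (n choose j) = Q * real n * (real n + 2 - real j) * (real n + 1 - real j)"
    "j \<ge> 2 \<Longrightarrow> real ((n + i - 1) choose i) * real (n choose (j - 2)) = Q * real n * real j * (real j - 1)"
proof -
  obtain m where n: "n = j + m" using assms(1) le_Suc_ex by blast
  obtain p where p: "n = Suc p" using assms(2) by (cases n) auto
  have f1: "fact (n + i + 1) = (real n + real i + 1) * (real n + real i) * fact (n + i - 1)"
    "fact (n + i) = (real n + real i) * fact (n + i - 1)"
    using p by (simp_all add: algebra_simps)
  define J1 where "J1 = real j + 1"
  have f3: "fact (j + 1) = J1 * fact j" "real j + 1 = J1" by (simp_all add: J1_def algebra_simps)
  define M1 M2 where "M1 = real m + 1" "M2 = real m + 2"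
  have f2: "fact (n + 2 - j) = M2 * (M1 * fact m)" "fact (n + 1 - j) = M1 * fact m"
    "n - j = m" "real n + 2 - real j = M2" "real n + 1 - real j = M1"
    using n by (simp_all add: M1_M2_def algebra_simps)
  have nz: "fact m \<noteq> (0::real)" "fact i \<noteq> (0::real)" "fact j \<noteq> (0::real)" "M1 \<noteq> 0" "M2 \<noteq> 0" "J1 \<noteq> 0"
    by (auto simp: M1_M2_def J1_def add_eq_0_iff)
  show "fact (n + i + 1) / (fact i * fact j * fact (n + 1 - j)) = Q * (real n + real i) * (real n + real i + 1) * (real n + 2 - real j)"
    unfolding Q_def f1 f2 using nz by (simp add: field_simps)
  show "fact (n + i) / (fact (i - 1) * fact (j + 1) * fact (n - j))
      = Q * (real n + real i) * real i * (real n + 2 - real j) * (real n + 1 - real j) / (real j + 1)" if i: "i \<ge> 1"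
  proof -
    obtain i' where "i = Suc i'" using i by (cases i) auto
    then have "fact i = real i * fact (i - 1)" by simp
    then show ?thesis unfolding Q_def f1(2) f2 f3 using nz by (simp add: field_simps)
  qed
  show "fact (n + i) / (fact (i - 1) * fact (j - 1) * fact (n + 2 - j))
      = Q * (real n + real i) * real i * real j" if ij: "i \<ge> 1" "j \<ge> 1"
  proof -
    obtain i' j' where "i = Suc i'" "j = Suc j'" using ij by (cases i; cases j) auto
    then have "fact i = real i * fact (i - 1)" "fact j = real j * fact (j - 1)" by simp_all
    then show ?thesis unfolding Q_def f1(2) f2(1) using nz by (simp add: field_simps)
  qed
  show "fact (n + i - 1) / (fact (i - 2) * fact j * fact (n + 1 - j))
      = Q * real i * (real i - 1) * (real n + 2 - real j)" if i: "i \<ge> 2"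
  proof -
    obtain i' where "i = Suc (Suc i')" using i by (metis add_2_eq_Suc le_Suc_ex)
    define I1 where "I1 = real i - 1"
    have *: "fact i = real i * I1 * fact (i - 2)" "real i - 1 = I1" and "I1 \<noteq> 0" "real i \<noteq> 0"
      using i \<open>i = Suc (Suc i')\<close> by (simp_all add: I1_def)
    then show ?thesis unfolding Q_def f2 * using nz by simp
  qed
  have c1: "real ((n + i - 1) choose i) = fact (n + i - 1) * real n / (fact i * fact n)"
  proof -
    have "fact n = real n * fact p" "real n \<noteq> 0" "n + i - 1 - i = p" using p by simp_all
    then show ?thesis using assms(2) by (subst binomial_fact) simp_all
  qed
  have c2: "real (n choose j) = fact n / (fact j * fact m)"
    using n by (subst binomial_fact) simp_all
  show "real ((n + i - 1) choose i) * real (n choose j) = Q * real n * (real n + 2 - real j) * (real n + 1 - real j)"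
    unfolding c1 c2 Q_def f2 using nz by (simp add: field_simps)
  show "real ((n + i - 1) choose i) * real (n choose (j - 2)) = Q * real n * real j * (real j - 1)" if j2: "j \<ge> 2"
  proof -
    obtain j' where j': "j = Suc (Suc j')" using j2 by (metis add_2_eq_Suc le_Suc_ex)
    define J0 where "J0 = real j - 1"
    have *: "fact j = real j * J0 * fact (j - 2)" "real j - 1 = J0" and j0: "J0 \<noteq> 0" "real j \<noteq> 0"
      using j' by (simp_all add: J0_def)
    have "real (n choose (j - 2)) = fact n / (fact (j - 2) * fact (n + 2 - j))"
      using n j' by (subst binomial_fact) simp_all
    then show ?thesis unfolding c1 Q_def * using nz j0 by simp
  qed
qed

text \<open>Up to the factor \<open>Q\<close>, the left side is the dimension of the primitive forms
  and the four fractions are the expected dimensions of the constituents. Multiplication by the four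
  linear factors of the denominators leaves a polynomial identity.\<close>

lemma rational_identity:
  fixes n i j :: real
  assumes "n + 2 + i - j \<noteq> 0" "n + i - j \<noteq> 0" "i + j \<noteq> 0" "i + j - 2 \<noteq> 0"
  shows "n * (n + 2 - j) * (n + 1 - j) - n * j * (j - 1) =
    (n + i) * (n + i + 1) * (n + 2 - j) * (n + 2 - 2 * j) * j / ((n + 2 + i - j) * (i + j))
    + (n + i) * i * (n + 2 - j) * (n + 1 - j) * (n - 2 * j) / ((n + i - j) * (i + j))
    + (n + i) * i * j * (n + 4 - 2 * j) * (j - 1) / ((n + 2 + i - j) * (i + j - 2))
    + i * (i - 1) * (n + 2 - j) * (n + 2 - 2 * j) * j / ((n + i - j) * (i + j - 2))"
proof -
  define a b c d where "a = n + 2 + i - j" "b = n + i - j" "c = i + j" "d = i + j - 2"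
  have nz: "a \<noteq> 0" "b \<noteq> 0" "c \<noteq> 0" "d \<noteq> 0" unfolding a_b_c_d_def using assms by blast+
  have "(n + i) * (n + i + 1) * (n + 2 - j) * (n + 2 - 2 * j) * j / (a * c)
    + (n + i) * i * (n + 2 - j) * (n + 1 - j) * (n - 2 * j) / (b * c)
    + (n + i) * i * j * (n + 4 - 2 * j) * (j - 1) / (a * d)
    + i * (i - 1) * (n + 2 - j) * (n + 2 - 2 * j) * j / (b * d)
   = ((n + i) * (n + i + 1) * (n + 2 - j) * (n + 2 - 2 * j) * j * (b * d)
    + (n + i) * i * (n + 2 - j) * (n + 1 - j) * (n - 2 * j) * (a * d)
    + (n + i) * i * j * (n + 4 - 2 * j) * (j - 1) * (b * c)
    + i * (i - 1) * (n + 2 - j) * (n + 2 - 2 * j) * j * (a * c)) / (a * b * c * d)"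
    using nz by (simp add: add_divide_distrib mult.assoc)
  also have "\<dots> = (n * (n + 2 - j) * (n + 1 - j) - n * j * (j - 1)) * (a * b * c * d) / (a * b * c * d)"
    unfolding a_b_c_d_def by (rule arg_cong[where f="\<lambda>z. z / _"]) (simp add: algebra_simps)
  also have "\<dots> = n * (n + 2 - j) * (n + 1 - j) - n * j * (j - 1)"
    using nz by simp
  finally show ?thesis by (simp only: a_b_c_d_def)
qed

text \<open>For i = j = 1 the pair (i - 1, j - 1) is (0, 0), where the last factor of
  \<open>dim_formula\<close> is 0/0, evaluated as 0, although the trivial representation contributes
  1; hence the exclusion. For \<open>i = 1\<close> the missing fourth term agrees with the factor
  \<open>i - 1\<close> in the rational identity.\<close>

lemma dim_formula_recursion:
  assumes "1 \<le> i" "1 \<le> j" "j \<le> g" "i + j \<noteq> 2"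
  shows "real ((2 * g + i - 1) choose i) * (real ((2 * g) choose j) - (if j < 2 then 0 else real ((2 * g) choose (j - 2))))
    = dim_formula g i j + dim_formula g (i - 1) (j + 1) + dim_formula g (i - 1) (j - 1)
      + (if i = 1 then 0 else dim_formula g (i - 2) j)"
proof -
  define n where "n = 2 * g"
  define Q :: real where "Q = fact (n + i - 1) / (fact i * fact j * fact (n + 2 - j))"
  have n: "j \<le> n" "n \<ge> 1" "2 * j \<le> n" using assms by (auto simp: n_def)
  note F = fact_ratio[OF n(1,2), of i, folded Q_def]
  have g: "2 * real g = real n" by (simp add: n_def)
  have nz: "real n + 2 + real i - real j \<noteq> 0" "real n + real i - real j \<noteq> 0" "real i + real j \<noteq> 0" "real i + real j - 2 \<noteq> 0"
    using assms n by linarith+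
  have 1: "dim_formula g i j = Q * ((real n + real i) * (real n + real i + 1) * (real n + 2 - real j) * (real n + 2 - 2 * real j) * real j / ((real n + 2 + real i - real j) * (real i + real j)))"
  proof -
    have "trinomial (2 * g + i + 1) i j = Q * (real n + real i) * (real n + real i + 1) * (real n + 2 - real j)"
      unfolding F(1)[symmetric] trinomial_def n_def[symmetric] using n by (simp add: Suc_diff_le)
    then show ?thesis unfolding dim_formula_def g by (simp add: mult_ac)
  qed
  have 2: "dim_formula g (i - 1) (j + 1) = Q * ((real n + real i) * real i * (real n + 2 - real j) * (real n + 1 - real j) * (real n - 2 * real j) / ((real n + real i - real j) * (real i + real j)))"
  proof -
    have "trinomial (2 * g + (i - 1) + 1) (i - 1) (j + 1) = Q * (real n + real i) * real i * (real n + 2 - real j) * (real n + 1 - real j) / (real j + 1)"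
      unfolding F(2)[OF assms(1), symmetric] trinomial_def n_def[symmetric] using n assms by simp
    then have *: "trinomial (2 * g + (i - 1) + 1) (i - 1) (j + 1) * real (j + 1)
      = Q * (real n + real i) * real i * (real n + 2 - real j) * (real n + 1 - real j)"
      by (simp add: add.commute)
    have **: "real n + 2 - 2 * real (j + 1) = real n - 2 * real j"
      "real n + 2 + real (i - 1) - real (j + 1) = real n + real i - real j"
      "real (i - 1) + real (j + 1) = real i + real j"
      using assms by (simp_all add: of_nat_diff)
    have "dim_formula g (i - 1) (j + 1) = trinomial (2 * g + (i - 1) + 1) (i - 1) (j + 1) * real (j + 1)
        * ((real n - 2 * real j) / ((real n + real i - real j) * (real i + real j)))"
      unfolding dim_formula_def g ** by (simp del: of_nat_add of_nat_Suc)
    then show ?thesis unfolding * by (simp add: mult_ac)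
  qed
  have 3: "dim_formula g (i - 1) (j - 1) = Q * ((real n + real i) * real i * real j * (real n + 4 - 2 * real j) * (real j - 1) / ((real n + 2 + real i - real j) * (real i + real j - 2)))"
  proof -
    have *: "trinomial (2 * g + (i - 1) + 1) (i - 1) (j - 1) = Q * (real n + real i) * real i * real j"
      unfolding F(3)[OF assms(1,2), symmetric] trinomial_def n_def[symmetric] using n assms
      by (simp add: numeral_2_eq_2 Suc_diff_le)
    have **: "real n + 2 - 2 * real (j - 1) = real n + 4 - 2 * real j"
      "real n + 2 + real (i - 1) - real (j - 1) = real n + 2 + real i - real j"
      "real (i - 1) + real (j - 1) = real i + real j - 2"
      using assms by (simp_all add: of_nat_diff)
    have ***: "real (j - 1) = real j - 1" using assms by (simp add: of_nat_diff)
    show ?thesis unfolding dim_formula_def g * ** unfolding *** by (simp add: mult_ac)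
  qed
  have 4: "(if i = 1 then 0 else dim_formula g (i - 2) j) = Q * (real i * (real i - 1) * (real n + 2 - real j) * (real n + 2 - 2 * real j) * real j / ((real n + real i - real j) * (real i + real j - 2)))"
  proof (cases "i = 1")
    case False
    then have i: "i \<ge> 2" using assms by simp
    have "trinomial (2 * g + (i - 2) + 1) (i - 2) j = Q * real i * (real i - 1) * (real n + 2 - real j)"
      unfolding F(4)[OF i, symmetric] trinomial_def n_def[symmetric] using n i
      by (simp add: Suc_diff_le numeral_2_eq_2 Suc_diff_Suc)
    moreover have "real n + 2 + real (i - 2) - real j = real n + real i - real j"
      "real (i - 2) + real j = real i + real j - 2"
      using i by (simp_all add: of_nat_diff)
    ultimately show ?thesis using False unfolding dim_formula_def g by (simp add: mult_ac)
  qed simp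
  have "real ((2 * g + i - 1) choose i) * (real ((2 * g) choose j) - (if j < 2 then 0 else real ((2 * g) choose (j - 2))))
    = Q * real n * (real n + 2 - real j) * (real n + 1 - real j) - Q * real n * real j * (real j - 1)"
    using F(5,6) assms unfolding n_def[symmetric] by (cases "j = 1") (auto simp: right_diff_distrib)
  also have "\<dots> = Q * (real n * (real n + 2 - real j) * (real n + 1 - real j) - real n * real j * (real j - 1))"
    by (simp add: algebra_simps)
  finally show ?thesis
    unfolding 1 2 3 4 rational_identity[OF nz] by (simp only: distrib_left)
qed

lemma dim_formula_0:
  assumes "1 \<le> j" "j \<le> g"
  shows "real ((2 * g) choose j) - (if j < 2 then 0 else real ((2 * g) choose (j - 2))) = dim_formula g 0 j"
proof -
  define n where "n = 2 * g"
  have n: "j \<le> n" "n \<ge> 1" using assms by (auto simp: n_def)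
  define Q :: real where "Q = fact (n - 1) / (fact j * fact (n + 2 - j))"
  have "real (n choose j) - (if j < 2 then 0 else real (n choose (j - 2)))
    = Q * real n * (real n + 2 - real j) * (real n + 1 - real j) - Q * real n * real j * (real j - 1)"
    using fact_ratio(5,6)[OF n, of 0] assms unfolding Q_def by (cases "j = 1") auto
  also have "\<dots> = Q * real n * (real n + 1) * (real n + 2 - 2 * real j)"
    by (simp add: algebra_simps)
  also have "\<dots> = trinomial (n + 1) 0 j * ((real n + 2 - 2 * real j) / (real n + 2 - real j))"
  proof -
    have "trinomial (n + 1) 0 j = Q * real n * (real n + 1) * (real n + 2 - real j)"
      using fact_ratio(1)[OF n, of 0] unfolding Q_def trinomial_def by simp
    moreover have "real n + 2 - real j \<noteq> 0" using n by linarith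
    ultimately show ?thesis by simp
  qed
  also have "\<dots> = dim_formula g 0 j"
    using assms by (simp add: dim_formula_def n_def)
  finally show ?thesis unfolding n_def .
qed

text \<open>The case i = j = 1 of the recursion: the square of 2g is the dimension of V tensor V,
  and the summand 1 is its trivial constituent.\<close>

lemma dim_formula_1_1:
  assumes "1 \<le> g"
  shows "dim_formula g 1 1 + dim_formula g 0 2 + 1 = (2 * real g)\<^sup>2"
proof -
  obtain m where m: "2 * g = Suc m" using assms by (cases "2 * g") auto
  have "trinomial (2 * g + 1 + 1) 1 1 = (2 * real g + 2) * (2 * real g + 1)"
  proof -
    have "fact (2 * g + 1 + 1) = (2 * real g + 2) * (2 * real g + 1) * fact (2 * g)"
      by (simp add: algebra_simps)
    then show ?thesis by (simp add: trinomial_def del: fact_Suc)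
  qed
  moreover have "trinomial (2 * g + 0 + 1) 0 2 = (2 * real g + 1) * real g"
  proof -
    have "fact (2 * g + 0 + 1) = (2 * real g + 1) * (2 * real g) * fact m"
      using m by (metis (no_types, lifting) Suc_eq_plus1 add.right_neutral fact_Suc mult.assoc of_nat_Suc of_nat_mult of_nat_numeral add.commute)
    moreover have "2 * g + 0 + 1 - 0 - 2 = m" using m by simp
    ultimately show ?thesis unfolding trinomial_def by simp
  qed
  moreover define P where "P = 2 * real g + 2"
  moreover have "P \<noteq> 0" "real g \<noteq> 0" using assms by (auto simp: P_def)
  ultimately have "dim_formula g 1 1 = (2 * real g + 1) * real g" "dim_formula g 0 2 = (2 * real g + 1) * (real g - 1)"
    unfolding dim_formula_def by (simp_all del: One_nat_def) (simp add: field_simps)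
  then show ?thesis by (simp add: algebra_simps power2_eq_square)
qed

text \<open>Induction on \<open>i\<close>. The range of \<open>j\<close> reaches g + 1 because the
  recursion at \<open>j = g\<close> refers to that degree; there the formula vanishes through its
  factor 2g + 2 - 2j. The value at \<open>j = 0\<close> is set apart because of the quotient 0/0 in
  bidegree (0, 0).\<close>

lemma dim_harm_eq:
  assumes "1 \<le> g" "j \<le> Suc g"
  shows "real (form.dim (harm g i j)) = (if j = 0 then (if i = 0 then 1 else 0) else dim_formula g i j)"
  using assms(2)
  supply fscale_apply [simp del]
proof (induction i arbitrary: j rule: less_induct)
  case (less i)
  have dim0: "form.dim {0} = 0" using form.dim_eq_card[of "{}" "{0}"] form.independent_empty by simp
  \<comment> \<open>The contraction from degree g + 1 to degree g - 1 is a surjection between spaces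
    of equal dimension, so no nonzero primitive form exists in degree g + 1.\<close>
  have top: "form.dim (harm g i (Suc g)) = 0"
  proof -
    have "(2 * g) choose (Suc g) = (2 * g) choose (g - 1)"
      using assms(1) binomial_symmetric[of "Suc g" "2 * g"] by (simp add: mult_2)
    then have "form.dim (prim g i (Suc g)) = 0"
      using dim_prim[of "Suc g" g i] assms(1) by simp
    then have "form.dim (prim g i (Suc g)) = form.dim {0}" by (simp add: dim0)
    then have "{0} = prim g i (Suc g)"
      by (intro form.subspace_eq_if_dim_eq[OF form.subspace_single_0 _ prim_span finite_delta])
        (auto simp: form.subspace_0[OF subspace_prim])
    then have "harm g i (Suc g) \<subseteq> {0}" by (auto simp: harm_def coclosed_def)
    then have "harm g i (Suc g) = {0}" using form.subspace_0[OF subspace_harm] by blast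
    then show ?thesis by (simp add: dim0)
  qed
  consider "j = 0" | "j = Suc g" | "1 \<le> j" "j \<le> g" using less.prems by linarith
  then show ?case
  proof cases
    case 1
    show ?thesis
    proof (cases i)
      case 0
      have "form.dim (harm g 0 0) = 1" using dim_prim[of 0 g 0] unfolding harm_0 by simp
      then have "real (form.dim (harm g 0 0)) = 1" by (simp only: of_nat_1)
      then show ?thesis by (simp only: 0 1 if_True simp_thms)
    next
      case (Suc m)
      have "real (form.dim (harm g (Suc m) 0)) = 0" unfolding harm_Suc_0 dim0 by simp
      then show ?thesis by (simp only: Suc 1 if_True simp_thms nat.distinct if_False)
    qed
  next
    case 2
    moreover have "real (form.dim (harm g i (Suc g))) = 0" unfolding top by simp
    moreover have "dim_formula g i (Suc g) = 0" by (simp add: dim_formula_def)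
    ultimately show ?thesis by (simp only: nat.distinct if_False)
  next
    case 3
    let ?B = "real ((2 * g + i - 1) choose i) * (real ((2 * g) choose j) - (if j < 2 then 0 else real ((2 * g) choose (j - 2))))"
    have "real (form.dim (prim g i j) + ((2 * g + i - 1) choose i) * (if j < 2 then 0 else (2 * g) choose (j - 2)))
        = real (((2 * g + i - 1) choose i) * ((2 * g) choose j))"
      using dim_prim[of j g i] 3 by simp
    then have "real (form.dim (prim g i j)) = ?B"
      by (simp add: algebra_simps split: if_splits)
    moreover define B where "B = ?B"
    ultimately have prim: "real (form.dim (prim g i j)) = B" by (simp only:)
    show ?thesis
    proof (cases i)
      case 0
      then show ?thesis using prim 3 dim_formula_0[of j g] unfolding B_def by (simp add: harm_0)
    next
      case (Suc m)
      obtain l where l: "j = Suc l" using 3 by (cases j) auto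
      \<comment> \<open>Primitive forms split along \<open>wc.del\<close>, and its kernel, the
        coclosed forms, splits along \<open>wc.d\<close>.\<close>
      have p: "form.dim (prim g i j) = form.dim (harm g i j) + form.dim (harm g m (Suc j)) + form.dim (coclosed g m l)"
        using dim_prim_Suc_Suc[of l g m] dim_coclosed_Suc[of g m j] 3 Suc l by simp
      then have p: "B = real (form.dim (harm g i j)) + real (form.dim (harm g m (Suc j))) + real (form.dim (coclosed g m l))"
        unfolding prim[symmetric] by simp
      have h1: "real (form.dim (harm g m (Suc j))) = dim_formula g m (Suc j)"
        using less.IH[of m "Suc j"] Suc 3 by simp
      have h2: "real (form.dim (harm g m l)) = (if l = 0 then (if m = 0 then 1 else 0) else dim_formula g m l)"
        using less.IH[of m l] Suc 3 l by simp
      show ?thesis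
      proof (cases m)
        case 0
        then have "form.dim (coclosed g m l) = form.dim (harm g m l)" by (simp add: coclosed_0 harm_0)
        then have *: "real (form.dim (harm g i j)) = B - dim_formula g m (Suc j) - (if l = 0 then 1 else dim_formula g m l)"
          using p h1 h2 0 by simp
        show ?thesis
        proof (cases "j = 1")
          case True
          then show ?thesis using * l 0 Suc unfolding B_def using dim_formula_1_1[OF assms(1)]
            by (simp add: power2_eq_square numeral_2_eq_2)
        next
          case False
          then show ?thesis using * l 0 Suc unfolding B_def using dim_formula_recursion[of i j g] 3 by simp
        qed
      next
        case (Suc m')
        have "real (form.dim (harm g m' j)) = dim_formula g m' j"
          using less.IH[of m' j] \<open>i = Suc m\<close> Suc 3 by simp
        moreover have "form.dim (coclosed g m l) = form.dim (harm g m l) + form.dim (harm g m' j)"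
          using dim_coclosed_Suc[of g m' l] Suc l by simp
        moreover have "l = 0 \<Longrightarrow> dim_formula g m l = 0" by (simp add: dim_formula_def)
        ultimately have "real (form.dim (coclosed g m l)) = dim_formula g m l + dim_formula g m' j"
          using h2 Suc by (simp split: if_splits)
        moreover have "B = dim_formula g i j + dim_formula g m (Suc j) + dim_formula g m l + dim_formula g m' j"
          unfolding B_def using dim_formula_recursion[of i j g] 3 l Suc \<open>i = Suc m\<close> by simp
        ultimately have "real (form.dim (harm g i j)) = dim_formula g i j" using p h1 by linarith
        then show ?thesis using l by simp
      qed
    qed
  qed
qed

section \<open>The action of the symplectic Lie algebra\<close>

lemma mult_mat_index:
  "A \<in> carrier_mat n n \<Longrightarrow> B \<in> carrier_mat n n \<Longrightarrow> k < n \<Longrightarrow> l < n \<Longrightarrow>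
    (A * B) $$ (k, l) = (\<Sum>m<n. A $$ (k, m) * B $$ (m, l))"
  by (simp add: scalar_prod_def atLeast0LessThan)

lemma sn_conj [simp]: "k < 2 * g \<Longrightarrow> sn g (opp g k) = - sn g k"
  by (auto simp: sn_def opp_def)

lemma sn_sq [simp]: "sn g k * sn g k = 1" "sn g k * (sn g k * z) = z"
  by (simp_all add: sn_def)

lemma symp_form_carrier: "symp_form g \<in> carrier_mat (2 * g) (2 * g)"
  by (auto simp: symp_form_def mult_2)

lemma symp_form_index:
  "k < 2 * g \<Longrightarrow> l < 2 * g \<Longrightarrow> symp_form g $$ (k, l) = (if l = opp g k then sn g k else 0)"
  by (auto simp: symp_form_def opp_def sn_def)

lemma sp_carrier: "X \<in> sp g \<Longrightarrow> X \<in> carrier_mat (2 * g) (2 * g)"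
  by (simp add: sp_def)

text \<open>Each row and column of \<open>symp_form\<close> has a single nonzero entry, so every
  entry of the two products in the defining equation has only one term.\<close>

lemma sp_iff:
  "X \<in> sp g \<longleftrightarrow> X \<in> carrier_mat (2 * g) (2 * g) \<and>
    (\<forall>k<2 * g. \<forall>l<2 * g. X $$ (opp g l, opp g k) = - sn g k * sn g l * X $$ (k, l))"
proof (cases "X \<in> carrier_mat (2 * g) (2 * g)")
  case X: True
  have entry: "(transpose_mat X * symp_form g + symp_form g * X) $$ (k, l)
      = sn g k * X $$ (opp g k, l) - sn g l * X $$ (opp g l, k)" if kl: "k < 2 * g" "l < 2 * g" for k l
  proof -
    have "(transpose_mat X * symp_form g) $$ (k, l) = (\<Sum>m<2 * g. X $$ (m, k) * symp_form g $$ (m, l))"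
      using X kl symp_form_carrier[of g] by (subst mult_mat_index[where n = "2 * g"]) auto
    also have "\<dots> = (\<Sum>m<2 * g. if m = opp g l then - sn g l * X $$ (opp g l, k) else 0)"
      using kl by (intro sum.cong refl) (auto simp: symp_form_index)
    also have "\<dots> = - sn g l * X $$ (opp g l, k)" using kl by simp
    finally have 1: "(transpose_mat X * symp_form g) $$ (k, l) = - sn g l * X $$ (opp g l, k)" .
    have "(symp_form g * X) $$ (k, l) = (\<Sum>m<2 * g. symp_form g $$ (k, m) * X $$ (m, l))"
      using X kl symp_form_carrier[of g] by (subst mult_mat_index[where n = "2 * g"]) auto
    also have "\<dots> = (\<Sum>m<2 * g. if m = opp g k then sn g k * X $$ (opp g k, l) else 0)"
      using kl by (intro sum.cong refl) (auto simp: symp_form_index)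
    also have "\<dots> = sn g k * X $$ (opp g k, l)" using kl by simp
    finally show ?thesis using X kl symp_form_carrier[of g] 1 by simp
  qed
  have "X \<in> sp g \<longleftrightarrow> (\<forall>k<2 * g. \<forall>l<2 * g. sn g k * X $$ (opp g k, l) = sn g l * X $$ (opp g l, k))"
  proof
    assume "X \<in> sp g"
    then have "(transpose_mat X * symp_form g + symp_form g * X) = 0\<^sub>m (2 * g) (2 * g)" by (simp add: sp_def)
    then show "\<forall>k<2 * g. \<forall>l<2 * g. sn g k * X $$ (opp g k, l) = sn g l * X $$ (opp g l, k)"
      using entry by simp
  next
    assume *: "\<forall>k<2 * g. \<forall>l<2 * g. sn g k * X $$ (opp g k, l) = sn g l * X $$ (opp g l, k)"
    have "(transpose_mat X * symp_form g + symp_form g * X) = 0\<^sub>m (2 * g) (2 * g)"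
      by (rule eq_matI) (use X symp_form_carrier[of g] entry * in auto)
    then show "X \<in> sp g" using X by (simp add: sp_def)
  qed
  also have "\<dots> \<longleftrightarrow> (\<forall>k<2 * g. \<forall>l<2 * g. X $$ (opp g l, opp g k) = - sn g k * sn g l * X $$ (k, l))"
  proof safe
    fix k l assume kl: "k < 2 * g" "l < 2 * g"
    assume *: "\<forall>k<2 * g. \<forall>l<2 * g. sn g k * X $$ (opp g k, l) = sn g l * X $$ (opp g l, k)"
    have "- (sn g k * X $$ (k, l)) = sn g l * X $$ (opp g l, opp g k)"
      using *[rule_format, of "opp g k" l] kl by simp
    then show "X $$ (opp g l, opp g k) = - sn g k * sn g l * X $$ (k, l)"
      by (auto simp: sn_def split: if_splits)
  next
    fix k l assume kl: "k < 2 * g" "l < 2 * g"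
    assume *: "\<forall>k<2 * g. \<forall>l<2 * g. X $$ (opp g l, opp g k) = - sn g k * sn g l * X $$ (k, l)"
    show "sn g k * X $$ (opp g k, l) = sn g l * X $$ (opp g l, k)"
      using *[rule_format, of "opp g k" l] kl by (simp add: mult.left_commute)
  qed
  finally show ?thesis using X by simp
qed (simp add: sp_def)

text \<open>The symplectic counterpart of a matrix unit, matching \<open>wc.Y g k l\<close>. For
  \<open>l = opp g k\<close> both conditions describe the same entry, which is then 2; for
  \<open>k = l\<close> the matrix lies in the Cartan subalgebra.\<close>

definition Zm :: "nat \<Rightarrow> nat \<Rightarrow> nat \<Rightarrow> complex mat" where
  "Zm g k l = mat (2 * g) (2 * g) (\<lambda>(a, b). (if a = k \<and> b = l then 1 else 0)
     - (if a = opp g l \<and> b = opp g k then sn g k * sn g l else 0))"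

lemma Zm_carrier [simp]: "Zm g k l \<in> carrier_mat (2 * g) (2 * g)"
  by (simp add: Zm_def)

lemma Zm_sp: "k < 2 * g \<Longrightarrow> l < 2 * g \<Longrightarrow> Zm g k l \<in> sp g"
  unfolding sp_iff
proof (intro conjI allI impI)
  fix a b assume kl: "k < 2 * g" "l < 2 * g" and ab: "a < 2 * g" "b < 2 * g"
  let ?A = "a = k \<and> b = l" and ?B = "a = opp g l \<and> b = opp g k"
  have entry: "Zm g k l $$ (a, b) = (if ?A then 1 else 0) - (if ?B then sn g k * sn g l else 0)"
    using ab by (simp add: Zm_def)
  have "opp g b = k \<and> opp g a = l \<longleftrightarrow> ?B"
    using kl ab by (metis opp_opp)
  moreover have "opp g b = opp g l \<and> opp g a = opp g k \<longleftrightarrow> ?A"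
    using kl ab by auto
  ultimately have entry': "Zm g k l $$ (opp g b, opp g a)
      = (if ?B then 1 else 0) - (if ?A then sn g k * sn g l else 0)"
    using ab by (simp add: Zm_def)
  have signs: "sn g a * sn g b = sn g k * sn g l" if "?A \<or> ?B"
    using that kl by (elim disjE) simp_all
  have square: "sn g k * sn g l * (sn g k * sn g l) = 1" by (simp add: sn_def)
  have key: "(if B then 1 else 0) - (if A then q else 0) = - (p * ((if A then 1 else 0) - (if B then q else 0)))"
    if "A \<or> B \<Longrightarrow> p = q" "q * q = 1" for A B and p q :: complex
    using that by (auto simp: right_diff_distrib)
  show "Zm g k l $$ (opp g b, opp g a) = - sn g a * sn g b * Zm g k l $$ (a, b)"
    unfolding entry entry' mult_minus_left by (rule key[OF signs square])
qed (simp add: Zm_def)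

lemma sum_sum_single:
  fixes x :: "'a :: comm_monoid_add" and a b n :: nat
  assumes "a < n" "b < n"
  shows "(\<Sum>k<n. \<Sum>l<n. if k = a \<and> l = b then x else 0) = x"
proof -
  have "(\<Sum>k<n. \<Sum>l<n. if k = a \<and> l = b then x else 0) = (\<Sum>k<n. if k = a then x else 0)"
  proof (rule sum.cong[OF refl])
    fix k
    show "(\<Sum>l<n. if k = a \<and> l = b then x else 0) = (if k = a then x else 0)"
      using assms by (cases "k = a") simp_all
  qed
  then show ?thesis using assms by simp
qed

text \<open>A symplectic matrix is half the sum of all \<open>Zm g k l\<close> weighted by its
  entries, because its entry at (a, b) is met twice: for the pair (a, b) and for (opp b, opp a). The
  partial sums \<open>P K\<close> are kept inside \<open>sp g\<close>, as the rule for addition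
  demands.\<close>

lemma sp_induct [consumes 1, case_names zero gen add smult]:
  assumes X: "X \<in> sp g"
    and zero: "Q (0\<^sub>m (2 * g) (2 * g))"
    and gen: "\<And>k l. k < 2 * g \<Longrightarrow> l < 2 * g \<Longrightarrow> Q (Zm g k l)"
    and add: "\<And>A B. A \<in> sp g \<Longrightarrow> B \<in> sp g \<Longrightarrow> Q A \<Longrightarrow> Q B \<Longrightarrow> Q (A + B)"
    and smult: "\<And>c A. A \<in> sp g \<Longrightarrow> Q A \<Longrightarrow> Q (c \<cdot>\<^sub>m A)"
  shows "Q X"
proof -
  have sp_add: "A + B \<in> sp g" if "A \<in> sp g" "B \<in> sp g" for A B
    using that by (auto simp: sp_iff distrib_left)
  have sp_smult: "c \<cdot>\<^sub>m A \<in> sp g" if "A \<in> sp g" for A c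
    using that by (auto simp: sp_iff mult.left_commute)
  define P where "P K = mat (2 * g) (2 * g) (\<lambda>ab. \<Sum>(k, l)\<in>K. X $$ (k, l) / 2 * Zm g k l $$ ab)" for K
  have "Q (P K) \<and> P K \<in> sp g" if "finite K" "K \<subseteq> {..<2 * g} \<times> {..<2 * g}" for K
    using that
  proof (induction K rule: finite_induct)
    case empty
    have "P {} = 0\<^sub>m (2 * g) (2 * g)" by (rule eq_matI) (auto simp: P_def)
    then show ?case using zero by (simp add: sp_iff)
  next
    case (insert kl K)
    obtain k l where [simp]: "kl = (k, l)" by fastforce
    have kl: "k < 2 * g" "l < 2 * g" using insert by auto
    have "P (insert kl K) = (X $$ (k, l) / 2) \<cdot>\<^sub>m Zm g k l + P K"
      by (rule eq_matI) (use insert in \<open>auto simp: P_def Zm_def\<close>)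
    then show ?case
      using insert kl by (auto intro!: add smult gen sp_add sp_smult Zm_sp)
  qed
  from this[of "{..<2 * g} \<times> {..<2 * g}"] have "Q (P ({..<2 * g} \<times> {..<2 * g}))" by simp
  also have "P ({..<2 * g} \<times> {..<2 * g}) = X"
  proof (rule eq_matI)
    fix a b assume "a < dim_row X" "b < dim_col X"
    then have ab: "a < 2 * g" "b < 2 * g" using sp_carrier[OF X] by auto
    have "P ({..<2 * g} \<times> {..<2 * g}) $$ (a, b) = (\<Sum>k<2 * g. \<Sum>l<2 * g. X $$ (k, l) / 2 * Zm g k l $$ (a, b))"
      using ab by (simp add: P_def sum.cartesian_product)
    also have "\<dots> = (\<Sum>k<2 * g. \<Sum>l<2 * g. (if k = a \<and> l = b then X $$ (a, b) / 2 else 0)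
      + (if k = opp g b \<and> l = opp g a then X $$ (a, b) / 2 else 0))"
    proof (intro sum.cong refl)
      fix k l assume kl: "k \<in> {..<2 * g}" "l \<in> {..<2 * g}"
      have "X $$ (opp g b, opp g a) = - sn g a * sn g b * X $$ (a, b)"
        using X ab by (simp add: sp_iff)
      then have swap: "- (X $$ (opp g b, opp g a) * (sn g a * sn g b)) = X $$ (a, b)"
        by (simp add: algebra_simps)
      let ?A = "k = a \<and> l = b" and ?B = "k = opp g b \<and> l = opp g a"
      have B: "a = opp g l \<and> b = opp g k \<longleftrightarrow> ?B"
        using ab kl by (metis opp_opp lessThan_iff)
      have A: "a = k \<and> b = l \<longleftrightarrow> ?A" by blast
      have entry: "Zm g k l $$ (a, b) = (if ?A then 1 else 0) - (if ?B then sn g k * sn g l else 0)"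
        using ab unfolding Zm_def A[symmetric] B[symmetric] by simp
      have key: "u / 2 * ((if A then 1 else 0) - (if B then q else 0)) = (if A then x / 2 else 0) + (if B then x / 2 else 0)"
        if "A \<Longrightarrow> u = x" "B \<Longrightarrow> - (u * q) = x" for A B and u q x :: complex
      proof -
        have "u / 2 * ((if A then 1 else 0) - (if B then q else 0)) = (if A then u / 2 else 0) + (if B then - (u * q) / 2 else 0)"
          by (simp add: algebra_simps)
        also have "(if A then u / 2 else 0) = (if A then x / 2 else 0)" by (rule if_cong) (simp_all only: that)
        also have "(if B then - (u * q) / 2 else 0) = (if B then x / 2 else 0)" by (rule if_cong) (simp_all only: that)
        finally show ?thesis .
      qed
      have "sn g (opp g b) * sn g (opp g a) = sn g a * sn g b" using ab by (simp add: mult.commute)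
      then have hB: "- (X $$ (k, l) * (sn g k * sn g l)) = X $$ (a, b)" if ?B
        unfolding conjunct1[OF that] conjunct2[OF that] using swap by (simp only:)
      have hA: "X $$ (k, l) = X $$ (a, b)" if ?A
        unfolding conjunct1[OF that] conjunct2[OF that] ..
      show "X $$ (k, l) / 2 * Zm g k l $$ (a, b) = (if ?A then X $$ (a, b) / 2 else 0) + (if ?B then X $$ (a, b) / 2 else 0)"
        unfolding entry by (rule key[OF hA hB])
    qed
    also have "\<dots> = X $$ (a, b)"
    proof -
      define x where "x = X $$ (a, b) / 2"
      have "(\<Sum>k<2 * g. \<Sum>l<2 * g. u k l + v k l) = (\<Sum>k<2 * g. \<Sum>l<2 * g. u k l) + (\<Sum>k<2 * g. \<Sum>l<2 * g. v k l)"
        for u v :: "nat \<Rightarrow> nat \<Rightarrow> complex"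
        by (simp add: sum.distrib)
      then have "(\<Sum>k<2 * g. \<Sum>l<2 * g. (if k = a \<and> l = b then x else 0) + (if k = opp g b \<and> l = opp g a then x else 0))
        = (\<Sum>k<2 * g. \<Sum>l<2 * g. if k = a \<and> l = b then x else 0)
          + (\<Sum>k<2 * g. \<Sum>l<2 * g. if k = opp g b \<and> l = opp g a then x else 0)" .
      also have "(\<Sum>k<2 * g. \<Sum>l<2 * g. if k = a \<and> l = b then x else 0) = x"
        by (rule sum_sum_single[OF ab])
      also have "(\<Sum>k<2 * g. \<Sum>l<2 * g. if k = opp g b \<and> l = opp g a then x else 0) = x"
        by (rule sum_sum_single[OF opp_less[OF ab(2)] opp_less[OF ab(1)]])
      also have "x + x = X $$ (a, b)" by (simp add: x_def)
      finally show ?thesis unfolding x_def .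
    qed
    finally show "P ({..<2 * g} \<times> {..<2 * g}) $$ (a, b) = X $$ (a, b)" .
  qed (use sp_carrier[OF X] in \<open>auto simp: P_def\<close>)
  finally show ?thesis .
qed

lemma lie_bracket_index:
  "X \<in> carrier_mat n n \<Longrightarrow> Y \<in> carrier_mat n n \<Longrightarrow> k < n \<Longrightarrow> l < n \<Longrightarrow>
    lie_bracket X Y $$ (k, l) = (\<Sum>m<n. X $$ (k, m) * Y $$ (m, l)) - (\<Sum>m<n. Y $$ (k, m) * X $$ (m, l))"
  unfolding lie_bracket_def by (simp add: mult_mat_index del: index_mult_mat(1))

lemma lie_bracket_carrier: "X \<in> carrier_mat n n \<Longrightarrow> Y \<in> carrier_mat n n \<Longrightarrow> lie_bracket X Y \<in> carrier_mat n n"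
  by (auto simp: lie_bracket_def)

lemma lie_bracket_sp:
  assumes X: "X \<in> sp g" and Y: "Y \<in> sp g"
  shows "lie_bracket X Y \<in> sp g"
proof -
  note c = sp_carrier[OF X] sp_carrier[OF Y]
  have "(\<Sum>m<2 * g. A $$ (opp g l, m) * B $$ (m, opp g k)) = sn g k * sn g l * (\<Sum>m<2 * g. B $$ (k, m) * A $$ (m, l))"
    if A: "A \<in> sp g" and B: "B \<in> sp g" and kl: "k < 2 * g" "l < 2 * g" for A B k l
  proof -
    have "(\<Sum>m<2 * g. A $$ (opp g l, m) * B $$ (m, opp g k))
      = (\<Sum>m<2 * g. A $$ (opp g l, opp g m) * B $$ (opp g m, opp g k))"
      by (rule sum_opp[symmetric])
    also have "\<dots> = (\<Sum>m<2 * g. sn g k * sn g l * (B $$ (k, m) * A $$ (m, l)))"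
    proof (intro sum.cong refl)
      fix m assume "m \<in> {..<2 * g}"
      then have "A $$ (opp g l, opp g m) = - sn g m * sn g l * A $$ (m, l)"
        "B $$ (opp g m, opp g k) = - sn g k * sn g m * B $$ (k, m)"
        using A B kl by (simp_all add: sp_iff)
      then show "A $$ (opp g l, opp g m) * B $$ (opp g m, opp g k)
        = sn g k * sn g l * (B $$ (k, m) * A $$ (m, l))"
        by (auto simp: sn_def)
    qed
    finally show ?thesis by (simp add: sum_distrib_left)
  qed
  note * = this
  show ?thesis
    unfolding sp_iff using lie_bracket_carrier[OF c] *[OF X Y] *[OF Y X]
    by (simp add: lie_bracket_index[OF c] right_diff_distrib)
qed

text \<open>The position of \<open>k\<close> in the basis order 0, ..., g - 1, 2g - 1, ..., g. In
  this order \<open>opp g\<close> is the reversal, and the matrices \<open>Zm g k l\<close> with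
  \<open>pos g k < pos g l\<close> are strictly upper triangular and span the positive root
  spaces.\<close>

definition pos :: "nat \<Rightarrow> nat \<Rightarrow> nat" where
  "pos g k = (if k < g then k else 3 * g - 1 - k)"

lemma pos_less: "k < 2 * g \<Longrightarrow> pos g k < 2 * g"
  by (auto simp: pos_def)

lemma pos_pos: "k < 2 * g \<Longrightarrow> pos g (pos g k) = k"
  by (auto simp: pos_def)

lemma pos_inj: "k < 2 * g \<Longrightarrow> l < 2 * g \<Longrightarrow> pos g k = pos g l \<longleftrightarrow> k = l"
  by (metis pos_pos)

lemma pos_conj: "k < 2 * g \<Longrightarrow> pos g (opp g k) = 2 * g - 1 - pos g k"
  by (auto simp: pos_def opp_def)

lemma pos_conj_less: "k < 2 * g \<Longrightarrow> l < 2 * g \<Longrightarrow> pos g k < pos g l \<Longrightarrow> pos g (opp g l) < pos g (opp g k)"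
  using pos_less[of k g] pos_less[of l g] by (simp add: pos_conj)

section \<open>Cartan subalgebra and root vectors\<close>

lemma cartan_sp: "H \<in> cartan g \<Longrightarrow> H \<in> sp g"
  by (simp add: cartan_def)

lemma cartan_index: "H \<in> cartan g \<Longrightarrow> k < 2 * g \<Longrightarrow> l < 2 * g \<Longrightarrow> k \<noteq> l \<Longrightarrow> H $$ (k, l) = 0"
  using sp_carrier[of H g] by (auto simp: cartan_def diagonal_mat_def)

lemma cartan_conj: "H \<in> cartan g \<Longrightarrow> k < 2 * g \<Longrightarrow> H $$ (opp g k, opp g k) = - H $$ (k, k)"
  by (simp add: cartan_def sp_iff)

lemma lie_bracket_cartan:
  assumes H: "H \<in> cartan g" and kl: "k < 2 * g" "l < 2 * g"
  shows "lie_bracket H (Zm g k l) = (H $$ (k, k) - H $$ (l, l)) \<cdot>\<^sub>m Zm g k l"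
proof (rule eq_matI)
  note c = sp_carrier[OF cartan_sp[OF H]] Zm_carrier[of g k l]
  fix a b assume "a < dim_row ((H $$ (k, k) - H $$ (l, l)) \<cdot>\<^sub>m Zm g k l)" "b < dim_col ((H $$ (k, k) - H $$ (l, l)) \<cdot>\<^sub>m Zm g k l)"
  then have ab: "a < 2 * g" "b < 2 * g" by (auto simp: Zm_def)
  have "(\<Sum>m<2 * g. H $$ (a, m) * Zm g k l $$ (m, b)) = (\<Sum>m<2 * g. if m = a then H $$ (a, a) * Zm g k l $$ (a, b) else 0)"
    using ab by (intro sum.cong refl) (auto simp: cartan_index[OF H])
  moreover have "(\<Sum>m<2 * g. Zm g k l $$ (a, m) * H $$ (m, b)) = (\<Sum>m<2 * g. if m = b then Zm g k l $$ (a, b) * H $$ (b, b) else 0)"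
    using ab by (intro sum.cong refl) (auto simp: cartan_index[OF H])
  ultimately have "lie_bracket H (Zm g k l) $$ (a, b) = (H $$ (a, a) - H $$ (b, b)) * Zm g k l $$ (a, b)"
    unfolding lie_bracket_index[OF c ab] using ab by (simp add: algebra_simps)
  also have "\<dots> = (H $$ (k, k) - H $$ (l, l)) * Zm g k l $$ (a, b)"
    using ab kl by (auto simp: Zm_def cartan_conj[OF H])
  finally show "lie_bracket H (Zm g k l) $$ (a, b) = ((H $$ (k, k) - H $$ (l, l)) \<cdot>\<^sub>m Zm g k l) $$ (a, b)"
    using ab by (simp add: Zm_def)
qed (use lie_bracket_carrier[OF sp_carrier[OF cartan_sp[OF H]] Zm_carrier[of g k l]] in \<open>auto simp: Zm_def\<close>)

lemma Zm_root_space: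
  assumes kl: "k < 2 * g" "l < 2 * g" "pos g k < pos g l"
  shows "\<exists>\<alpha>\<in>positive_roots g. Zm g k l \<in> root_space g \<alpha>"
proof -
  consider "k < g" "l < g" | "k < g" "l \<ge> g" | "k \<ge> g" "l \<ge> g" | "k \<ge> g" "l < g" by linarith
  then show ?thesis
  proof cases
    case 1
    let ?\<alpha> = "\<lambda>H. std_coord k H - std_coord l H"
    have "?\<alpha> \<in> positive_roots g" using 1 kl by (auto simp: positive_roots_def pos_def)
    moreover have "Zm g k l \<in> root_space g ?\<alpha>"
      using kl by (auto simp: root_space_def Zm_sp lie_bracket_cartan std_coord_def)
    ultimately show ?thesis by blast
  next
    case 2
    define b where "b = l - g"
    have b: "l = opp g b" "b < g" using 2 kl by (auto simp: b_def opp_def)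
    \<comment> \<open>Minimum and maximum put the two coordinates into the order demanded by
      \<open>positive_roots\<close>; equality \<open>k = b\<close> gives a long root.\<close>
    let ?\<alpha> = "\<lambda>H. std_coord (min k b) H + std_coord (max k b) H"
    have "\<exists>a' b'. ?\<alpha> = (\<lambda>H. std_coord a' H + std_coord b' H) \<and> a' \<le> b' \<and> b' < g"
      by (rule exI[of _ "min k b"], rule exI[of _ "max k b"]) (use 2 b in simp)
    then have "?\<alpha> \<in> positive_roots g" unfolding positive_roots_def by blast
    moreover have "Zm g k l \<in> root_space g ?\<alpha>"
    proof -
      have "H $$ (k, k) - H $$ (l, l) = ?\<alpha> H" if "H \<in> cartan g" for H
        using cartan_conj[OF that, of b] b by (cases "k \<le> b") (simp_all add: std_coord_def)
      then show ?thesis using kl by (simp add: root_space_def Zm_sp lie_bracket_cartan)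
    qed
    ultimately show ?thesis by blast
  next
    case 3
    define a b where "a = l - g" "b = k - g"
    have b: "k = opp g b" "b < g" "l = opp g a" "a < g" "a < b" using 3 kl by (auto simp: a_b_def opp_def pos_def)
    let ?\<alpha> = "\<lambda>H. std_coord a H - std_coord b H"
    have "?\<alpha> \<in> positive_roots g" using b by (auto simp: positive_roots_def)
    moreover have "Zm g k l \<in> root_space g ?\<alpha>"
    proof -
      have "H $$ (k, k) - H $$ (l, l) = ?\<alpha> H" if "H \<in> cartan g" for H
        using cartan_conj[OF that, of a] cartan_conj[OF that, of b] b by (simp add: std_coord_def)
      then show ?thesis using kl by (simp add: root_space_def Zm_sp lie_bracket_cartan)
    qed
    ultimately show ?thesis by blast
  next
    case 4
    then show ?thesis using kl by (auto simp: pos_def)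
  qed
qed

text \<open>The sum of the positive coroots, with entries 2g - 1, 2g - 3, ..., 1 on the first half
  of the diagonal. Every simple root takes the value 2 on it, so a lowering operator decreases its
  eigenvalue by a positive even integer.\<close>

definition rho_mat :: "nat \<Rightarrow> complex mat" where
  "rho_mat g = mat (2 * g) (2 * g) (\<lambda>(a, b). if a = b then of_int (2 * int g - 1 - 2 * int (pos g a)) else 0)"

lemma rho_mat_cartan: "rho_mat g \<in> cartan g"
proof -
  have "rho_mat g \<in> sp g"
    unfolding sp_iff
  proof (intro conjI allI impI)
    fix k l assume kl: "k < 2 * g" "l < 2 * g"
    show "rho_mat g $$ (opp g l, opp g k) = - sn g k * sn g l * rho_mat g $$ (k, l)"
      using kl pos_less[of k g] by (auto simp: rho_mat_def pos_conj of_nat_diff)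
  qed (simp add: rho_mat_def)
  then show ?thesis by (simp add: cartan_def diagonal_mat_def rho_mat_def)
qed

lemma rho_mat_diag: "k < 2 * g \<Longrightarrow> rho_mat g $$ (k, k) = of_int (2 * int g - 1 - 2 * int (pos g k))"
  by (simp add: rho_mat_def)

lemma Zm_diag_cartan: "k < 2 * g \<Longrightarrow> Zm g k k \<in> cartan g"
  by (auto simp: cartan_def Zm_sp) (auto simp: Zm_def diagonal_mat_def)

section \<open>The representation on forms\<close>

definition act :: "nat \<Rightarrow> complex mat \<Rightarrow> lop" where
  "act g X = (\<Sum>k<2 * g. \<Sum>l<2 * g. sc (X $$ (k, l)) * wc.T k l)"

lemma act_add: "X \<in> sp g \<Longrightarrow> Y \<in> sp g \<Longrightarrow> act g (X + Y) = act g X + act g Y"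
  using sp_carrier[of X g] sp_carrier[of Y g]
  by (simp add: act_def sc_hom distrib_right sum.distrib)

lemma act_smult: "X \<in> sp g \<Longrightarrow> act g (a \<cdot>\<^sub>m X) = sc a * act g X"
  using sp_carrier[of X g] by (simp add: act_def sc_hom sum_distrib_left mult.assoc)

lemma act_zero: "act g (0\<^sub>m (2 * g) (2 * g)) = 0"
  by (simp add: act_def sc_hom)

lemma act_bracket:
  assumes "X \<in> sp g" "Y \<in> sp g"
  shows "act g (lie_bracket X Y) = act g X * act g Y - act g Y * act g X"
proof -
  have "act g X * act g Y - act g Y * act g X = (\<Sum>k<2 * g. \<Sum>l<2 * g.
    ((\<Sum>m<2 * g. sc (X $$ (k, m)) * sc (Y $$ (m, l))) - (\<Sum>m<2 * g. sc (Y $$ (k, m)) * sc (X $$ (m, l)))) * wc.T k l)"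
    unfolding act_def by (rule wc.linear_T_comm) (rule sc_central)+
  also have "\<dots> = act g (lie_bracket X Y)"
    unfolding act_def using assms
    by (intro sum.cong refl) (simp add: lie_bracket_index[OF sp_carrier sp_carrier] sc_hom sc_sum)
  finally show ?thesis by simp
qed

lemma sc_sn: "sc (sn g k) = wc.s g k"
  by (auto simp: sn_def wc.s_def sc_hom)

lemma if_eqI: "(A \<Longrightarrow> x = y) \<Longrightarrow> (if A then x else z) = (if A then y else z)"
  by (rule if_cong[OF refl _ refl])

lemma act_Zm:
  assumes "k < 2 * g" "l < 2 * g"
  shows "act g (Zm g k l) = wc.Y g k l"
proof -
  let ?S = "wc.s g k * wc.s g l * wc.T (opp g l) (opp g k)"
  have "act g (Zm g k l) = (\<Sum>a<2 * g. \<Sum>b<2 * g. (if a = k \<and> b = l then wc.T k l else 0)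
    - (if a = opp g l \<and> b = opp g k then ?S else 0))"
    unfolding act_def
  proof (intro sum.cong refl)
    fix a b assume ab: "a \<in> {..<2 * g}" "b \<in> {..<2 * g}"
    have expand: "sc ((if A then 1 else 0) - (if B then z else 0)) * t = (if A then t else 0) - (if B then sc z * t else 0)"
      for A B z t
      by (cases A; cases B) (simp_all add: sc_hom left_diff_distrib)
    have "Zm g k l $$ (a, b) = (if a = k \<and> b = l then 1 else 0)
        - (if a = opp g l \<and> b = opp g k then sn g k * sn g l else 0)"
      using ab by (simp add: Zm_def)
    then have "sc (Zm g k l $$ (a, b)) * wc.T a b = (if a = k \<and> b = l then wc.T a b else 0)
        - (if a = opp g l \<and> b = opp g k then wc.s g k * wc.s g l * wc.T a b else 0)"
      by (simp only: expand sc_hom(2) sc_sn)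
    also have "(if a = k \<and> b = l then wc.T a b else 0) = (if a = k \<and> b = l then wc.T k l else 0)"
      by (rule if_eqI, elim conjE, hypsubst, rule refl)
    also have "(if a = opp g l \<and> b = opp g k then wc.s g k * wc.s g l * wc.T a b else 0)
        = (if a = opp g l \<and> b = opp g k then ?S else 0)"
      by (rule if_eqI, elim conjE, hypsubst, rule refl)
    finally show "sc (Zm g k l $$ (a, b)) * wc.T a b = (if a = k \<and> b = l then wc.T k l else 0)
        - (if a = opp g l \<and> b = opp g k then ?S else 0)" .
  qed
  also have "\<dots> = (\<Sum>a<2 * g. \<Sum>b<2 * g. if a = k \<and> b = l then wc.T k l else 0)
    - (\<Sum>a<2 * g. \<Sum>b<2 * g. if a = opp g l \<and> b = opp g k then ?S else 0)"
    by (simp only: sum_subtractf)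
  also have "\<dots> = wc.T k l - ?S"
    by (simp only: sum_sum_single[OF assms] sum_sum_single[OF opp_less[OF assms(2)] opp_less[OF assms(1)]])
  finally show ?thesis by (simp only: wc.Y_def)
qed

lemma act_homog: "f \<in> homog (2 * g) i j \<Longrightarrow> ap (act g X) f \<in> homog (2 * g) i j"
  by (auto simp: act_def ap_sum intro!: homog_closed T_homog)

lemma Y_homog: "k < 2 * g \<Longrightarrow> l < 2 * g \<Longrightarrow> f \<in> homog (2 * g) i j \<Longrightarrow> ap (wc.Y g k l) f \<in> homog (2 * g) i j"
  by (simp add: act_Zm[symmetric] act_homog)

text \<open>Transposing a matrix unit is taking the adjoint for the Fischer inner product, so
  raising and lowering operators are adjoint to each other.\<close>

lemma ip_Y:
  assumes "k < 2 * g" "l < 2 * g" "f \<in> homog (2 * g) i j" "h \<in> homog (2 * g) i j"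
  shows "ip (2 * g) i j (ap (wc.Y g k l) f) h = ip (2 * g) i j f (ap (wc.Y g l k) h)"
  using assms by (simp add: wc.Y_def ip_left ip_right ip_T)

lemma Y_harm:
  assumes "k < 2 * g" "l < 2 * g" "f \<in> harm g i j"
  shows "ap (wc.Y g k l) f \<in> harm g i j"
proof -
  let ?h = "ap (wc.Y g k l) f"
  have f: "f \<in> homog (2 * g) i j" "ap (wc.Lam g) f = 0" "ap (wc.del g) f = 0" "ap (wc.d g) f = 0"
    using assms(3) unfolding harm_def coclosed_def prim_def by blast+
  have "ap (A * wc.Y g k l) f = 0" if "wc.Y g k l * A = A * wc.Y g k l" "ap A f = 0" for A
    unfolding that(1)[symmetric] by (simp add: that(2))
  then have "ap A ?h = 0" if "wc.Y g k l * A = A * wc.Y g k l" "ap A f = 0" for A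
    using that by (simp only: ap_mult)
  from this[OF wc.Y_Lam[OF assms(1,2)] f(2)] this[OF wc.Y_del[OF assms(1,2)] f(3)] this[OF wc.Y_d[OF assms(1,2)] f(4)]
    Y_homog[OF assms(1,2) f(1)]
  show ?thesis unfolding harm_def coclosed_def prim_def mem_Collect_eq by (intro conjI)
qed

text \<open>Both x_k and dx_k have the weight of the basis vector \<open>k\<close>, so counting them
  together gives the weight of a monomial under the diagonal matrices of gl(2g).\<close>

definition mult_of :: "(nat \<Rightarrow> nat) \<times> nat set \<Rightarrow> nat \<Rightarrow> nat" where
  "mult_of s k = fst s k + (if k \<in> snd s then 1 else 0)"

lemma T_diag_apply: "ap (wc.T k k) f s = of_nat (mult_of s k) * f s"
proof -
  have "ap (mulx k) (ap (ddx k) f) s = of_nat (fst s k) * f s"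
    by (cases "fst s k") (auto simp: op_apply fun_upd_idem)
  moreover have "ap (wedge k) (ap (contr k) f) s = (if k \<in> snd s then f s else 0)"
    by (auto simp: op_apply sg_diff insert_absorb)
  ultimately show ?thesis by (simp add: wc.T_def mult_of_def algebra_simps)
qed

lemma act_cartan:
  assumes "H \<in> cartan g"
  shows "ap (act g H) f s = (\<Sum>k<2 * g. H $$ (k, k) * of_nat (mult_of s k)) * f s"
proof -
  have "act g H = (\<Sum>k<2 * g. \<Sum>l<2 * g. if l = k then sc (H $$ (k, k)) * wc.T k k else 0)"
    unfolding act_def using assms by (intro sum.cong refl) (auto simp: cartan_index sc_hom)
  then have "act g H = (\<Sum>k<2 * g. sc (H $$ (k, k)) * wc.T k k)" by simp
  then show ?thesis
    by (simp add: ap_sum sum_form_apply T_diag_apply sum_distrib_right mult.assoc)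
qed

lemma Y_diag_apply:
  "k < 2 * g \<Longrightarrow> ap (wc.Y g k k) f s = of_int (int (mult_of s k) - int (mult_of s (opp g k))) * f s"
  by (simp add: wc.Y_diag T_diag_apply algebra_simps)

section \<open>Irreducibility of the space of harmonic forms\<close>

text \<open>Abel summation.\<close>

lemma sum_mult_partial_sums:
  fixes x c :: "nat \<Rightarrow> int"
  shows "(\<Sum>a<m. x a * c a) = (\<Sum>b<m. (\<Sum>a\<le>b. x a) * (c b - c (Suc b))) + (\<Sum>a<m. x a) * c m"
  by (induction m) (auto simp: algebra_simps lessThan_Suc_atMost[symmetric])

text \<open>Used with x = \<lambda> - \<mu> and c = \<lambda> + \<mu> + 2 \<rho>. Abel summation
  turns the vanishing pairing into a sum of nonnegative terms in which each partial sum is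
  multiplied by a positive difference of \<open>c\<close>.\<close>

lemma partial_sums_eq_0:
  fixes x c :: "nat \<Rightarrow> int"
  assumes nonneg: "\<And>b. b \<le> m \<Longrightarrow> (\<Sum>a<b. x a) \<ge> 0"
    and dec: "\<And>a. Suc a < m \<Longrightarrow> c (Suc a) < c a" and pos: "m > 0 \<Longrightarrow> c (m - 1) > 0"
    and zero: "(\<Sum>a<m. x a * c a) = 0" and "b \<le> m"
  shows "(\<Sum>a<b. x a) = 0"
proof -
  \<comment> \<open>The value 0 at \<open>m\<close> removes the boundary term and makes the last
    difference equal to \<open>c (m - 1)\<close>.\<close>
  define c' where "c' = c(m := 0)"
  have diff: "c' a - c' (Suc a) > 0" if "a < m" for a
  proof (cases "Suc a < m")
    case True
    then show ?thesis using dec[OF True] that by (simp add: c'_def)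
  next
    case False
    then have "m = Suc a" using that by simp
    then show ?thesis using pos by (simp add: c'_def)
  qed
  have "(\<Sum>a<m. x a * c' a) = 0" using zero by (simp add: c'_def)
  then have "(\<Sum>b<m. (\<Sum>a\<le>b. x a) * (c' b - c' (Suc b))) = 0"
    unfolding sum_mult_partial_sums[of x c'] by (simp add: c'_def)
  moreover have "(\<Sum>a\<le>b. x a) * (c' b - c' (Suc b)) \<ge> 0" if "b < m" for b
    using nonneg[of "Suc b"] diff[OF that] that by (simp add: lessThan_Suc_atMost)
  ultimately have "\<forall>b<m. (\<Sum>a\<le>b. x a) * (c' b - c' (Suc b)) = 0"
    by (subst (asm) sum_nonneg_eq_0_iff) auto
  then have "(\<Sum>a\<le>b. x a) = 0" if "b < m" for b using diff[OF that] that by force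
  then show ?thesis using \<open>b \<le> m\<close> by (cases b) (auto simp: lessThan_Suc_atMost)
qed

section \<open>The highest weight vector\<close>

definition s0 :: "nat \<Rightarrow> nat \<Rightarrow> (nat \<Rightarrow> nat) \<times> nat set" where
  "s0 i j = ((\<lambda>k. if k = 0 then i else 0), {..<j})"

lemma mult_of_s0: "mult_of (s0 i j) k = (if k = 0 then i else 0) + (if k < j then 1 else 0)"
  by (simp add: mult_of_def s0_def)

abbreviation top_form :: "nat \<Rightarrow> nat \<Rightarrow> form" where
  "top_form i j \<equiv> delta (s0 i j)"

lemma s0_idx: "1 \<le> j \<Longrightarrow> j \<le> g \<Longrightarrow> s0 i j \<in> idx (2 * g) i j"
  by (auto simp: s0_def idx_def)

lemma top_homog: "1 \<le> j \<Longrightarrow> j \<le> g \<Longrightarrow> top_form i j \<in> homog (2 * g) i j"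
  using s0_idx[of j g i] by (auto simp: homog_def delta_def simp del: split_paired_All)

lemma top_neq_0: "top_form i j \<noteq> 0"
proof
  assume "top_form i j = 0"
  then have "top_form i j (s0 i j) = 0" by simp
  then show False by (simp add: delta_def)
qed

lemma ddx_top: "k \<noteq> 0 \<Longrightarrow> ap (ddx k) (top_form i j) = 0"
  by (auto simp: fun_eq_iff op_apply delta_def s0_def)

lemma contr_top: "j \<le> k \<Longrightarrow> ap (contr k) (top_form i j) = 0"
  by (auto simp: fun_eq_iff op_apply delta_def s0_def)

text \<open>Only x_0 can be differentiated, and dx_0 is already present as \<open>1 \<le> j\<close>.
  Of two opposite indices at most one lies below \<open>j \<le> g\<close>, so \<open>wc.Lam\<close>
  gives zero; in \<open>wc.del\<close> the derivative along x_0 is paired with contraction of the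
  absent dx_g.\<close>

lemma top_harm:
  assumes "1 \<le> j" "j \<le> g"
  shows "top_form i j \<in> harm g i j"
proof -
  have "ap (wedge k) (ap (ddx k) (top_form i j)) = 0" for k
  proof (cases "k = 0")
    case True
    have "ap (wedge 0 * ddx 0) (top_form i j) = 0"
      using assms by (auto simp: wc.eD fun_eq_iff op_apply delta_def s0_def)
    then show ?thesis using True by simp
  qed (simp add: ddx_top)
  then have "ap (wc.d g) (top_form i j) = 0"
    by (simp add: wc.d_def ap_sum)
  moreover have "ap (contr k) (ap (contr (opp g k)) (top_form i j)) = 0" if "k < 2 * g" for k
  proof (cases "k < g")
    case True
    then show ?thesis using assms by (simp add: contr_top opp_def)
  next
    case False
    have "ap (contr k * contr (opp g k)) (top_form i j) = 0"
      using False assms by (subst wc.cc) (simp add: contr_top)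
    then show ?thesis by simp
  qed
  then have "ap (wc.Lam g) (top_form i j) = 0"
    by (simp add: wc.Lam_def ap_sum)
  moreover have "ap (ddx k) (ap (contr (opp g k)) (top_form i j)) = 0" if "k < 2 * g" for k
  proof (cases "k = 0")
    case True
    then show ?thesis using assms by (simp add: contr_top opp_def)
  next
    case False
    have "ap (contr (opp g k) * ddx k) (top_form i j) = 0"
      using False by (simp add: ddx_top)
    then show ?thesis by (simp only: wc.cD ap_mult)
  qed
  then have "ap (wc.del g) (top_form i j) = 0"
    by (simp add: wc.del_def ap_sum)
  ultimately show ?thesis using top_homog[OF assms] by (simp add: harm_def coclosed_def prim_def)
qed

text \<open>\<open>l\<close> is not the first index, so the derivative along x_l vanishes. If dx_l
  is present, then \<open>k < l < j\<close>, and replacing dx_l by dx_k repeats a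
  differential.\<close>

lemma T_raise_top:
  assumes "k < 2 * g" "l < 2 * g" "pos g k < pos g l" "1 \<le> j" "j \<le> g"
  shows "ap (wc.T k l) (top_form i j) = 0"
proof -
  have "pos g 0 = 0" using assms by (simp add: pos_def)
  then have "l \<noteq> 0" using assms(3) by (intro notI) simp
  moreover have "ap (wedge k) (ap (contr l) (top_form i j)) = 0"
  proof (cases "j \<le> l")
    case False
    then have "k < l" "l < j" using assms by (auto simp: pos_def split: if_splits)
    have "(ap (wedge k) (ap (contr l) (top_form i j))) (a, S) = 0" for a S
    proof (cases "insert l (S - {k}) = {..<j}")
      case True
      then have "k \<in> insert l (S - {k})" using \<open>k < l\<close> \<open>l < j\<close> by auto
      then show ?thesis using \<open>k < l\<close> by simp
    qed (simp add: op_apply delta_def s0_def)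
    then show ?thesis by (simp add: fun_eq_iff)
  qed (simp add: contr_top)
  ultimately show ?thesis by (simp add: wc.T_def ddx_top)
qed

lemma Y_raise_top:
  assumes "k < 2 * g" "l < 2 * g" "pos g k < pos g l" "1 \<le> j" "j \<le> g"
  shows "ap (wc.Y g k l) (top_form i j) = 0"
  using assms by (simp add: wc.Y_def T_raise_top[where g = g] pos_conj_less)

lemma act_cartan_top:
  assumes "H \<in> cartan g" "1 \<le> j" "j \<le> g"
  shows "ap (act g H) (top_form i j) = fscale (of_nat i * fund_weight 1 H + fund_weight j H) (top_form i j)"
proof -
  have "(\<Sum>k<2 * g. H $$ (k, k) * of_nat (mult_of (s0 i j) k))
    = (\<Sum>k<2 * g. if k = 0 then of_nat i * H $$ (0, 0) else 0) + (\<Sum>k<2 * g. if k < j then H $$ (k, k) else 0)"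
    unfolding sum.distrib[symmetric] by (intro sum.cong refl) (simp add: mult_of_s0 algebra_simps)
  also have "(\<Sum>k<2 * g. if k < j then H $$ (k, k) else 0) = (\<Sum>k<j. H $$ (k, k))"
    by (rule sum.mono_neutral_cong_right) (use assms in auto)
  also have "(\<Sum>k<2 * g. if k = 0 then of_nat i * H $$ (0, 0) else 0) = of_nat i * H $$ (0, 0)"
    using assms by simp
  finally have "(\<Sum>k<2 * g. H $$ (k, k) * of_nat (mult_of (s0 i j) k)) = of_nat i * fund_weight 1 H + fund_weight j H"
    by (simp add: fund_weight_def std_coord_def)
  then show ?thesis
    by (auto simp: fun_eq_iff act_cartan[OF assms(1)] delta_def)
qed

section \<open>The Casimir scalar of a highest weight vector\<close>

lemma sum_pos: "(\<Sum>k<2 * g. f (pos g k)) = (\<Sum>k<2 * g. f k)"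
  by (rule sum.reindex_bij_witness[of _ "pos g" "pos g"]) (auto simp: pos_less pos_pos)

text \<open>On a vector of weight \<open>y\<close> killed by all raising operators,
  \<open>Y k l * Y l k\<close> acts by its bracket if \<open>k\<close> comes before
  \<open>l\<close>, by a square if \<open>k = l\<close>, and by zero otherwise. These scalars add up
  to 2 (\<mu>, \<mu> + 2 \<rho>), where \<rho> = (g, g - 1, ..., 1).\<close>

lemma casimir_eigenvalue:
  fixes y :: "nat \<Rightarrow> int"
  assumes y: "\<And>k. k < 2 * g \<Longrightarrow> y (opp g k) = - y k"
  shows "(\<Sum>k<2 * g. \<Sum>l<2 * g. if k = l then (y k)\<^sup>2 else if pos g k < pos g l
      then (if l = opp g k then 2 * (y k - y l) else y k - y l) else 0)
    = 2 * (\<Sum>a<g. (y a)\<^sup>2 + 2 * y a * (int g - int a))"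
proof -
  \<comment> \<open>\<open>y k\<close> is counted once for each later position and subtracted once
    for each earlier one. Together with the extra contribution of the long roots, these counts
    produce the coefficients of 2 \<rho>.\<close>
  have above: "(\<Sum>l<2 * g. if pos g k < pos g l then 1 else 0) = 2 * int g - 1 - int (pos g k)" if "k < 2 * g" for k
  proof -
    have "(\<Sum>l<2 * g. if pos g k < pos g l then 1 else (0 :: int)) = (\<Sum>l<2 * g. if pos g k < l then 1 else 0)"
      by (rule sum_pos)
    also have "\<dots> = int (card {pos g k<..<2 * g})"
    proof -
      have "{l \<in> {..<2 * g}. pos g k < l} = {pos g k<..<2 * g}" by auto
      then show ?thesis by (subst sum.inter_filter[symmetric]) simp_all
    qed
    finally show ?thesis using pos_less[OF that] by (simp add: of_nat_diff)
  qed
  have below: "(\<Sum>l<2 * g. if pos g l < pos g k then 1 else 0) = int (pos g k)" if "k < 2 * g" for k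
  proof -
    have "(\<Sum>l<2 * g. if pos g l < pos g k then 1 else (0 :: int)) = (\<Sum>l<2 * g. if l < pos g k then 1 else 0)"
      by (rule sum_pos)
    also have "\<dots> = int (card {..<pos g k})"
    proof -
      have "{l \<in> {..<2 * g}. l < pos g k} = {..<pos g k}" using pos_less[OF that] by auto
      then show ?thesis by (subst sum.inter_filter[symmetric]) simp_all
    qed
    finally show ?thesis by simp
  qed
  have "(\<Sum>k<2 * g. \<Sum>l<2 * g. if k = l then (y k)\<^sup>2 else if pos g k < pos g l
      then (if l = opp g k then 2 * (y k - y l) else y k - y l) else 0)
    = (\<Sum>k<2 * g. \<Sum>l<2 * g. (if l = k then (y k)\<^sup>2 else 0) + y k * (if pos g k < pos g l then 1 else 0)
      - y l * (if pos g k < pos g l then 1 else 0)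
      + (if l = opp g k then if pos g k < pos g (opp g k) then 2 * y k else 0 else 0))"
  proof (intro sum.cong refl)
    fix k l assume "k \<in> {..<2 * g}" "l \<in> {..<2 * g}"
    then have kl: "k < 2 * g" "l < 2 * g" by simp_all
    show "(if k = l then (y k)\<^sup>2 else if pos g k < pos g l
      then (if l = opp g k then 2 * (y k - y l) else y k - y l) else 0)
      = (if l = k then (y k)\<^sup>2 else 0) + y k * (if pos g k < pos g l then 1 else 0)
      - y l * (if pos g k < pos g l then 1 else 0)
      + (if l = opp g k then if pos g k < pos g (opp g k) then 2 * y k else 0 else 0)"
    proof (cases "l = opp g k")
      case True
      show ?thesis unfolding True using kl(1) by (simp add: y)
    next
      case False
      then show ?thesis by (cases "k = l") simp_all
    qed
  qed
  also have "\<dots> = (\<Sum>k<2 * g. (y k)\<^sup>2) + (\<Sum>k<2 * g. y k * (\<Sum>l<2 * g. if pos g k < pos g l then 1 else 0))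
      - (\<Sum>k<2 * g. \<Sum>l<2 * g. y l * (if pos g k < pos g l then 1 else 0))
      + (\<Sum>k<2 * g. if pos g k < pos g (opp g k) then 2 * y k else 0)"
    by (simp add: sum.distrib sum_subtractf sum_distrib_left)
  also have "(\<Sum>k<2 * g. \<Sum>l<2 * g. y l * (if pos g k < pos g l then 1 else 0))
      = (\<Sum>l<2 * g. y l * (\<Sum>k<2 * g. if pos g k < pos g l then 1 else 0))"
    by (subst sum.swap) (simp add: sum_distrib_left)
  also have "\<dots> = (\<Sum>k<2 * g. y k * int (pos g k))"
    by (intro sum.cong refl) (simp add: below)
  also have "(\<Sum>k<2 * g. y k * (\<Sum>l<2 * g. if pos g k < pos g l then 1 else 0))
      = (\<Sum>k<2 * g. y k * (2 * int g - 1 - int (pos g k)))"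
    by (intro sum.cong refl) (simp add: above)
  also have "(\<Sum>k<2 * g. (y k)\<^sup>2) + (\<Sum>k<2 * g. y k * (2 * int g - 1 - int (pos g k)))
      - (\<Sum>k<2 * g. y k * int (pos g k)) + (\<Sum>k<2 * g. if pos g k < pos g (opp g k) then 2 * y k else 0)
    = (\<Sum>k<2 * g. (y k)\<^sup>2 + y k * (2 * int g - 1 - 2 * int (pos g k)) + (if pos g k < pos g (opp g k) then 2 * y k else 0))"
    by (simp add: sum.distrib sum_subtractf algebra_simps sum_distrib_left)
  also have "\<dots> = (\<Sum>a<g. 2 * ((y a)\<^sup>2 + 2 * y a * (int g - int a)))"
    unfolding sum_pairs
  proof (intro sum.cong refl)
    fix a assume a: "a \<in> {..<g}"
    have "y (a + g) = - y a" using y[of a] a by (simp add: opp_def)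
    moreover have "opp g a = a + g" "opp g (a + g) = a" "pos g a = a" "pos g (a + g) = 2 * g - 1 - a"
      using a by (auto simp: opp_def pos_def)
    moreover have "int (2 * g - 1 - a) = 2 * int g - 1 - int a" using a by auto
    moreover have "a < 2 * g - 1 - a" "\<not> 2 * g - 1 - a < a" using a by auto
    ultimately show "(y a)\<^sup>2 + y a * (2 * int g - 1 - 2 * int (pos g a)) + (if pos g a < pos g (opp g a) then 2 * y a else 0)
      + ((y (a + g))\<^sup>2 + y (a + g) * (2 * int g - 1 - 2 * int (pos g (a + g))) + (if pos g (a + g) < pos g (opp g (a + g)) then 2 * y (a + g) else 0))
      = 2 * ((y a)\<^sup>2 + 2 * y a * (int g - int a))"
      by (simp add: algebra_simps)
  qed
  finally show ?thesis by (simp add: sum_distrib_left)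
qed

definition raised_to_0 :: "nat \<Rightarrow> form \<Rightarrow> bool" where
  "raised_to_0 g f \<longleftrightarrow> (\<forall>k<2 * g. \<forall>l<2 * g. pos g k < pos g l \<longrightarrow> ap (wc.Y g k l) f = 0)"

definition weight_of :: "nat \<Rightarrow> (nat \<Rightarrow> nat) \<times> nat set \<Rightarrow> nat \<Rightarrow> int" where
  "weight_of g s k = int (mult_of s k) - int (mult_of s (opp g k))"

lemma weight_of_conj: "k < 2 * g \<Longrightarrow> weight_of g s (opp g k) = - weight_of g s k"
  by (simp add: weight_of_def)

text \<open>This is (\<mu> + \<rho>, \<mu> + \<rho>) - (\<rho>, \<rho>) for the weight \<mu> with
  coordinates \<open>y\<close>.\<close>

definition casimir_const :: "nat \<Rightarrow> (nat \<Rightarrow> int) \<Rightarrow> int" where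
  "casimir_const g y = (\<Sum>a<g. (y a)\<^sup>2 + 2 * y a * (int g - int a))"

lemma Y_Y_raised:
  assumes "k < 2 * g" "l < 2 * g" "pos g k < pos g l" "raised_to_0 g f"
    and y: "\<And>k. k < 2 * g \<Longrightarrow> ap (wc.Y g k k) f = fscale (of_int (y k)) f"
  shows "ap (wc.Y g k l) (ap (wc.Y g l k) f)
    = fscale (of_int (if l = opp g k then 2 * (y k - y l) else y k - y l)) f"
proof -
  have "k \<noteq> l" using assms by auto
  have "ap (wc.Y g k l * wc.Y g l k) f = fscale (of_int (if l = opp g k then 2 * (y k - y l) else y k - y l)) f"
    unfolding wc.Y_Y_comm[OF assms(1,2) \<open>k \<noteq> l\<close>] using assms
    by (simp add: raised_to_0_def y) (simp add: fun_eq_iff algebra_simps)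
  then show ?thesis by simp
qed

text \<open>The Casimir element is evaluated twice: from the bidegree through
  \<open>wc.casimir\<close>, and from the weight of the vector. The two scalars are compared at an
  index where \<open>f\<close> does not vanish.\<close>

lemma casimir_const_harm:
  assumes f: "f \<in> harm g i j" "f \<noteq> 0" and r: "raised_to_0 g f"
    and y: "\<And>k. k < 2 * g \<Longrightarrow> ap (wc.Y g k k) f = fscale (of_int (y k)) f"
    and yc: "\<And>k. k < 2 * g \<Longrightarrow> y (opp g k) = - y k"
  shows "casimir_const g y = int i * int i + (2 * int g + 2) * (int i + int j) - int j * int j"
proof -
  have fh: "f \<in> homog (2 * g) i j" "ap (wc.d g) f = 0" "ap (wc.Lam g) f = 0" "ap (wc.del g) f = 0"
    using f by (auto simp: harm_def coclosed_def prim_def)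
  define e where "e k l = (if k = l then (y k)\<^sup>2 else if pos g k < pos g l
      then (if l = opp g k then 2 * (y k - y l) else y k - y l) else 0)" for k l
  define X where "X = int i * int i + (2 * int g + 2) * (int i + int j) - int j * int j"
  define C where "C = 2 * X"
  have 1: "ap (\<Sum>k<2 * g. \<Sum>l<2 * g. wc.Y g k l * wc.Y g l k) f = fscale (of_int C) f"
    unfolding wc.casimir C_def X_def
    by (simp add: fh N_homog[OF fh(1)] F_homog[OF fh(1)]) (simp add: fun_eq_iff algebra_simps)
  have 2: "ap (\<Sum>k<2 * g. \<Sum>l<2 * g. wc.Y g k l * wc.Y g l k) f = (\<Sum>k<2 * g. \<Sum>l<2 * g. fscale (of_int (e k l)) f)"
    unfolding ap_sum
  proof (intro sum.cong refl)
    fix k l assume "k \<in> {..<2 * g}" "l \<in> {..<2 * g}"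
    then have kl: "k < 2 * g" "l < 2 * g" by simp_all
    consider "k = l" | "pos g k < pos g l" "k \<noteq> l" | "pos g l < pos g k" "k \<noteq> l"
      using pos_inj[OF kl] by linarith
    then show "ap (wc.Y g k l * wc.Y g l k) f = fscale (of_int (e k l)) f"
    proof cases
      case 1
      then show ?thesis using kl by (simp add: y power2_eq_square e_def)
    next
      case 2
      then have "e k l = (if l = opp g k then 2 * (y k - y l) else y k - y l)"
        by (simp only: e_def if_True if_False)
      then show ?thesis using Y_Y_raised[OF kl 2(1) r y] by (simp only: ap_mult)
    next
      case 3
      then have "ap (wc.Y g l k) f = 0" using kl r by (simp add: raised_to_0_def)
      then show ?thesis using 3 by (simp add: e_def)
    qed
  qed
  obtain s where s: "f s \<noteq> 0"
  proof (rule ccontr)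
    assume "\<not> thesis"
    then have "f = 0" using that by (intro ext) (metis zero_fun_apply)
    then show False using f(2) by blast
  qed
  define S where "S = (\<Sum>k<2 * g. \<Sum>l<2 * g. e k l)"
  have 3: "(\<Sum>k<2 * g. \<Sum>l<2 * g. fscale (of_int (e k l)) f) s = of_int S * f s"
    by (simp add: S_def sum_form_apply sum_distrib_right)
  have 4: "fscale (of_int C) f s = of_int S * f s"
    unfolding 3[symmetric] 2[symmetric] 1 ..
  then have "(of_int C :: complex) = of_int S"
    using mult_right_cancel[OF s] by (simp only: fscale_apply)
  then have "C = S" by (rule of_int_eq_iff[THEN iffD1])
  moreover have "S = 2 * casimir_const g y"
    unfolding S_def e_def casimir_const_def by (rule casimir_eigenvalue[where y = y and g = g, OF yc])
  ultimately have "casimir_const g y = X" using C_def by linarith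
  then show ?thesis unfolding X_def .
qed

text \<open>A unitarity argument: the pairing of \<open>Y k l (Y l k f)\<close> with
  \<open>f\<close> is the squared norm of \<open>Y l k f\<close>, while the operator product acts by
  the eigenvalue of the bracket. The long roots, \<open>l = opp g k\<close>, bound the coordinates
  in the first half below by zero.\<close>

lemma weight_dominant:
  assumes f: "f \<in> homog (2 * g) i j" "f \<noteq> 0" and r: "raised_to_0 g f"
    and y: "\<And>k. k < 2 * g \<Longrightarrow> ap (wc.Y g k k) f = fscale (of_int (y k)) f"
    and kl: "k < 2 * g" "l < 2 * g" "pos g k < pos g l"
  shows "y l \<le> y k"
proof -
  define c where "c = (if l = opp g k then 2 * (y k - y l) else y k - y l)"
  have e: "ap (wc.Y g k l) (ap (wc.Y g l k) f) = fscale (of_int c) f"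
    unfolding c_def by (rule Y_Y_raised[OF kl r y])
  have "ip (2 * g) i j (ap (wc.Y g k l) (ap (wc.Y g l k) f)) f = ip (2 * g) i j (ap (wc.Y g l k) f) (ap (wc.Y g l k) f)"
    by (rule ip_Y[OF kl(1,2) Y_homog[OF kl(2,1) f(1)] f(1)])
  then have "ip (2 * g) i j (ap (wc.Y g l k) f) (ap (wc.Y g l k) f) = of_int c * ip (2 * g) i j f f"
    unfolding e ip_left(4) by (rule sym)
  then have "Re (ip (2 * g) i j (ap (wc.Y g l k) f) (ap (wc.Y g l k) f)) = real_of_int c * Re (ip (2 * g) i j f f)"
    by simp
  then have "0 \<le> real_of_int c * Re (ip (2 * g) i j f f)"
    using ip_self_nonneg(1)[of "2 * g" i j "ap (wc.Y g l k) f"] by linarith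
  moreover have "Re (ip (2 * g) i j f f) > 0"
  proof -
    have "ip (2 * g) i j f f \<noteq> 0" using ip_self_eq_0[OF f(1)] f(2) by blast
    then show ?thesis using ip_self_nonneg[of "2 * g" i j f] by (auto simp: complex_eq_iff)
  qed
  ultimately have "0 \<le> real_of_int c" by (simp add: zero_le_mult_iff)
  then show ?thesis by (simp add: c_def split: if_splits)
qed

lemma idxD:
  assumes "s \<in> idx n i j"
  shows "\<And>k. n \<le> k \<Longrightarrow> fst s k = 0" "(\<Sum>k<n. fst s k) = i" "snd s \<subseteq> {..<n}" "card (snd s) = j" "finite (snd s)"
  using assms finite_subset[of "snd s" "{..<n}"] by (auto simp: idx_def)

lemma sum_mult_of: "(\<Sum>k<b. mult_of s k) = (\<Sum>k<b. fst s k) + card ({..<b} \<inter> snd s)"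
proof -
  have "(\<Sum>k<b. if k \<in> snd s then 1 else 0) = card ({..<b} \<inter> snd s)"
    by (subst sum.inter_restrict[symmetric]) simp_all
  then show ?thesis by (simp add: mult_of_def sum.distrib)
qed

lemma sum_mult_of_le:
  assumes "s \<in> idx (2 * g) i j" "b \<le> g"
  shows "(\<Sum>k<b. fst s k) \<le> i" "card ({..<b} \<inter> snd s) \<le> j" "card ({..<b} \<inter> snd s) \<le> b"
proof -
  note s = idxD[OF assms(1)]
  have "(\<Sum>k<b. fst s k) \<le> (\<Sum>k<2 * g. fst s k)"
    by (rule sum_mono2) (use assms in auto)
  then show "(\<Sum>k<b. fst s k) \<le> i" by (simp only: s)
  show "card ({..<b} \<inter> snd s) \<le> j"
    using card_mono[OF s(5), of "{..<b} \<inter> snd s"] s(4) by simp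
  show "card ({..<b} \<inter> snd s) \<le> b"
    using card_mono[of "{..<b}" "{..<b} \<inter> snd s"] by simp
qed

lemma weight_of_s0: "j \<le> g \<Longrightarrow> a < g \<Longrightarrow> weight_of g (s0 i j) a = (if a = 0 then int i else 0) + (if a < j then 1 else 0)"
  by (simp add: weight_of_def mult_of_s0 opp_def)

lemma sum_weight_s0:
  assumes "1 \<le> j" "j \<le> g" "b \<le> g"
  shows "(\<Sum>a<b. weight_of g (s0 i j) a) = (if b = 0 then 0 else int i) + int (min b j)"
proof -
  have "(\<Sum>a<b. weight_of g (s0 i j) a) = (\<Sum>a<b. (if a = 0 then int i else 0)) + (\<Sum>a<b. (if a < j then 1 else 0))"
    unfolding sum.distrib[symmetric] using assms by (intro sum.cong refl weight_of_s0) auto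
  also have "(\<Sum>a<b. (if a = 0 then int i else 0)) = (if b = 0 then 0 else int i)"
    by simp
  also have "(\<Sum>a<b. (if a < j then 1 else (0::int))) = int (min b j)"
  proof -
    have "{a \<in> {..<b}. a < j} = {..<min b j}" by auto
    then show ?thesis by (subst sum.inter_filter[symmetric]) simp_all
  qed
  finally show ?thesis .
qed

text \<open>The dominance order: among the first \<open>b\<close> variables a monomial can use at
  most its \<open>i\<close> polynomial factors and \<open>min b j\<close> differentials, while
  factors of opposite index only lower the weight.\<close>

lemma sum_weight_le:
  assumes "s \<in> idx (2 * g) i j" "1 \<le> j" "j \<le> g" "b \<le> g"
  shows "(\<Sum>a<b. weight_of g s a) \<le> (\<Sum>a<b. weight_of g (s0 i j) a)"
proof (cases "b = 0")
  case False
  have "(\<Sum>a<b. weight_of g s a) = int (\<Sum>a<b. mult_of s a) - int (\<Sum>a<b. mult_of s (opp g a))"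
    by (simp add: weight_of_def sum_subtractf)
  also have "\<dots> \<le> int (\<Sum>a<b. mult_of s a)" by linarith
  also have "\<dots> \<le> int i + int (min b j)"
  proof -
    have "(\<Sum>a<b. fst s a) + card ({..<b} \<inter> snd s) \<le> i + min b j"
      using sum_mult_of_le[OF assms(1,4)] by simp
    then show ?thesis unfolding sum_mult_of by (simp only: of_nat_add[symmetric] of_nat_le_iff)
  qed
  finally show ?thesis unfolding sum_weight_s0[OF assms(2,3,4)] using False by simp
qed simp

text \<open>Equality at \<open>b = j\<close> forces the differentials to be the first
  \<open>j\<close> ones; equality at \<open>b = 1\<close>, where a differential contributes at most
  1, forces all polynomial factors to be x_0.\<close>

lemma eq_s0_if_sum_weight_eq:
  assumes s: "s \<in> idx (2 * g) i j" and j: "1 \<le> j" "j \<le> g"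
    and eq: "\<And>b. b \<le> g \<Longrightarrow> (\<Sum>a<b. weight_of g s a) = (\<Sum>a<b. weight_of g (s0 i j) a)"
  shows "s = s0 i j"
proof -
  note sD = idxD[OF s]
  have sum: "int (\<Sum>a<b. fst s a) + int (card ({..<b} \<inter> snd s)) \<ge> int i + int (min b j)" if "1 \<le> b" "b \<le> g" for b
  proof -
    have "(\<Sum>a<b. weight_of g s a) = int (\<Sum>a<b. mult_of s a) - int (\<Sum>a<b. mult_of s (opp g a))"
      by (simp add: weight_of_def sum_subtractf)
    moreover have "(\<Sum>a<b. weight_of g s a) = int i + int (min b j)"
      using eq[OF that(2)] sum_weight_s0[OF j that(2)] that(1) by simp
    moreover have "0 \<le> int (\<Sum>a<b. mult_of s (opp g a))" by (rule of_nat_0_le_iff)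
    ultimately have "int (\<Sum>a<b. mult_of s a) \<ge> int i + int (min b j)" by linarith
    then show ?thesis unfolding sum_mult_of of_nat_add .
  qed
  have "int i + int j \<le> int (\<Sum>a<j. fst s a) + int (card ({..<j} \<inter> snd s))"
    using sum[OF j] by (simp only: min.idem)
  then have "j \<le> card ({..<j} \<inter> snd s)"
    using sum_mult_of_le(1)[OF s j(2)] by linarith
  then have "{..<j} \<inter> snd s = {..<j}" by (intro card_seteq) auto
  then have "{..<j} \<subseteq> snd s" by blast
  then have S: "snd s = {..<j}"
    using card_subset_eq[OF sD(5), of "{..<j}"] sD(4) by (simp only: card_lessThan)
  have "fst s 0 \<ge> i"
  proof -
    have "card ({..<1} \<inter> snd s) \<le> 1" using sum_mult_of_le(3)[OF s, of 1] j by simp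
    then have "i \<le> (\<Sum>a<1. fst s a)" using sum[of 1] j by linarith
    then show ?thesis by simp
  qed
  moreover have "(\<Sum>k<2 * g. fst s k) = fst s 0 + (\<Sum>k\<in>{..<2 * g} - {0}. fst s k)"
    using j by (intro sum.remove) auto
  ultimately have 0: "fst s 0 = i" "(\<Sum>k\<in>{..<2 * g} - {0}. fst s k) = 0" using sD(2) by linarith+
  have "fst s k = (if k = 0 then i else 0)" for k
  proof (cases "k = 0 \<or> 2 * g \<le> k")
    case True
    then show ?thesis using 0(1) sD(1)[of k] by auto
  next
    case False
    then show ?thesis using 0(2) by simp
  qed
  then show ?thesis using S by (intro prod_eqI) (auto simp: s0_def)
qed

lemma eigenvalue_eq_weight:
  assumes "f s \<noteq> 0" "k < 2 * g" "ap (wc.Y g k k) f = fscale (of_int y) f"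
  shows "y = weight_of g s k"
proof -
  have "of_int (weight_of g s k) * f s = of_int y * f s"
    using fun_cong[OF assms(3), of s] unfolding Y_diag_apply[OF assms(2)] weight_of_def fscale_apply .
  then have "(of_int (weight_of g s k) :: complex) = of_int y"
    using mult_right_cancel[OF assms(1)] by blast
  then show ?thesis by (simp only: of_int_eq_iff)
qed

lemma Y_diag_top: "k < 2 * g \<Longrightarrow> ap (wc.Y g k k) (top_form i j) = fscale (of_int (weight_of g (s0 i j) k)) (top_form i j)"
proof
  fix s assume k: "k < 2 * g"
  show "ap (wc.Y g k k) (top_form i j) s = fscale (of_int (weight_of g (s0 i j) k)) (top_form i j) s"
    unfolding Y_diag_apply[OF k] fscale_apply by (cases "s = s0 i j") (simp_all add: delta_def weight_of_def)
qed

lemma raised_weight_vector: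
  assumes f: "f \<in> harm g i j" "f \<noteq> 0" and r: "raised_to_0 g f" and j: "1 \<le> j" "j \<le> g"
    and y: "\<And>k. k < 2 * g \<Longrightarrow> ap (wc.Y g k k) f = fscale (of_int (y k)) f"
  obtains c where "c \<noteq> 0" "f = fscale c (top_form i j)"
proof -
  have fh: "f \<in> homog (2 * g) i j" using f by (simp add: harm_def coclosed_def prim_def)
  let ?l = "weight_of g (s0 i j)"
  have supp: "s = s0 i j" if s: "f s \<noteq> 0" for s
  proof -
    have idx: "s \<in> idx (2 * g) i j" using fh s by (auto simp: homog_def simp del: split_paired_All)
    have yw: "y k = weight_of g s k" if "k < 2 * g" for k
      by (rule eigenvalue_eq_weight[OF s that y[OF that]])
    have yc: "y (opp g k) = - y k" if "k < 2 * g" for k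
      unfolding yw[OF that] yw[OF opp_less[OF that]] by (rule weight_of_conj[OF that])
    have raised_top: "raised_to_0 g (top_form i j)"
      unfolding raised_to_0_def by (intro allI impI Y_raise_top j)
    have "casimir_const g y = casimir_const g ?l"
      using casimir_const_harm[where y = y, OF f r y yc]
        casimir_const_harm[where y = ?l, OF top_harm[OF j] top_neq_0 raised_top Y_diag_top weight_of_conj]
      by (rule trans[OF _ sym])
    then have "0 = (\<Sum>a<g. ((?l a)\<^sup>2 + 2 * ?l a * (int g - int a)) - ((y a)\<^sup>2 + 2 * y a * (int g - int a)))"
      unfolding casimir_const_def sum_subtractf by simp
    \<comment> \<open>The difference of the Casimir scalars factors as (\<lambda> - \<mu>, \<lambda>
      + \<mu> + 2 \<rho>). The second argument is strictly decreasing and positive because both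
      weights are dominant.\<close>
    also have "\<dots> = (\<Sum>a<g. (?l a - y a) * (?l a + y a + 2 * (int g - int a)))"
      by (intro sum.cong refl) (simp add: algebra_simps power2_eq_square)
    finally have zero: "(\<Sum>a<g. (?l a - y a) * (?l a + y a + 2 * (int g - int a))) = 0" by simp
    have ysum: "(\<Sum>a<b. y a) = (\<Sum>a<b. weight_of g s a)" if "b \<le> g" for b
      by (intro sum.cong refl yw) (use that in auto)
    have "(\<Sum>a<b. ?l a - y a) = 0" if "b \<le> g" for b
    proof (rule partial_sums_eq_0[OF _ _ _ zero that])
      fix b assume b: "b \<le> g"
      show "0 \<le> (\<Sum>a<b. ?l a - y a)"
        unfolding sum_subtractf ysum[OF b] using sum_weight_le[OF idx j b] by simp
    next
      fix a assume a: "Suc a < g"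
      have "y (Suc a) \<le> y a"
        by (rule weight_dominant[OF fh f(2) r y]) (use a in \<open>auto simp: pos_def\<close>)
      moreover have "?l (Suc a) \<le> ?l a"
        using a j by (simp add: weight_of_s0)
      ultimately show "?l (Suc a) + y (Suc a) + 2 * (int g - int (Suc a)) < ?l a + y a + 2 * (int g - int a)"
        by simp
    next
      have g: "g - 1 < g" "g - 1 < 2 * g" using j by simp_all
      have "y (opp g (g - 1)) \<le> y (g - 1)"
        by (rule weight_dominant[OF fh f(2) r y g(2) opp_less[OF g(2)]]) 
          (use j in \<open>auto simp: pos_def opp_def\<close>)
      then have "0 \<le> y (g - 1)" unfolding yc[OF g(2)] by simp
      moreover have "0 \<le> ?l (g - 1)" using weight_of_s0[OF j(2) g(1), of i] by simp
      moreover have "int (g - 1) = int g - 1" using j by simp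
      ultimately show "0 < ?l (g - 1) + y (g - 1) + 2 * (int g - int (g - 1))" by simp
    qed
    then show ?thesis
      by (intro eq_s0_if_sum_weight_eq[OF idx j]) (simp add: ysum sum_subtractf)
  qed
  have eq: "f = fscale (f (s0 i j)) (top_form i j)"
  proof
    fix s
    show "f s = fscale (f (s0 i j)) (top_form i j) s"
      using supp[of s] by (cases "f s = 0") (auto simp: delta_def)
  qed
  moreover have "f (s0 i j) \<noteq> 0"
  proof
    assume "f (s0 i j) = 0"
    then have "f = 0" using eq by simp
    then show False using f(2) by simp
  qed
  ultimately show thesis using that by blast
qed

text \<open>Passing from an index to an earlier one decreases this number. Raising operators
  therefore strictly lower the maximal height in the support of a form, unless they kill it.\<close>

definition height :: "nat \<Rightarrow> (nat \<Rightarrow> nat) \<times> nat set \<Rightarrow> nat" where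
  "height g s = (\<Sum>k<2 * g. mult_of s k * pos g k)"

lemma height_move:
  assumes "k < 2 * g" "l < 2 * g" "pos g k < pos g l"
    and "\<And>m. mult_of s' m + (if m = k then 1 else 0) = mult_of s m + (if m = l then 1 else 0)"
  shows "height g s < height g s'"
proof -
  have "(\<Sum>m<2 * g. (mult_of s' m + (if m = k then 1 else 0)) * pos g m)
      = (\<Sum>m<2 * g. (mult_of s m + (if m = l then 1 else 0)) * pos g m)"
    by (simp only: assms(4))
  moreover have key: "(\<Sum>m<2 * g. (mult_of u m + (if m = p then 1 else 0)) * pos g m) = height g u + pos g p"
    if "p < 2 * g" for u p
  proof -
    have "(\<Sum>m<2 * g. (mult_of u m + (if m = p then 1 else 0)) * pos g m)
      = (\<Sum>m<2 * g. mult_of u m * pos g m + (if m = p then pos g m else 0))"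
      by (intro sum.cong refl) (simp add: add_mult_distrib)
    then show ?thesis using that by (simp add: sum.distrib height_def)
  qed
  ultimately have "height g s' + pos g k = height g s + pos g l"
    using key[OF assms(1), of s'] key[OF assms(2), of s] by simp
  then show ?thesis using assms(3) by linarith
qed

lemma T_raise_support:
  assumes kl: "k < 2 * g" "l < 2 * g" "pos g k < pos g l" and "ap (wc.T k l) f s \<noteq> 0"
  obtains s' where "f s' \<noteq> 0" "height g s < height g s'"
proof -
  have "k \<noteq> l" using kl by auto
  obtain a S where s: "s = (a, S)" by fastforce
  have "ap (mulx k) (ap (ddx l) f) s \<noteq> 0 \<or> ap (wedge k) (ap (contr l) f) s \<noteq> 0"
    using assms(4) by (auto simp: wc.T_def)
  then show thesis
  proof
    assume "ap (mulx k) (ap (ddx l) f) s \<noteq> 0"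
    then have "a k \<noteq> 0" "f ((a(k := a k - 1))(l := Suc (a l)), S) \<noteq> 0"
      using \<open>k \<noteq> l\<close> by (auto simp: s op_apply split: if_splits)
    moreover have "height g s < height g ((a(k := a k - 1))(l := Suc (a l)), S)"
      by (rule height_move[OF kl]) (use \<open>k \<noteq> l\<close> \<open>a k \<noteq> 0\<close> in \<open>auto simp: s mult_of_def\<close>)
    ultimately show thesis using that by blast
  next
    assume "ap (wedge k) (ap (contr l) f) s \<noteq> 0"
    then have kS: "k \<in> S" "l \<notin> S" "f (a, insert l (S - {k})) \<noteq> 0"
      using \<open>k \<noteq> l\<close> by (auto simp: s op_apply split: if_splits)
    moreover have "height g s < height g (a, insert l (S - {k}))"
      by (rule height_move[OF kl]) (use \<open>k \<noteq> l\<close> kS in \<open>auto simp: s mult_of_def\<close>)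
    ultimately show thesis using that by blast
  qed
qed

lemma Y_raise_support:
  assumes kl: "k < 2 * g" "l < 2 * g" "pos g k < pos g l" and "ap (wc.Y g k l) f s \<noteq> 0"
  obtains s' where "f s' \<noteq> 0" "height g s < height g s'"
proof -
  have "ap (wc.T k l) f s \<noteq> 0 \<or> ap (wc.T (opp g l) (opp g k)) f s \<noteq> 0"
    using assms(4) by (auto simp: wc.Y_def)
  then show thesis
    using T_raise_support[OF kl] T_raise_support[OF opp_less[OF kl(2)] opp_less[OF kl(1)] pos_conj_less[OF kl]] that
    by metis
qed

lemma form_nonzero_at:
  fixes f :: form
  assumes "f \<noteq> 0"
  obtains s where "f s \<noteq> 0"
  using assms fun_eq_iff[of f 0] unfolding zero_fun_apply by blast

definition Y_stable :: "nat \<Rightarrow> form set \<Rightarrow> bool" where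
  "Y_stable g U \<longleftrightarrow> (\<forall>k<2 * g. \<forall>l<2 * g. \<forall>f\<in>U. ap (wc.Y g k l) f \<in> U)"

text \<open>A nonzero element of \<open>U\<close> with the least bound on the height of its support
  is killed by every raising operator, since a nonzero image would stay in \<open>U\<close> with a
  smaller bound.\<close>

lemma exists_raised:
  assumes U: "Y_stable g U" "U \<subseteq> homog (2 * g) i j" and f: "f \<in> U" "f \<noteq> 0"
  obtains h where "h \<in> U" "h \<noteq> 0" "raised_to_0 g h"
proof -
  define P where "P n h \<longleftrightarrow> h \<in> U \<and> h \<noteq> 0 \<and> (\<forall>s. h s \<noteq> 0 \<longrightarrow> height g s \<le> n)" for n h
  have "{s. f s \<noteq> 0} \<subseteq> idx (2 * g) i j"
    using U f by (auto simp: homog_def simp del: split_paired_All)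
  then have fin: "finite {s. f s \<noteq> 0}" by (rule finite_subset) simp
  have "P (Max (height g ` {s. f s \<noteq> 0})) f"
    unfolding P_def
  proof (intro conjI allI impI f)
    fix s assume "f s \<noteq> 0"
    then show "height g s \<le> Max (height g ` {s. f s \<noteq> 0})"
      by (intro Max_ge finite_imageI fin imageI) (rule CollectI)
  qed
  then have ex: "\<exists>n. \<exists>h. P n h" by (intro exI)
  define n where "n = (LEAST n. \<exists>h. P n h)"
  have least: "\<not> (\<exists>h. P m h)" if "m < n" for m
    using that unfolding n_def by (rule not_less_Least)
  have "\<exists>h. P n h" unfolding n_def by (rule LeastI_ex[OF ex])
  then obtain h where h: "P n h" by (rule exE)
  have hP: "h \<in> U \<and> h \<noteq> 0 \<and> (\<forall>s. h s \<noteq> 0 \<longrightarrow> height g s \<le> n)"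
    using h unfolding P_def .
  have hU: "h \<in> U" by (rule conjunct1[OF hP])
  have h0: "h \<noteq> 0" by (rule conjunct1[OF conjunct2[OF hP]])
  have hle: "height g s \<le> n" if "h s \<noteq> 0" for s
    by (rule mp[OF spec[OF conjunct2[OF conjunct2[OF hP]]] that])
  have "ap (wc.Y g k l) h = 0" if kl: "k < 2 * g" "l < 2 * g" "pos g k < pos g l" for k l
  proof (rule ccontr)
    assume neq: "ap (wc.Y g k l) h \<noteq> 0"
    have lt: "height g s < n" if nz: "ap (wc.Y g k l) h s \<noteq> 0" for s
    proof -
      obtain s' where s': "h s' \<noteq> 0" "height g s < height g s'" by (rule Y_raise_support[OF kl nz])
      have "height g s' \<le> n" by (rule hle[OF s'(1)])
      then show ?thesis using s'(2) by simp
    qed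
    obtain s where "ap (wc.Y g k l) h s \<noteq> 0" by (rule form_nonzero_at[OF neq])
    then have n: "n > 0" using lt[of s] by simp
    have "P (n - 1) (ap (wc.Y g k l) h)"
      unfolding P_def
    proof (intro conjI allI impI neq)
      show "ap (wc.Y g k l) h \<in> U" using U(1) kl(1,2) hU unfolding Y_stable_def by blast
      fix t assume "ap (wc.Y g k l) h t \<noteq> 0"
      then show "height g t \<le> n - 1" using lt[of t] by linarith
    qed
    moreover have "n - 1 < n" using n by simp
    ultimately show False using least by blast
  qed
  then have "raised_to_0 g h" unfolding raised_to_0_def by blast
  then show thesis by (rule that[OF hU h0])
qed

lemma raised_Y_diag:
  assumes "raised_to_0 g h" "k < 2 * g"
  shows "raised_to_0 g (ap (wc.Y g k k) h)"
  unfolding raised_to_0_def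
proof (intro allI impI)
  fix m n assume mn: "m < 2 * g" "n < 2 * g" "pos g m < pos g n"
  have 0: "ap (wc.Y g m n) h = 0" using assms(1) mn unfolding raised_to_0_def by blast
  have "ap (wc.Y g k k * wc.Y g m n) h = ap (wc.Y g m n * wc.Y g k k) h + ap ((wc.h g k m - wc.h g k n) * wc.Y g m n) h"
    unfolding wc.Y_diag_comm[OF assms(2) mn(1,2)] by (simp only: ap_add)
  then show "ap (wc.Y g m n) (ap (wc.Y g k k) h) = 0"
    by (simp only: ap_mult 0 ap_zero_right add_0_right)
qed

text \<open>A weight vector is obtained without diagonalisation: among the nonzero elements of
  \<open>U\<close> killed by raising operators, one of smallest support is taken. If it were no
  eigenvector of \<open>wc.Y g k k\<close>, subtracting the eigenvalue of one of its monomials would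
  leave a nonzero element of smaller support.\<close>

lemma top_mem_stable:
  assumes U: "form.subspace U" "Y_stable g U" "U \<subseteq> harm g i j" and "f \<in> U" "f \<noteq> 0" and j: "1 \<le> j" "j \<le> g"
  shows "top_form i j \<in> U"
proof -
  have Uh: "U \<subseteq> homog (2 * g) i j" using U(3) by (auto simp: harm_def coclosed_def prim_def)
  define V where "V = {h \<in> U. h \<noteq> 0 \<and> raised_to_0 g h}"
  obtain h where "h \<in> U" "h \<noteq> 0" "raised_to_0 g h"
    by (rule exists_raised[OF U(2) Uh assms(4,5)])
  then have "h \<in> V" by (simp add: V_def)
  then obtain h where h: "h \<in> V" and min: "\<And>h'. h' \<in> V \<Longrightarrow> card {s. h s \<noteq> 0} \<le> card {s. h' s \<noteq> 0}"
    using ex_has_least_nat[of "\<lambda>h. h \<in> V" h "\<lambda>h. card {s. h s \<noteq> 0}"] by blast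
  have hU: "h \<in> U" "h \<noteq> 0" "raised_to_0 g h" using h by (simp_all add: V_def)
  obtain s where s: "h s \<noteq> 0" by (rule form_nonzero_at[OF hU(2)])
  have fin: "finite {s. h s \<noteq> 0}"
  proof (rule finite_subset[OF _ finite_idx])
    show "{s. h s \<noteq> 0} \<subseteq> idx (2 * g) i j"
      using hU(1) Uh by (auto simp: homog_def simp del: split_paired_All)
  qed
  have eig: "ap (wc.Y g k k) h = fscale (of_int (weight_of g s k)) h" if k: "k < 2 * g" for k
  proof (rule ccontr)
    define u where "u = ap (wc.Y g k k) h - fscale (of_int (weight_of g s k)) h"
    assume "\<not> ?thesis"
    then have "u \<noteq> 0" by (simp add: u_def)
    have us: "u t = of_int (weight_of g t k - weight_of g s k) * h t" for t
      by (simp add: u_def Y_diag_apply[OF k] weight_of_def left_diff_distrib)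
    have "u \<in> U"
      unfolding u_def using U(2) k hU(1) unfolding Y_stable_def
      by (intro form.subspace_diff[OF U(1)] form.subspace_scale[OF U(1)]) blast+
    moreover have "raised_to_0 g u"
      using raised_Y_diag[OF hU(3) k] hU(3) unfolding raised_to_0_def u_def by simp
    ultimately have "u \<in> V" using \<open>u \<noteq> 0\<close> by (simp add: V_def)
    then have "card {s. h s \<noteq> 0} \<le> card {s. u s \<noteq> 0}" by (rule min)
    moreover have "{s. u s \<noteq> 0} \<subset> {s. h s \<noteq> 0}"
    proof
      show "{s. u s \<noteq> 0} \<subseteq> {s. h s \<noteq> 0}" using us by auto
      have "u s = 0" using us[of s] by simp
      then show "{s. u s \<noteq> 0} \<noteq> {s. h s \<noteq> 0}" using s by blast
    qed
    ultimately show False using psubset_card_mono[OF fin] by (meson not_less)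
  qed
  have "h \<in> harm g i j" using hU(1) U(3) by blast
  then obtain c where c: "c \<noteq> 0" "h = fscale c (top_form i j)"
    by (rule raised_weight_vector[OF _ hU(2,3) j eig])
  have "top_form i j = fscale (inverse c) h" unfolding c(2) using c(1) by (simp add: fun_eq_iff)
  then show ?thesis using form.subspace_scale[OF U(1) hU(1)] by metis
qed

text \<open>Gram-Schmidt: \<open>b'\<close> is the part of the new vector orthogonal to the old
  span, and the old projection is corrected by its component along \<open>b'\<close>.\<close>

lemma orthogonal_projection:
  assumes "finite B" "B \<subseteq> homog n i j"
  shows "\<exists>p\<in>form.span B. \<forall>u\<in>form.span B. ip n i j (f - p) u = 0"
  using assms
proof (induction B arbitrary: f rule: finite_induct)
  case empty
  show "\<exists>p\<in>form.span {}. \<forall>u\<in>form.span {}. ip n i j (f - p) u = 0" by (simp add: ip_right(5))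
next
  case (insert b B)
  have B: "B \<subseteq> homog n i j" "b \<in> homog n i j" using insert.prems by auto
  obtain q where q: "q \<in> form.span B" "\<forall>u\<in>form.span B. ip n i j (b - q) u = 0"
    using insert.IH[OF B(1), of b] by blast
  obtain p where p: "p \<in> form.span B" "\<forall>u\<in>form.span B. ip n i j (f - p) u = 0"
    using insert.IH[OF B(1), of f] by blast
  define b' where "b' = b - q"
  have "form.span B \<subseteq> homog n i j" by (rule form.span_minimal[OF B(1) subspace_homog])
  then have b'h: "b' \<in> homog n i j" unfolding b'_def using q(1) by (intro form.subspace_diff[OF subspace_homog B(2)]) (rule subsetD)
  \<comment> \<open>If \<open>b'\<close> is zero, the quotient is 0 by convention and the correction
    term vanishes.\<close>
  define r where "r = ip n i j (f - p) b' / ip n i j b' b'"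
  have mono: "form.span B \<subseteq> form.span (insert b B)" by (intro form.span_mono) auto
  have b'span: "b' \<in> form.span (insert b B)"
    unfolding b'_def by (rule form.span_diff[OF form.span_base[OF insertI1] subsetD[OF mono q(1)]])
  have split: "f - (p + fscale r b') = (f - p) - fscale r b'" by (rule diff_diff_eq[symmetric])
  have 1: "ip n i j (f - (p + fscale r b')) u = 0" if "u \<in> form.span B" for u
  proof -
    have "ip n i j (f - p) u = 0" "ip n i j b' u = 0"
      unfolding b'_def by (rule bspec[OF p(2) that], rule bspec[OF q(2) that])
    then show ?thesis unfolding split ip_left by simp
  qed
  have 2: "ip n i j (f - (p + fscale r b')) b' = 0"
  proof (cases "ip n i j b' b' = 0")
    case True
    then have "b' = 0" by (rule ip_self_eq_0[OF b'h])
    then show ?thesis by (simp add: ip_right)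
  next
    case False
    have "ip n i j (f - (p + fscale r b')) b' = ip n i j (f - p) b' - r * ip n i j b' b'"
      unfolding split ip_left ..
    then show ?thesis using False by (simp add: r_def)
  qed
  have "ip n i j (f - (p + fscale r b')) u = 0" if u: "u \<in> form.span (insert b B)" for u
  proof -
    obtain k where k: "u - fscale k b \<in> form.span B" using u form.span_breakdown_eq by blast
    have v: "u - fscale k b' \<in> form.span B"
    proof -
      have "u - fscale k b' = (u - fscale k b) + fscale k q"
        by (simp add: b'_def form.scale_right_diff_distrib)
      then show ?thesis using form.span_add[OF k form.span_scale[OF q(1)]] by (simp only:)
    qed
    have "ip n i j (f - (p + fscale r b')) u
      = ip n i j (f - (p + fscale r b')) (u - fscale k b') + cnj k * ip n i j (f - (p + fscale r b')) b'"
      unfolding ip_right by simp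
    then show ?thesis by (simp only: 1[OF v] 2 mult_zero_right add_0_right)
  qed
  moreover have "p + fscale r b' \<in> form.span (insert b B)"
    by (rule form.span_add[OF subsetD[OF mono p(1)] form.span_scale[OF b'span]])
  ultimately show "\<exists>p\<in>form.span (insert b B). \<forall>u\<in>form.span (insert b B). ip n i j (f - p) u = 0"
    by (intro bexI ballI)
qed

text \<open>The orthogonal complement of \<open>W\<close> is stable by adjointness. If it were
  nonzero, it would contain the top form by \<open>top_mem_stable\<close>; but that form lies in
  \<open>W\<close> and is not orthogonal to itself.\<close>

lemma stable_containing_top:
  assumes W: "form.subspace W" "Y_stable g W" "W \<subseteq> harm g i j" "top_form i j \<in> W" and j: "1 \<le> j" "j \<le> g"
  shows "W = harm g i j"
proof (intro subset_antisym subsetI)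
  fix f assume f: "f \<in> harm g i j"
  have hh: "harm g i j \<subseteq> homog (2 * g) i j" by (auto simp: harm_def coclosed_def prim_def)
  let ?ip = "ip (2 * g) i j"
  obtain B where B: "B \<subseteq> W" "form.independent B" "W \<subseteq> form.span B"
    using form.maximal_independent_subset by blast
  have "B \<subseteq> form.span (delta ` idx (2 * g) i j)" using B(1) W(3) harm_span by blast
  then have "finite B" using form.independent_span_bound[OF finite_delta B(2)] by blast
  moreover have "B \<subseteq> homog (2 * g) i j" using B(1) W(3) hh by blast
  ultimately obtain p where p: "p \<in> form.span B" "\<forall>u\<in>form.span B. ?ip (f - p) u = 0"
    using orthogonal_projection by blast
  have "form.span B \<subseteq> W" by (rule form.span_minimal[OF B(1) W(1)])
  then have pW: "p \<in> W" using p(1) by blast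
  define N where "N = {h \<in> harm g i j. \<forall>u\<in>W. ?ip h u = 0}"
  have N: "form.subspace N"
    using subspace_harm[of g i j] by (auto simp: N_def form.subspace_def ip_left)
  have "f - p \<in> N"
    unfolding N_def using p(2) B(3) pW W(3) f by (auto intro: form.subspace_diff[OF subspace_harm])
  moreover have "Y_stable g N"
    unfolding Y_stable_def
  proof (intro allI impI ballI)
    fix k l h assume kl: "k < 2 * g" "l < 2 * g" and h: "h \<in> N"
    then have hN: "h \<in> harm g i j" "\<And>u. u \<in> W \<Longrightarrow> ?ip h u = 0" by (auto simp: N_def)
    have "?ip (ap (wc.Y g k l) h) u = 0" if u: "u \<in> W" for u
    proof -
      have "?ip (ap (wc.Y g k l) h) u = ?ip h (ap (wc.Y g l k) u)"
        using hN(1) u W(3) hh by (intro ip_Y kl) auto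
      also have "\<dots> = 0" using W(2) u kl unfolding Y_stable_def by (intro hN(2)) blast
      finally show ?thesis .
    qed
    then show "ap (wc.Y g k l) h \<in> N" unfolding N_def using Y_harm[OF kl hN(1)] by blast
  qed
  ultimately have "top_form i j \<in> N" if "f - p \<noteq> 0"
    using top_mem_stable[OF N _ _ _ that j] by (auto simp: N_def)
  moreover have "top_form i j \<notin> N"
  proof
    assume "top_form i j \<in> N"
    then have "?ip (top_form i j) (top_form i j) = 0" using W(4) by (auto simp: N_def)
    then show False using ip_self_eq_0[OF top_homog[OF j]] top_neq_0 by blast
  qed
  ultimately have "f - p = 0" by blast
  then show "f \<in> W" using pW by simp
qed (use W(3) in blast)

section \<open>Comparison with an abstract irreducible representation\<close>

context vector_space
begin

text \<open>\<open>q M\<close> is the product of A - (c - m) over m = 1, ..., M. For large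
  \<open>M\<close> it kills a given element of the span, whereas it multiplies \<open>x\<close> by
  M!, which is nonzero.\<close>

lemma eigenvector_not_in_span_other_eigenvectors:
  assumes A: "Vector_Spaces.linear scale scale A"
    and x: "x \<in> span {u. \<exists>m\<ge>1. A u = scale (c - of_nat m) u}" and eig: "A x = scale c x"
    and inj: "\<And>m. m \<ge> 1 \<Longrightarrow> of_nat m \<noteq> (0 :: 'a)"
  shows "x = 0"
proof -
  have add: "A (u + w) = A u + A w" and scl: "A (scale r u) = scale r (A u)" for u w r
    using A unfolding Vector_Spaces.linear_iff by blast+
  define q where "q = rec_nat (\<lambda>u. u) (\<lambda>M f u. A (f u) - scale (c - of_nat (Suc M)) (f u))"
  have q0: "q 0 u = u" and qS: "q (Suc M) u = A (q M u) - scale (c - of_nat (Suc M)) (q M u)" for M u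
    by (simp_all add: q_def)
  have q_add: "q M (u + w) = q M u + q M w" for M u w
    by (induction M) (simp_all add: q0 qS add scale_right_distrib)
  have q_scale: "q M (scale r u) = scale r (q M u)" for M u r
    by (induction M) (simp_all add: q0 qS scl scale_right_diff_distrib mult.commute)
  have A0: "A 0 = 0" using scl[of 0 0] by simp
  have vanish: "\<exists>M. \<forall>M'\<ge>M. q M' x = 0"
    using x
  proof (induction rule: span_induct_alt)
    case base
    have "q M 0 = 0" for M by (induction M) (simp_all add: q0 qS A0)
    then show ?case by blast
  next
    case (step r u w)
    then obtain m where m: "m \<ge> 1" "A u = scale (c - of_nat m) u" by blast
    obtain M where M: "\<forall>M'\<ge>M. q M' w = 0" using step.IH by blast
    have eigq: "A (q M' u) = scale (c - of_nat m) (q M' u)" for M'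
      by (induction M') (simp_all add: q0 qS m(2) scl add scale_right_diff_distrib mult.commute
          module_hom.diff[OF module_hom_eq_linear[THEN fun_cong, THEN fun_cong, THEN fun_cong, THEN iffD2, OF A]])
    have "q M' u = 0" if "M' \<ge> m" for M'
      using that
    proof (induction M' rule: dec_induct)
      case base
      obtain p where p: "m = Suc p" using m(1) by (cases m) auto
      show ?case unfolding p qS eigq unfolding p by simp
    next
      case (step M')
      then show ?case by (simp add: qS A0)
    qed
    then have "\<forall>M'\<ge>max m M. q M' (scale r u + w) = 0"
      using M by (simp add: q_add q_scale)
    then show ?case by blast
  qed
  have "\<exists>r. r \<noteq> 0 \<and> q M x = scale r x" for M
  proof (induction M)
    case 0
    then show ?case by (intro exI[of _ 1]) (simp add: q0)
  next
    case (Suc M)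
    then obtain r where r: "r \<noteq> 0" "q M x = scale r x" by blast
    have "q (Suc M) x = scale (of_nat (Suc M) * r) x"
      unfolding qS r(2) scl eig
      by (simp only: scale_scale scale_left_diff_distrib[symmetric]) (simp add: algebra_simps)
    then show ?case using r(1) inj[of "Suc M"] by (intro exI[of _ "of_nat (Suc M) * r"]) (simp del: of_nat_Suc)
  qed
  then obtain M r where "r \<noteq> 0" "scale r x = 0" using vanish by (metis order_refl)
  then show ?thesis by simp
qed

end

lemma ip_top: 
  assumes "1 \<le> j" "j \<le> g"
  shows "\<exists>w. w \<noteq> 0 \<and> (\<forall>f. ip (2 * g) i j f (top_form i j) = w * f (s0 i j))"
proof -
  define w where "w s = (\<Prod>k<2 * g. fact (fst s k) :: complex)" for s :: "(nat \<Rightarrow> nat) \<times> nat set"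
  have "ip (2 * g) i j f (top_form i j) = w (s0 i j) * f (s0 i j)" for f
  proof -
    have "ip (2 * g) i j f (top_form i j) = (\<Sum>s\<in>idx (2 * g) i j. if s = s0 i j then w s * f s else 0)"
      unfolding ip_def w_def by (rule sum.cong[OF refl]) (simp add: delta_def)
    then show ?thesis using s0_idx[OF assms, of i] by simp
  qed
  moreover have "w (s0 i j) \<noteq> 0" by (simp add: w_def)
  ultimately show ?thesis by blast
qed

text \<open>The coefficient at \<open>s0 i j\<close> is, up to a nonzero factor, the pairing with
  the top form; the adjoint of a lowering operator is a raising operator and kills that
  form.\<close>

lemma Y_lower_coeff:
  assumes kl: "k < 2 * g" "l < 2 * g" "pos g l < pos g k" and f: "f \<in> homog (2 * g) i j" and j: "1 \<le> j" "j \<le> g"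
  shows "ap (wc.Y g k l) f (s0 i j) = 0"
proof -
  obtain w where w: "w \<noteq> 0" "\<forall>f. ip (2 * g) i j f (top_form i j) = w * f (s0 i j)" using ip_top[OF j] by blast
  have "ip (2 * g) i j (ap (wc.Y g k l) f) (top_form i j) = ip (2 * g) i j f (ap (wc.Y g l k) (top_form i j))"
    by (rule ip_Y[OF kl(1,2) f top_homog[OF j]])
  also have "\<dots> = 0" unfolding Y_raise_top[OF kl(2,1,3) j] by (rule ip_right(5))
  finally show ?thesis using w by simp
qed

context sp_representation
begin

lemma rep_lin:
  assumes "X \<in> sp g"
  shows "\<rho> X (u + w) = \<rho> X u + \<rho> X w" "\<rho> X (scale c u) = scale c (\<rho> X u)"
  using linear_rep[OF assms] unfolding Vector_Spaces.linear_iff by blast+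

lemma rep_swap:
  assumes "X \<in> sp g" "Y \<in> sp g"
  shows "\<rho> X (\<rho> Y u) = \<rho> Y (\<rho> X u) + \<rho> (lie_bracket X Y) u"
  using rep_bracket[OF assms] by simp

text \<open>The submodule of the direct sum of the given representation and the space of forms that is
  generated by the pair of highest weight vectors; it turns out to be the graph of an isomorphism.\<close>

inductive rel :: "nat \<Rightarrow> nat \<Rightarrow> 'v \<Rightarrow> 'v \<Rightarrow> form \<Rightarrow> bool" for i j v where
  base: "rel i j v v (top_form i j)"
| add: "rel i j v s t \<Longrightarrow> rel i j v s' t' \<Longrightarrow> rel i j v (s + s') (t + t')"
| scale: "rel i j v s t \<Longrightarrow> rel i j v (scale c s) (fscale c t)"
| low: "rel i j v s t \<Longrightarrow> k < 2 * g \<Longrightarrow> l < 2 * g \<Longrightarrow> pos g l < pos g k \<Longrightarrow>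
    rel i j v (\<rho> (Zm g k l) s) (ap (wc.Y g k l) t)"

context
  fixes i j :: nat and v :: 'v
  assumes j: "1 \<le> j" "j \<le> g" and irr: irreducible_rep
    and hwv: "highest_weight_vector (\<lambda>H. of_nat i * fund_weight 1 H + fund_weight j H) v"
begin

lemma rep_raise_v:
  assumes "k < 2 * g" "l < 2 * g" "pos g k < pos g l"
  shows "\<rho> (Zm g k l) v = 0"
proof -
  obtain \<alpha> where "\<alpha> \<in> positive_roots g" "Zm g k l \<in> root_space g \<alpha>" using Zm_root_space[OF assms] by blast
  then show ?thesis using hwv unfolding highest_weight_vector_def by blast
qed

lemma rep_cartan_v: "H \<in> cartan g \<Longrightarrow> \<rho> H v = scale (of_nat i * fund_weight 1 H + fund_weight j H) v"
  using hwv unfolding highest_weight_vector_def by blast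

lemma v_nonzero: "v \<noteq> 0"
  using hwv unfolding highest_weight_vector_def by blast

lemma rel_zero: "rel i j v 0 0"
  using rel.scale[OF rel.base, of i j v 0] by simp

lemma rel_base_sp:
  assumes "X \<in> sp g"
  shows "rel i j v (\<rho> X v) (ap (act g X) (top_form i j))"
proof (rule sp_induct[where Q = "\<lambda>X. rel i j v (\<rho> X v) (ap (act g X) (top_form i j))", OF assms])
  have "0\<^sub>m (2 * g) (2 * g) = 0 \<cdot>\<^sub>m rho_mat g" by (rule eq_matI) (auto simp: rho_mat_def)
  then have "\<rho> (0\<^sub>m (2 * g) (2 * g)) v = 0"
    using rep_smult[OF cartan_sp[OF rho_mat_cartan], of 0 v] by simp
  then show "rel i j v (\<rho> (0\<^sub>m (2 * g) (2 * g)) v) (ap (act g (0\<^sub>m (2 * g) (2 * g))) (top_form i j))"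
    unfolding act_zero ap_zero using rel_zero by simp
next
  fix k l assume kl: "k < 2 * g" "l < 2 * g"
  consider "k = l" | "pos g k < pos g l" | "pos g l < pos g k" using pos_inj[OF kl] by linarith
  then show "rel i j v (\<rho> (Zm g k l) v) (ap (act g (Zm g k l)) (top_form i j))"
  proof cases
    case 1
    show ?thesis
      unfolding 1 rep_cartan_v[OF Zm_diag_cartan[OF kl(2)]] act_cartan_top[OF Zm_diag_cartan[OF kl(2)] j]
      by (rule rel.scale[OF rel.base])
  next
    case 2
    then show ?thesis unfolding rep_raise_v[OF kl 2] act_Zm[OF kl] Y_raise_top[OF kl 2 j] by (intro rel_zero)
  next
    case 3
    then show ?thesis unfolding act_Zm[OF kl] by (rule rel.low[OF rel.base kl])
  qed
next
  fix A B assume "A \<in> sp g" "B \<in> sp g"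
    "rel i j v (\<rho> A v) (ap (act g A) (top_form i j))" "rel i j v (\<rho> B v) (ap (act g B) (top_form i j))"
  then show "rel i j v (\<rho> (A + B) v) (ap (act g (A + B)) (top_form i j))"
    using rel.add by (simp only: rep_add act_add ap_add)
next
  fix c A assume "A \<in> sp g" "rel i j v (\<rho> A v) (ap (act g A) (top_form i j))"
  then show "rel i j v (\<rho> (c \<cdot>\<^sub>m A) v) (ap (act g (c \<cdot>\<^sub>m A)) (top_form i j))"
    using rel.scale by (simp only: rep_smult act_smult ap_mult ap_sc)
qed

text \<open>The rules of \<open>rel\<close> apply lowering operators only. An arbitrary
  \<open>X\<close> is moved inwards past them at the cost of brackets, which are again symplectic,
  until it meets the generating pair, where \<open>rel_base_sp\<close> applies.\<close>

lemma rel_sp: "rel i j v s t \<Longrightarrow> X \<in> sp g \<Longrightarrow> rel i j v (\<rho> X s) (ap (act g X) t)"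
proof (induction arbitrary: X rule: rel.induct)
  case base
  then show ?case by (rule rel_base_sp)
next
  case (add s t s' t')
  show ?case unfolding rep_lin(1)[OF add.prems] ap_add_right by (intro rel.add add.IH add.prems)
next
  case (scale s t c)
  show ?case unfolding rep_lin(2)[OF scale.prems] ap_scale_right by (intro rel.scale scale.IH scale.prems)
next
  case (low s t k l)
  have Z: "Zm g k l \<in> sp g" using low.hyps by (intro Zm_sp)
  have "ap (act g X) (ap (wc.Y g k l) t) = ap (wc.Y g k l) (ap (act g X) t) + ap (act g (lie_bracket X (Zm g k l))) t"
    unfolding act_bracket[OF low.prems Z] act_Zm[OF low.hyps(2,3)] by simp
  then show ?case
    unfolding rep_swap[OF low.prems Z]
    using rel.add[OF rel.low[OF low.IH[OF low.prems] low.hyps(2-4)] low.IH[OF lie_bracket_sp[OF low.prems Z]]]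
    by (simp only:)
qed

lemma rel_harm: "rel i j v s t \<Longrightarrow> t \<in> harm g i j"
proof (induction rule: rel.induct)
  case base
  show ?case by (rule top_harm[OF j])
next
  case (add s t s' t')
  show ?case by (rule form.subspace_add[OF subspace_harm add.IH])
next
  case (scale s t c)
  show ?case by (rule form.subspace_scale[OF subspace_harm scale.IH])
next
  case (low s t k l)
  show ?case by (rule Y_harm[OF low.hyps(2,3) low.IH])
qed

lemma harm_homog: "f \<in> harm g i j \<Longrightarrow> f \<in> homog (2 * g) i j"
  by (simp add: harm_def coclosed_def prim_def)

text \<open>A substitute for the sum of the lower weight spaces that presupposes no decomposition of
  the module: the eigenvalues of \<open>rho_mat g\<close> allowed here are that of \<open>v\<close>
  minus a positive integer.\<close>

definition Vlow :: "'v set" where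
  "Vlow = span {u. \<exists>m\<ge>1. \<rho> (rho_mat g) u =
     scale (of_nat i * fund_weight 1 (rho_mat g) + fund_weight j (rho_mat g) - of_nat m) u}"

lemma VlowI:
  assumes "m \<ge> 1" "\<rho> (rho_mat g) u =
     scale (of_nat i * fund_weight 1 (rho_mat g) + fund_weight j (rho_mat g) - of_nat m) u"
  shows "u \<in> Vlow"
  unfolding Vlow_def by (rule span_base) (rule CollectI, rule exI[of _ m], rule conjI[OF assms])

lemma rep_rho_lower:
  assumes kl: "k < 2 * g" "l < 2 * g" "pos g l < pos g k" and u: "\<rho> (rho_mat g) u = scale a u"
  shows "\<rho> (rho_mat g) (\<rho> (Zm g k l) u) = scale (a - of_nat (2 * (pos g k - pos g l))) (\<rho> (Zm g k l) u)"
proof -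
  note R = cartan_sp[OF rho_mat_cartan, of g] and Z = Zm_sp[OF kl(1,2)]
  have "rho_mat g $$ (k, k) - rho_mat g $$ (l, l) = - of_nat (2 * (pos g k - pos g l))"
    unfolding rho_mat_diag[OF kl(1)] rho_mat_diag[OF kl(2)] using kl(3) by (simp add: of_nat_diff)
  then show ?thesis
    unfolding rep_swap[OF R Z] lie_bracket_cartan[OF rho_mat_cartan kl(1,2)] rep_smult[OF Z] u rep_lin(2)[OF Z]
    by (simp only: scale_left_distrib[symmetric] add_uminus_conv_diff)
qed

lemma Vlow_lower:
  assumes kl: "k < 2 * g" "l < 2 * g" "pos g l < pos g k" and u: "u \<in> Vlow"
  shows "\<rho> (Zm g k l) u \<in> Vlow"
  using u unfolding Vlow_def
proof (induction rule: span_induct_alt)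
  case base
  have "\<rho> (Zm g k l) 0 = 0" using rep_lin(2)[OF Zm_sp[OF kl(1,2)], of 0 0] by simp
  then show ?case by (simp add: span_zero)
next
  case (step c x y)
  then obtain m where m: "m \<ge> 1" "\<rho> (rho_mat g) x = 
     scale (of_nat i * fund_weight 1 (rho_mat g) + fund_weight j (rho_mat g) - of_nat m) x" by blast
  have "\<rho> (rho_mat g) (\<rho> (Zm g k l) x) = scale (of_nat i * fund_weight 1 (rho_mat g) + fund_weight j (rho_mat g)
      - of_nat (m + 2 * (pos g k - pos g l))) (\<rho> (Zm g k l) x)"
    unfolding rep_rho_lower[OF kl m(2)] by (simp add: algebra_simps)
  then have "\<rho> (Zm g k l) x \<in> Vlow"
    by (intro VlowI[of "m + 2 * (pos g k - pos g l)"]) (use m(1) in simp)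
  then show ?case
    unfolding rep_lin[OF Zm_sp[OF kl(1,2)]] Vlow_def by (rule span_add[OF span_scale step.IH])
qed

text \<open>This ties the two components of a pair together: a lowering operator puts the first one
  into \<open>Vlow\<close> and annihilates the top coefficient of the second.\<close>

lemma rel_Vlow: "rel i j v s t \<Longrightarrow> s - scale (t (s0 i j)) v \<in> Vlow"
proof (induction rule: rel.induct)
  case base
  show ?case by (simp add: delta_def Vlow_def span_zero)
next
  case (add s t s' t')
  have "s + s' - scale ((t + t') (s0 i j)) v = (s - scale (t (s0 i j)) v) + (s' - scale (t' (s0 i j)) v)"
    by (simp add: scale_left_distrib)
  then show ?case using add.IH unfolding Vlow_def by (simp only: span_add)
next
  case (scale s t c)
  have "scale c s - scale (fscale c t (s0 i j)) v = scale c (s - scale (t (s0 i j)) v)"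
    by (simp add: scale_right_diff_distrib)
  then show ?case using scale.IH unfolding Vlow_def by (simp only: span_scale)
next
  case (low s t k l)
  note kl = low.hyps(2-4) and Z = Zm_sp[OF low.hyps(2,3)]
  have t0: "ap (wc.Y g k l) t (s0 i j) = 0"
    by (rule Y_lower_coeff[OF kl harm_homog[OF rel_harm[OF low.hyps(1)]] j])
  have "\<rho> (rho_mat g) (\<rho> (Zm g k l) v) = scale (of_nat i * fund_weight 1 (rho_mat g) + fund_weight j (rho_mat g)
      - of_nat (2 * (pos g k - pos g l))) (\<rho> (Zm g k l) v)"
    by (rule rep_rho_lower[OF kl rep_cartan_v[OF rho_mat_cartan]])
  then have "\<rho> (Zm g k l) v \<in> Vlow"
    by (intro VlowI[of "2 * (pos g k - pos g l)"]) (use kl(3) in simp)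
  then have "scale (t (s0 i j)) (\<rho> (Zm g k l) v) + \<rho> (Zm g k l) (s - scale (t (s0 i j)) v) \<in> Vlow"
    using Vlow_lower[OF kl low.IH] unfolding Vlow_def by (rule span_add[OF span_scale])
  moreover have "scale (t (s0 i j)) (\<rho> (Zm g k l) v) + \<rho> (Zm g k l) (s - scale (t (s0 i j)) v) = \<rho> (Zm g k l) s"
    unfolding rep_lin(2)[OF Z, symmetric] rep_lin(1)[OF Z, symmetric] by simp
  ultimately show ?case unfolding t0 by simp
qed

lemma v_notin_Vlow: "v \<notin> Vlow"
proof
  assume "v \<in> Vlow"
  then have "v = 0"
    unfolding Vlow_def
    by (rule eigenvector_not_in_span_other_eigenvectors[OF linear_rep[OF cartan_sp[OF rho_mat_cartan]] _ rep_cartan_v[OF rho_mat_cartan]]) simp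
  then show False using v_nonzero by blast
qed

lemma rel_fst_surj: "\<exists>t. rel i j v s t"
proof -
  have "invariant_subspace {s. \<exists>t. rel i j v s t}"
    unfolding invariant_subspace_def subspace_def using rel_zero rel.add rel.scale rel_sp by blast
  then have "{s. \<exists>t. rel i j v s t} = {0} \<or> {s. \<exists>t. rel i j v s t} = UNIV"
    using irr unfolding irreducible_rep_def by blast
  then show ?thesis using rel.base[of i j v] v_nonzero by blast
qed

text \<open>Such vectors \<open>s\<close> form an invariant subspace. It misses \<open>v\<close>,
  which would otherwise lie in \<open>Vlow\<close> by \<open>rel_Vlow\<close>, so irreducibility
  makes it zero.\<close>

lemma rel_snd_zero: "rel i j v s 0 \<Longrightarrow> s = 0"
proof -
  assume s: "rel i j v s 0"
  have "ap (act g X) 0 = 0" for X by (rule ap_zero_right)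
  then have "invariant_subspace {s. rel i j v s 0}"
    unfolding invariant_subspace_def subspace_def
    using rel_zero rel.add[of i j v _ 0 _ 0] rel.scale[of i j v _ 0] rel_sp[of _ 0] by simp
  moreover have "v \<notin> {s. rel i j v s 0}"
    using rel_Vlow[of v 0] v_notin_Vlow by auto
  ultimately have "{s. rel i j v s 0} = {0}"
    using irr unfolding irreducible_rep_def by blast
  then show ?thesis using s by blast
qed

text \<open>Second components paired with 0 have no top coefficient and are preserved by all
  \<open>wc.Y g k l\<close>. Moving operators across the inner product shows that they are
  orthogonal to every second component, in particular to themselves.\<close>

lemma rel_fst_zero:
  assumes "rel i j v 0 t"
  shows "t = 0"
proof -
  have coeff: "t (s0 i j) = 0" if t: "rel i j v 0 t" for t
  proof (rule ccontr)
    assume "t (s0 i j) \<noteq> 0"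
    moreover have "scale (- (1 / t (s0 i j))) (0 - scale (t (s0 i j)) v) \<in> Vlow"
      using rel_Vlow[OF t] unfolding Vlow_def by (rule span_scale)
    ultimately have "v \<in> Vlow" by simp
    then show False using v_notin_Vlow by blast
  qed
  have orth: "rel i j v s u \<Longrightarrow> rel i j v 0 t \<Longrightarrow> ip (2 * g) i j t u = 0" for s u t
  proof (induction arbitrary: t rule: rel.induct)
    case base
    then show ?case using ip_top[OF j, of i] coeff[OF base] by auto
  next
    case (add s u s' u')
    show "ip (2 * g) i j t (u + u') = 0"
      unfolding ip_right(1) add.IH(1)[OF add.prems] add.IH(2)[OF add.prems] by simp
  next
    case (scale s u c)
    show "ip (2 * g) i j t (fscale c u) = 0"
      unfolding ip_right(4) scale.IH[OF scale.prems] by simp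
  next
    case (low s u k l)
    have Z: "Zm g l k \<in> sp g" using low.hyps by (intro Zm_sp)
    have "\<rho> (Zm g l k) 0 = 0" using rep_lin(2)[OF Z, of 0 0] by simp
    then have "rel i j v 0 (ap (wc.Y g l k) t)"
      using rel_sp[OF low.prems Z] unfolding act_Zm[OF low.hyps(3,2)] by simp
    then have "ip (2 * g) i j (ap (wc.Y g l k) t) u = 0" by (rule low.IH)
    then show ?case
      using ip_Y[OF low.hyps(3,2) harm_homog[OF rel_harm[OF low.prems]] harm_homog[OF rel_harm[OF low.hyps(1)]]] by simp
  qed
  show ?thesis
    by (rule ip_self_eq_0[OF harm_homog[OF rel_harm[OF assms]] orth[OF assms assms]])
qed

lemma rel_unique: "rel i j v s t \<Longrightarrow> rel i j v s t' \<Longrightarrow> t = t'"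
proof -
  assume "rel i j v s t" "rel i j v s t'"
  then have "rel i j v (s + scale (- 1) s) (t + fscale (- 1) t')" by (intro rel.add rel.scale)
  then have "rel i j v 0 (t - t')" by simp
  then show ?thesis using rel_fst_zero by fastforce
qed

lemma snd_rel: "{t. \<exists>s. rel i j v s t} = harm g i j"
proof (rule stable_containing_top[OF _ _ _ _ j])
  show "form.subspace {t. \<exists>s. rel i j v s t}"
    unfolding form.subspace_def using rel_zero rel.add rel.scale by blast
  show "Y_stable g {t. \<exists>s. rel i j v s t}"
    unfolding Y_stable_def
  proof (intro allI impI ballI)
    fix k l f assume kl: "k < 2 * g" "l < 2 * g" and "f \<in> {t. \<exists>s. rel i j v s t}"
    then obtain s where "rel i j v s f" by blast
    from rel_sp[OF this Zm_sp[OF kl]] show "ap (wc.Y g k l) f \<in> {t. \<exists>s. rel i j v s t}"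
      unfolding act_Zm[OF kl] by blast
  qed
  show "{t. \<exists>s. rel i j v s t} \<subseteq> harm g i j" using rel_harm by blast
  show "top_form i j \<in> {t. \<exists>s. rel i j v s t}" using rel.base by blast
qed

lemma dim_eq_dim_harm: "dim (UNIV :: 'v set) = form.dim (harm g i j)"
proof -
  interpret pair: vector_space_pair scale fscale ..
  define \<phi> where "\<phi> s = (THE t. rel i j v s t)" for s
  have \<phi>: "rel i j v s (\<phi> s)" for s
    unfolding \<phi>_def by (rule theI'[OF ex_ex1I[OF rel_fst_surj rel_unique]])
  have \<phi>I: "\<phi> s = t" if "rel i j v s t" for s t
    by (rule rel_unique[OF \<phi> that])
  have lin: "Vector_Spaces.linear scale fscale \<phi>"
    unfolding Vector_Spaces.linear_iff
  proof (intro conjI allI vector_space_axioms form.vector_space_axioms)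
    show "\<phi> (s + s') = \<phi> s + \<phi> s'" for s s' by (rule \<phi>I[OF rel.add[OF \<phi> \<phi>]])
    show "\<phi> (scale c s) = fscale c (\<phi> s)" for c s by (rule \<phi>I[OF rel.scale[OF \<phi>]])
  qed
  have inj: "inj \<phi>"
  proof (rule iffD2[OF pair.linear_inj_iff_eq_0[OF lin]], intro allI impI)
    fix s assume "\<phi> s = 0"
    then have "rel i j v s 0" using \<phi>[of s] by (simp only:)
    then show "s = 0" by (rule rel_snd_zero)
  qed
  have range: "range \<phi> = harm g i j"
    unfolding snd_rel[symmetric]
  proof (intro subset_antisym subsetI CollectI)
    fix t assume "t \<in> range \<phi>"
    then obtain s where "t = \<phi> s" by (rule rangeE)
    then show "\<exists>s. rel i j v s t" using \<phi>[of s] by (intro exI[of _ s]) (simp only:)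
  next
    fix t assume "t \<in> {t. \<exists>s. rel i j v s t}"
    then obtain s where "rel i j v s t" by (elim CollectE exE)
    then have "t = \<phi> s" by (rule \<phi>I[symmetric])
    then show "t \<in> range \<phi>" by (rule range_eqI)
  qed
  obtain B where B': "B \<subseteq> UNIV" "independent B" "UNIV \<subseteq> span B" "card B = dim (UNIV :: 'v set)"
    by (rule basis_exists)
  then have B: "independent B" "span B = UNIV" "card B = dim (UNIV :: 'v set)" by auto
  have "form.independent (\<phi> ` B)"
    by (rule pair.linear_independent_injective_image[OF lin B(1) inj_on_subset[OF inj subset_UNIV]])
  moreover have "form.span (\<phi> ` B) = form.span (harm g i j)"
    unfolding pair.linear_span_image[OF lin] B(2) range form.span_eq_iff[THEN iffD2, OF subspace_harm] ..
  ultimately have "form.dim (harm g i j) = card (\<phi> ` B)" by (intro form.dim_eq_card)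
  also have "\<dots> = card B" by (rule card_image[OF inj_on_subset[OF inj subset_UNIV]])
  finally show ?thesis using B(3) by simp
qed

end

end

theorem lemma3p10:
  fixes g i j :: nat
    and scale :: "complex \<Rightarrow> 'v::ab_group_add \<Rightarrow> 'v"
    and \<rho> :: "complex mat \<Rightarrow> 'v \<Rightarrow> 'v"
  assumes "g \<ge> 1" and "1 \<le> j" and "j \<le> g"
    and "sp_representation scale g \<rho>"
    and "sp_representation.irreducible_rep scale g \<rho>"
    and "sp_representation.has_highest_weight scale g \<rho>
           (\<lambda>H. of_nat i * fund_weight 1 H + fund_weight j H)"
  shows "real (vector_space.dim scale (UNIV :: 'v set)) =
     trinomial (2 * g + i + 1) i j
       * ((2 * real g + 2 - 2 * real j) / (2 * real g + 2 + real i - real j))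
       * (real j / (real i + real j))"
proof -
  interpret sp_representation scale g \<rho> by fact
  obtain v where v: "highest_weight_vector (\<lambda>H. of_nat i * fund_weight 1 H + fund_weight j H) v"
    using assms(6) unfolding has_highest_weight_def by blast
  have "real (dim (UNIV :: 'v set)) = real (form.dim (harm g i j))"
    unfolding dim_eq_dim_harm[OF assms(2,3,5) v] ..
  also have "\<dots> = dim_formula g i j"
    using dim_harm_eq[of g j i] assms(1-3) by simp
  finally show ?thesis unfolding dim_formula_def .
qed

end
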